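(* Let $S\subset\mathbb{R}^d$, $d\in\{2,3\}$, be an $S$-element with scaling center $\mathbf O$, let $k$ be a polynomial degree, and let $\mathcal{D}_k(S)$, $\mathcal{D}_0(S)$, $\mathcal{D}^0_0(S)$ and $\mathbb{S}_k(S)$ be the Duffy and SBFEM spaces defined in the context. Then the orthogonality property $$\langle \phi,\psi\rangle_{\nabla,S}=\int_S\nabla\phi\cdot\nabla\psi\,dS=0\qquad\forall\,\phi\in\mathbb{S}_k(S)\ \text{ and }\ \forall\,\psi\in\mathcal{D}_0(S)$$ is valid. Thus $$\mathcal{D}_k(S)=\mathbb{S}_k(S)\overset{\nabla}{\oplus}\mathcal{D}_0(S)$$ holds, where $\overset{\nabla}{\oplus}$ denotes a sum that is orthogonal with respect to $\langle\cdot,\cdot\rangle_{\nabla,S}$. (This is a mimetic version of the decomposition $H^1(S)=\mathcal{H}(S)\overset{\nabla}{\oplus}H^1_0(S)$, with $\mathcal{H}(S)$ the space of harmonic functions in $S$.)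
   Context: **$S$-element.** $S\subset\mathbb{R}^d$ is a convex polygon ($d=2$) or polyhedron with flat facets ($d=3$), with a point $\mathbf O\in S$ (the scaling center) from which every point of the boundary of $S$ is directly visible. Its scaled boundary is $\Gamma^S=\bigcup_e L^e$, where the facets $L^e$ are segments if $d=2$, and are all triangles or all quadrilaterals if $d=3$. $S$ has a conformal sub-partition into sectors $K^e$ (triangles, tetrahedra or pyramids, all of the same type), each having $\mathbf O$ as a vertex and $L^e$ as the facet opposite to $\mathbf O$. Points of $S$ are represented by a radial coordinate $\xi\in[0,1]$ and a surface coordinate $\mathbf x_b\in\Gamma^S$ through $\mathbf x=\mathbf O+\xi(\mathbf x_b-\mathbf O)$. **Trace space.** Each facet is parametrized by a geometric map $F_{L^e}:\hat L\to L^e$, where $\hat L$ is $[-1,1]$ (segments), the reference triangle (triangles) or $[-1,1]^2$ (quadrilaterals). $V_k(\hat L)$ is the space of polynomials of total degree at most $k$ for the interval and the triangle, and of polynomials of degree at most $k$ in each variable for the square; $V_k(L^e)=\{v\circ F_{L^e}^{-1}:v\in V_k(\hat L)\}$. Set $\Lambda_k(\Gamma^S)=\{\alpha\in C(\Gamma^S):\alpha|_{L^e}\in V_k(L^e)\ \forall e\}$; $\Lambda_0(\Gamma^S)$ consists of the constant functions on $\Gamma^S$. **Duffy spaces.** $\mathcal{D}_k(S)$ is the function space consisting of the $\phi\in H^1(S)$ obtained by radial extension of trace functions, $\phi(\mathbf x)=\rho(\xi)\,\alpha(\mathbf x_b)$ with $\alpha\in\Lambda_k(\Gamma^S)$ and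 a radial function $\rho$ on $[0,1]$ that is the same in all sectors $K^e$ and otherwise arbitrary. $\mathcal{D}_0(S)\subset\mathcal{D}_k(S)$ is the class obtained from constant traces, i.e. functions of the form $C\rho(\xi)$. $\mathcal{D}_0^0(S)\subset\mathcal{D}_0(S)$ is the subspace associated with radial functions $\rho$ vanishing at $\xi=1$. **SBFEM space.** $$\mathbb{S}_k(S)=\{\phi\in\mathcal{D}_k(S):\ \langle\phi,\psi\rangle_{\nabla,S}=0\ \ \forall\,\psi\in\mathcal{D}_0^0(S)\text{ with }\psi(\mathbf O)=0\}.$$ *)

theory Defs
  imports "HOL-Analysis.Analysis" "HOL-Computational_Algebra.Polynomial"
begin

subsection \<open>Facets and their geometric maps\<close>

text \<open>A facet is given by its vertices. The vertices of a quadrilateral are listed in cyclic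
  order, so that its diagonals are \<open>a c\<close> and \<open>b d\<close>.\<close>

datatype (discs_sels) 'a facet =
    Segment 'a 'a
  | Triangle 'a 'a 'a
  | Quadrilateral 'a 'a 'a 'a

fun facet_set :: "'a::euclidean_space facet \<Rightarrow> 'a set" where
  "facet_set (Segment a b) = convex hull {a, b}"
| "facet_set (Triangle a b c) = convex hull {a, b, c}"
| "facet_set (Quadrilateral a b c d) = convex hull {a, b, c, d}"

text \<open>For four points, crossing diagonals and non-collinearity of three vertices say exactly that
  \<open>a, b, c, d\<close> are the cyclically ordered vertices of a flat, strictly convex quadrilateral.\<close>

fun nondegenerate_facet :: "'a::euclidean_space facet \<Rightarrow> bool" where
  "nondegenerate_facet (Segment a b) \<longleftrightarrow> a \<noteq> b"
| "nondegenerate_facet (Triangle a b c) \<longleftrightarrow> \<not> collinear {a, b, c}"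
| "nondegenerate_facet (Quadrilateral a b c d) \<longleftrightarrow>
     open_segment a c \<inter> open_segment b d \<noteq> {} \<and> \<not> collinear {a, b, c}"

definition ref_interval :: "real set" where
  "ref_interval = {-1..1}"

definition ref_triangle :: "(real \<times> real) set" where
  "ref_triangle = {(s, t). 0 \<le> s \<and> 0 \<le> t \<and> s + t \<le> 1}"

definition ref_square :: "(real \<times> real) set" where
  "ref_square = {-1..1} \<times> {-1..1}"

text \<open>The geometric maps are the standard affine (segment, triangle) and bilinear
  (quadrilateral) interpolations of the vertices.\<close>

definition segment_map :: "'a::real_vector \<Rightarrow> 'a \<Rightarrow> real \<Rightarrow> 'a" where
  "segment_map a b t = ((1 - t) / 2) *\<^sub>R a + ((1 + t) / 2) *\<^sub>R b"

definition triangle_map :: "'a::real_vector \<Rightarrow> 'a \<Rightarrow> 'a \<Rightarrow> real \<times> real \<Rightarrow> 'a" where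
  "triangle_map a b c = (\<lambda>(s, t). (1 - s - t) *\<^sub>R a + s *\<^sub>R b + t *\<^sub>R c)"

definition quad_map :: "'a::real_vector \<Rightarrow> 'a \<Rightarrow> 'a \<Rightarrow> 'a \<Rightarrow> real \<times> real \<Rightarrow> 'a" where
  "quad_map a b c d = (\<lambda>(s, t).
       ((1 - s) * (1 - t) / 4) *\<^sub>R a + ((1 + s) * (1 - t) / 4) *\<^sub>R b
     + ((1 + s) * (1 + t) / 4) *\<^sub>R c + ((1 - s) * (1 + t) / 4) *\<^sub>R d)"

subsection \<open>S-elements\<close>

definition sector :: "'a::euclidean_space \<Rightarrow> 'a facet \<Rightarrow> 'a set" where
  "sector z L = convex hull (insert z (facet_set L))"

definition scaled_boundary :: "'a::euclidean_space facet set \<Rightarrow> 'a set" where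
  "scaled_boundary E = (\<Union>L\<in>E. facet_set L)"

text \<open>The scaling center \<open>z\<close> may lie in the interior of \<open>S\<close>, in which case the scaled boundary is
  the whole boundary, or on the boundary, in which case the scaled boundary is made of the facets
  opposite to \<open>z\<close>. Several facets may lie on the same face of \<open>S\<close>.\<close>

definition S_element ::
    "'a::euclidean_space set \<Rightarrow> 'a \<Rightarrow> 'a facet set \<Rightarrow> bool" where
  "S_element S z E \<longleftrightarrow>
     polytope S \<and> interior S \<noteq> {} \<and>
     z \<in> S \<and> (\<forall>y\<in>frontier S. closed_segment z y \<subseteq> S) \<and>
     finite E \<and> (\<forall>L\<in>E. nondegenerate_facet L \<and> facet_set L \<subseteq> frontier S) \<and>
     (DIM('a) = 2 \<and> (\<forall>L\<in>E. is_Segment L) \<or>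
      DIM('a) = 3 \<and> ((\<forall>L\<in>E. is_Triangle L) \<or> (\<forall>L\<in>E. is_Quadrilateral L))) \<and>
     (\<forall>L\<in>E. z \<notin> affine hull (facet_set L)) \<and>
     S = (\<Union>L\<in>E. sector z L) \<and>
     (\<forall>L\<in>E. \<forall>L'\<in>E. L \<noteq> L' \<longrightarrow>
        interior (sector z L) \<inter> interior (sector z L') = {} \<and>
        (sector z L \<inter> sector z L') face_of sector z L \<and>
        (sector z L \<inter> sector z L') face_of sector z L')"

subsection \<open>Trace spaces\<close>

definition poly_interval :: "nat \<Rightarrow> (real \<Rightarrow> real) set" where
  "poly_interval k = {poly p | p. degree p \<le> k}"

definition poly_total_degree :: "nat \<Rightarrow> (real \<times> real \<Rightarrow> real) set" where
  "poly_total_degree k =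
     {(\<lambda>(s, t). \<Sum>i\<le>k. \<Sum>j\<le>k - i. c i j * s ^ i * t ^ j) | c. True}"

definition poly_each_degree :: "nat \<Rightarrow> (real \<times> real \<Rightarrow> real) set" where
  "poly_each_degree k =
     {(\<lambda>(s, t). \<Sum>i\<le>k. \<Sum>j\<le>k. c i j * s ^ i * t ^ j) | c. True}"

text \<open>Functions whose restriction to the facet is \<open>v \<circ> F\<inverse>\<close>, with \<open>F\<close> the geometric map and \<open>v\<close> a
  polynomial on the reference facet; values off the facet are irrelevant.\<close>

fun facet_space :: "nat \<Rightarrow> 'a::euclidean_space facet \<Rightarrow> ('a \<Rightarrow> real) set" where
  "facet_space k (Segment a b) =
     {\<alpha>. \<exists>v\<in>poly_interval k. \<forall>y\<in>facet_set (Segment a b).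
        \<alpha> y = v (inv_into ref_interval (segment_map a b) y)}"
| "facet_space k (Triangle a b c) =
     {\<alpha>. \<exists>v\<in>poly_total_degree k. \<forall>y\<in>facet_set (Triangle a b c).
        \<alpha> y = v (inv_into ref_triangle (triangle_map a b c) y)}"
| "facet_space k (Quadrilateral a b c d) =
     {\<alpha>. \<exists>v\<in>poly_each_degree k. \<forall>y\<in>facet_set (Quadrilateral a b c d).
        \<alpha> y = v (inv_into ref_square (quad_map a b c d) y)}"

text \<open>For \<open>k = 0\<close> the facetwise description also gives the constants, since the scaled boundary of
  an S-element is connected.\<close>

definition trace_space :: "'a::euclidean_space facet set \<Rightarrow> nat \<Rightarrow> ('a \<Rightarrow> real) set" where
  "trace_space E k =
     (if k = 0 then {\<alpha>. \<exists>C. \<forall>y\<in>scaled_boundary E. \<alpha> y = C}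
      else {\<alpha>. continuous_on (scaled_boundary E) \<alpha> \<and> (\<forall>L\<in>E. \<alpha> \<in> facet_space k L)})"

subsection \<open>The Sobolev space and the gradient form\<close>

text \<open>Elements of Sobolev and Duffy spaces are represented by functions on the whole space. Only
  their values almost everywhere on \<open>S\<close> matter, and all spaces below are closed under changing a
  function on a null set or outside \<open>S\<close>. The boundary of the convex set \<open>S\<close> is a null set, so
  integrals over \<open>S\<close> and over its interior coincide.\<close>

definition square_integrable ::
    "'a::euclidean_space set \<Rightarrow> ('a \<Rightarrow> 'b::euclidean_space) \<Rightarrow> bool" where
  "square_integrable S f \<longleftrightarrow>
     f \<in> borel_measurable (lebesgue_on S) \<and> integrable (lebesgue_on S) (\<lambda>x. (norm (f x))\<^sup>2)"

text \<open>Continuously differentiable functions \<open>w\<close> with gradient \<open>Dw\<close> and compact support in the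
  interior of \<open>S\<close>; they define the same weak gradients as smooth test functions.\<close>

definition test_function ::
    "'a::euclidean_space set \<Rightarrow> ('a \<Rightarrow> real) \<Rightarrow> ('a \<Rightarrow> 'a) \<Rightarrow> bool" where
  "test_function S w Dw \<longleftrightarrow>
     (\<forall>x. GDERIV w x :> Dw x) \<and> continuous_on UNIV Dw \<and>
     compact (closure {x. w x \<noteq> 0}) \<and> closure {x. w x \<noteq> 0} \<subseteq> interior S"

definition has_weak_gradient ::
    "'a::euclidean_space set \<Rightarrow> ('a \<Rightarrow> real) \<Rightarrow> ('a \<Rightarrow> 'a) \<Rightarrow> bool" where
  "has_weak_gradient S \<phi> g \<longleftrightarrow>
     square_integrable S \<phi> \<and> square_integrable S g \<and>
     (\<forall>w Dw. test_function S w Dw \<longrightarrow>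
        (LINT x|lebesgue_on S. \<phi> x *\<^sub>R Dw x) = - (LINT x|lebesgue_on S. w x *\<^sub>R g x))"

definition H1 :: "'a::euclidean_space set \<Rightarrow> ('a \<Rightarrow> real) set" where
  "H1 S = {\<phi>. \<exists>g. has_weak_gradient S \<phi> g}"

text \<open>The choice is unique up to a null set.\<close>

definition weak_gradient :: "'a::euclidean_space set \<Rightarrow> ('a \<Rightarrow> real) \<Rightarrow> 'a \<Rightarrow> 'a" where
  "weak_gradient S \<phi> = (SOME g. has_weak_gradient S \<phi> g)"

definition grad_inner ::
    "'a::euclidean_space set \<Rightarrow> ('a \<Rightarrow> real) \<Rightarrow> ('a \<Rightarrow> real) \<Rightarrow> real" where
  "grad_inner S \<phi> \<psi> = (LINT x|lebesgue_on S. weak_gradient S \<phi> x \<bullet> weak_gradient S \<psi> x)"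

subsection \<open>Duffy and SBFEM spaces\<close>

text \<open>Every point \<open>x \<noteq> z\<close> of an S-element is \<open>z + \<xi> (y - z)\<close> for exactly one \<open>\<xi>\<close> in \<open>(0, 1]\<close> and one
  \<open>y\<close> in the scaled boundary.\<close>

definition radial_extension ::
    "'a::euclidean_space set \<Rightarrow> 'a \<Rightarrow> 'a facet set \<Rightarrow>
     (real \<Rightarrow> real) \<Rightarrow> ('a \<Rightarrow> real) \<Rightarrow> ('a \<Rightarrow> real) \<Rightarrow> bool" where
  "radial_extension S z E \<rho> \<alpha> \<phi> \<longleftrightarrow>
     (AE x in lebesgue_on S. \<forall>\<xi>\<in>{0..1}. \<forall>y\<in>scaled_boundary E.
        x = z + \<xi> *\<^sub>R (y - z) \<longrightarrow> \<phi> x = \<rho> \<xi> * \<alpha> y)"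

definition duffy_functions ::
    "'a::euclidean_space set \<Rightarrow> 'a \<Rightarrow> 'a facet set \<Rightarrow> nat \<Rightarrow> ('a \<Rightarrow> real) set" where
  "duffy_functions S z E k =
     {\<phi> \<in> H1 S. \<exists>\<rho>. \<exists>\<alpha>\<in>trace_space E k. radial_extension S z E \<rho> \<alpha> \<phi>}"

text \<open>Products \<open>\<rho>(\<xi>) \<alpha>(y)\<close> are not closed under addition; the Duffy space is the linear space of
  their finite sums.\<close>

definition duffy_space ::
    "'a::euclidean_space set \<Rightarrow> 'a \<Rightarrow> 'a facet set \<Rightarrow> nat \<Rightarrow> ('a \<Rightarrow> real) set" where
  "duffy_space S z E k =
     {(\<lambda>x. \<Sum>i<n. f i x) | (n::nat) f. \<forall>i<n. f i \<in> duffy_functions S z E k}"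

text \<open>Since functions are taken up to null sets, \<open>\<rho>(1) = 0\<close> refers to the representative of \<open>\<rho>\<close>
  that is continuous on \<open>(0, 1]\<close>; it exists for every function in \<open>duffy_space S z E 0\<close>. Continuity
  at \<open>0\<close> would be an extra condition.\<close>

definition duffy_space_00 ::
    "'a::euclidean_space set \<Rightarrow> 'a \<Rightarrow> 'a facet set \<Rightarrow> ('a \<Rightarrow> real) set" where
  "duffy_space_00 S z E =
     {\<psi> \<in> H1 S. \<exists>\<rho>. \<exists>\<alpha>\<in>trace_space E 0. radial_extension S z E \<rho> \<alpha> \<psi> \<and>
        continuous_on {0<..1} \<rho> \<and> \<rho> 1 = 0}"

text \<open>\<open>\<psi>(z) = 0\<close> for a function given up to null sets.\<close>

definition vanishes_at ::
    "'a::euclidean_space set \<Rightarrow> 'a \<Rightarrow> ('a \<Rightarrow> real) \<Rightarrow> bool" where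
  "vanishes_at S z \<psi> \<longleftrightarrow>
     (\<exists>\<psi>'. (AE x in lebesgue_on S. \<psi>' x = \<psi> x) \<and> continuous (at z within S) \<psi>' \<and> \<psi>' z = 0)"

definition sbfem_space ::
    "'a::euclidean_space set \<Rightarrow> 'a \<Rightarrow> 'a facet set \<Rightarrow> nat \<Rightarrow> ('a \<Rightarrow> real) set" where
  "sbfem_space S z E k =
     {\<phi> \<in> duffy_space S z E k.
        \<forall>\<psi>\<in>duffy_space_00 S z E. vanishes_at S z \<psi> \<longrightarrow> grad_inner S \<phi> \<psi> = 0}"

text \<open>The sum need not be direct: the form is degenerate on constants.\<close>

definition grad_orthogonal_sum ::
    "'a::euclidean_space set \<Rightarrow> ('a \<Rightarrow> real) set \<Rightarrow> ('a \<Rightarrow> real) set \<Rightarrow> ('a \<Rightarrow> real) set \<Rightarrow> bool" where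
  "grad_orthogonal_sum S V A B \<longleftrightarrow>
     V = {(\<lambda>x. \<phi> x + \<psi> x) | \<phi> \<psi>. \<phi> \<in> A \<and> \<psi> \<in> B} \<and>
     (\<forall>\<phi>\<in>A. \<forall>\<psi>\<in>B. grad_inner S \<phi> \<psi> = 0)"

end

theory Submission
  imports Defs
begin

text \<open>On \<open>S\<close> the radial coordinate \<open>\<xi>\<close> is the maximum of the affine functions \<open>N\<^sub>L \<bullet> (x - z)\<close>, where
  \<open>N\<^sub>L \<bullet> (y - z) = 1\<close> on the facet \<open>L\<close>, and it pushes the volume of \<open>S\<close> forward to a multiple of
  \<open>t\<^sup>d\<^sup>-\<^sup>1 dt\<close> on \<open>[0, 1]\<close>. A Sobolev function of the form \<open>\<rho>(\<xi>)\<close> has gradient \<open>r(\<xi>) \<nabla>\<xi>\<close> with \<open>r\<close> square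
  integrable for this measure, and every such \<open>r\<close> occurs. Hence the form \<open>\<langle>\<phi>, \<psi>\<rangle>\<close> with \<open>\<psi> \<in> \<D>\<^sub>0\<close> depends on
  \<open>\<phi>\<close> only through the density \<open>h\<close> of the push-forward of \<open>\<nabla>\<phi> \<bullet> \<nabla>\<xi>\<close>. Testing \<open>\<phi> \<in> \<S>\<^sub>k\<close> with \<open>\<kappa>(\<xi>)\<close>,
  \<open>\<kappa>\<close> compactly supported in \<open>(0, 1)\<close>, shows that \<open>t\<^sup>d\<^sup>-\<^sup>1 h(t)\<close> is constant; square integrability of
  \<open>h\<close> and \<open>d \<ge> 2\<close> force the constant to vanish, which gives orthogonality to all of \<open>\<D>\<^sub>0\<close>. For the
  decomposition one subtracts from \<open>\<phi>\<close> the radial function whose radial derivative is the multiple of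
  \<open>h\<close> that cancels the density.\<close>

subsection \<open>Test functions\<close>

text \<open>The obstacle sits at the center: a profile that is square integrable for
  \<open>t^(d-1) dt\<close> may blow up at \<open>\<xi> = 0\<close>, so antiderivatives are based at
  1 and one-dimensional test functions vanish near 0. Homogeneity takes the place of polar
  coordinates: dilations about \<open>z\<close> map \<open>S\<close> onto the sets
  \<open>\<xi> \<le> t\<close>, so a density that is homogeneous under them pushes forward to a
  power of \<open>t\<close>. That every \<open>r\<close> occurs is reduced by Fubini to a divergence
  identity on the sets \<open>\<xi> < t\<close> in which \<open>r\<close> no longer appears, and
  this identity can be tested with Lipschitz functions of \<open>\<xi>\<close>. Conversely, the
  profile \<open>\<rho>\<close> of a radial Sobolev function is arbitrary and need not be
  measurable. A Borel version is read off along one ray, and its weak derivative is found by testing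
  with a field \<open>W(x) (x - z)\<close> supported in a cone inside a single sector, with powers
  of \<open>\<xi>\<close> chosen so that only \<open>\<kappa>'\<close> survives in the divergence.
  One sector is enough because the profile is common to all of them.\<close>

definition C1_with_gradient :: "('a::euclidean_space \<Rightarrow> real) \<Rightarrow> ('a \<Rightarrow> 'a) \<Rightarrow> bool" where
  "C1_with_gradient f D \<longleftrightarrow> (\<forall>x. GDERIV f x :> D x) \<and> continuous_on UNIV D"

lemma C1_with_gradientD:
  assumes "C1_with_gradient f D"
  shows "GDERIV f x :> D x" "continuous_on UNIV D" "continuous_on UNIV f" "continuous_on A f" "continuous_on A D"
proof -
  show "GDERIV f x :> D x" "continuous_on UNIV D"
    using assms by (auto simp: C1_with_gradient_def)
  then show "continuous_on A D" by (rule_tac continuous_on_subset) auto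
  have "isCont f x" for x
    using assms unfolding C1_with_gradient_def gderiv_def
    by (meson has_derivative_continuous)
  then show "continuous_on UNIV f" "continuous_on A f"
    by (auto simp: continuous_at_imp_continuous_on)
qed

lemma C1_with_gradient_const: "C1_with_gradient (\<lambda>x. c) (\<lambda>x. 0)"
  by (auto simp: C1_with_gradient_def GDERIV_const)

lemma C1_with_gradient_inner: "C1_with_gradient (\<lambda>x. (x - p) \<bullet> v) (\<lambda>x. v)"
  unfolding C1_with_gradient_def gderiv_def
  by (auto intro!: derivative_eq_intros continuous_intros)

lemma C1_with_gradient_diff:
  assumes "C1_with_gradient f D" "C1_with_gradient g D'"
  shows "C1_with_gradient (\<lambda>x. f x - g x) (\<lambda>x. D x - D' x)"
  using assms unfolding C1_with_gradient_def
  by (auto intro: GDERIV_diff continuous_intros)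

lemma C1_with_gradient_mult:
  assumes "C1_with_gradient f D" "C1_with_gradient g D'"
  shows "C1_with_gradient (\<lambda>x. f x * g x) (\<lambda>x. f x *\<^sub>R D' x + g x *\<^sub>R D x)"
  using assms C1_with_gradientD(3)[OF assms(1)] C1_with_gradientD(3)[OF assms(2)]
  unfolding C1_with_gradient_def
  by (auto intro!: GDERIV_mult continuous_intros)

lemma C1_with_gradient_compose:
  assumes f: "C1_with_gradient f D" and h: "\<And>t. (h has_real_derivative h' t) (at t)" "continuous_on UNIV h'"
  shows "C1_with_gradient (\<lambda>x. h (f x)) (\<lambda>x. h' (f x) *\<^sub>R D x)"
proof -
  have "continuous_on UNIV (\<lambda>x. h' (f x))"
    by (rule continuous_on_compose2[OF h(2) C1_with_gradientD(3)[OF f]]) auto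
  then show ?thesis
    using f h unfolding C1_with_gradient_def by (auto intro: GDERIV_DERIV_compose intro!: continuous_intros)
qed

lemma C1_with_gradient_prod:
  assumes "finite I" "\<And>i. i \<in> I \<Longrightarrow> \<exists>D. C1_with_gradient (f i) D"
  shows "\<exists>D. C1_with_gradient (\<lambda>x. \<Prod>i\<in>I. f i x) D"
  using assms
proof (induction I rule: finite_induct)
  case empty
  then show ?case using C1_with_gradient_const[of 1] by auto
next
  case (insert i I)
  then obtain D D' where "C1_with_gradient (f i) D" "C1_with_gradient (\<lambda>x. \<Prod>i\<in>I. f i x) D'"
    by (metis insertCI)
  from C1_with_gradient_mult[OF this] show ?case using insert(1,2) by auto
qed

lemma test_function_alt:
  "test_function S w D \<longleftrightarrow> C1_with_gradient w D \<and> compact (closure {x. w x \<noteq> 0}) \<and>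
     closure {x. w x \<noteq> 0} \<subseteq> interior S"
  by (auto simp: test_function_def C1_with_gradient_def)

lemma test_functionI:
  assumes "C1_with_gradient w D" "compact K" "K \<subseteq> interior S" "\<And>x. x \<notin> K \<Longrightarrow> w x = 0"
  shows "test_function S w D"
proof -
  have "closure {x. w x \<noteq> 0} \<subseteq> K"
    using assms by (intro closure_minimal) (auto intro: compact_imp_closed)
  moreover have "compact (closure {x. w x \<noteq> 0})"
    using \<open>closure {x. w x \<noteq> 0} \<subseteq> K\<close> assms(2) 
    by (metis closed_Int_compact closed_closure inf.absorb_iff1)
  ultimately show ?thesis using assms by (auto simp: test_function_alt)
qed

text \<open>The gradient vanishes off the support because \<open>w\<close> is zero on a whole
  neighbourhood there and derivatives are unique. Both \<open>w\<close> and its gradient are thus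
  bounded with the same compact support.\<close>

lemma test_functionD:
  assumes "test_function S w D"
  shows "C1_with_gradient w D"
    "\<exists>K. compact K \<and> K \<subseteq> interior S \<and> (\<forall>x. x \<notin> K \<longrightarrow> w x = 0 \<and> D x = 0)"
proof -
  let ?K = "closure {x. w x \<noteq> 0}"
  show c: "C1_with_gradient w D" using assms by (auto simp: test_function_alt)
  have "D x = 0" if "x \<notin> ?K" for x
  proof -
    have "(w has_derivative (\<lambda>h. h \<bullet> D x)) (at x)"
      using C1_with_gradientD(1)[OF c] by (simp add: gderiv_def)
    moreover have "(w has_derivative (\<lambda>h. 0)) (at x)"
    proof (rule has_derivative_transform_within_open[where f="\<lambda>_. 0" and s="- ?K"])
      show "0 = w y" if "y \<in> - ?K" for y
        using that closure_subset[of "{x. w x \<noteq> 0}"] by auto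
    qed (use that in auto)
    ultimately have "(\<lambda>h. h \<bullet> D x) = (\<lambda>h. 0)" by (rule has_derivative_unique)
    then have "D x \<bullet> D x = 0" by meson
    then show "D x = 0" by simp
  qed
  moreover have "w x = 0" if "x \<notin> ?K" for x
    using that closure_subset[of "{x. w x \<noteq> 0}"] by auto
  ultimately show "\<exists>K. compact K \<and> K \<subseteq> interior S \<and> (\<forall>x. x \<notin> K \<longrightarrow> w x = 0 \<and> D x = 0)"
    using assms unfolding test_function_alt by blast
qed

text \<open>The squared positive part is the basic cutoff of the development: it is once
  continuously differentiable, which is exactly the regularity asked of test functions.\<close>

lemma square_max_deriv: "((\<lambda>s::real. (max 0 s)\<^sup>2) has_real_derivative 2 * max 0 t) (at t)"
proof (cases "t = 0")
  case True
  have "((\<lambda>h::real. (max 0 h)\<^sup>2 / h) \<longlongrightarrow> 0) (at 0)"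
  proof (rule Lim_null_comparison)
    show "eventually (\<lambda>h::real. norm ((max 0 h)\<^sup>2 / h) \<le> \<bar>h\<bar>) (at 0)"
      by (auto simp: eventually_at_filter max_def power2_eq_square divide_simps)
    show "((\<lambda>h::real. \<bar>h\<bar>) \<longlongrightarrow> 0) (at 0)" by (auto intro!: tendsto_eq_intros)
  qed
  then show ?thesis using True by (simp add: DERIV_def)
next
  case False
  then consider "t > 0" | "t < 0" by linarith
  then show ?thesis
  proof cases
    case 1
    have "((\<lambda>s::real. s\<^sup>2) has_real_derivative 2 * max 0 t) (at t)"
      using 1 by (auto intro!: derivative_eq_intros)
    then show ?thesis
      by (rule has_field_derivative_transform_within_open[where S="{0<..}"]) (use 1 in auto)
  next
    case 2
    have "((\<lambda>s::real. 0) has_real_derivative 2 * max 0 t) (at t)"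
      using 2 by (auto intro!: derivative_eq_intros)
    then show ?thesis
      by (rule has_field_derivative_transform_within_open[where S="{..<0}"]) (use 2 in auto)
  qed
qed

lemma C1_with_gradient_square_max:
  assumes "C1_with_gradient f D"
  shows "C1_with_gradient (\<lambda>x. (max 0 (f x))\<^sup>2) (\<lambda>x. (2 * max 0 (f x)) *\<^sub>R D x)"
  by (rule C1_with_gradient_compose[OF assms square_max_deriv]) (auto intro!: continuous_intros)

lemma box_test_function_sequence:
  fixes a b :: "'a::euclidean_space"
  obtains w D where "\<And>n::nat. C1_with_gradient (w n) (D n)" "\<And>n x. x \<notin> box a b \<Longrightarrow> w n x = 0"
    "\<And>n x. 0 \<le> w n x" "\<And>n x. w n x \<le> 1" "\<And>x. (\<lambda>n. w n x) \<longlonglongrightarrow> indicator (box a b) x"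
proof -
  \<comment> \<open>A product of cutoffs in the coordinate directions, positive exactly on the open
    box.\<close>
  define P where "P x = (\<Prod>i\<in>Basis. (max 0 ((x - a) \<bullet> i))\<^sup>2 * (max 0 (0 - (x - b) \<bullet> i))\<^sup>2)" for x
  have "\<exists>D. C1_with_gradient P D"
    unfolding P_def
    by (rule C1_with_gradient_prod[OF finite_Basis])
      (rule exI, rule C1_with_gradient_mult[OF C1_with_gradient_square_max[OF C1_with_gradient_inner]
          C1_with_gradient_square_max[OF C1_with_gradient_diff[OF C1_with_gradient_const C1_with_gradient_inner]]])
  then obtain D where D: "C1_with_gradient P D" by blast
  have P0: "0 \<le> P x" for x unfolding P_def by (intro prod_nonneg) auto
  have Ppos: "P x > 0 \<longleftrightarrow> x \<in> box a b" for x
  proof -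
    have "P x \<noteq> 0 \<longleftrightarrow> x \<in> box a b"
    proof -
      have "(max 0 ((x - a) \<bullet> i))\<^sup>2 * (max 0 (0 - (x - b) \<bullet> i))\<^sup>2 \<noteq> 0 \<longleftrightarrow> a \<bullet> i < x \<bullet> i \<and> x \<bullet> i < b \<bullet> i" for i
        by (auto simp: inner_diff_left max_def)
      then show ?thesis
        unfolding P_def mem_box by (simp only: prod_zero_iff finite_Basis) blast
    qed
    then show ?thesis using P0[of x] by linarith
  qed
  \<comment> \<open>\<open>q n s\<close> equals \<open>n s^2 / (1 + n s^2)\<close>, which vanishes
    at 0 and tends to 1 for every other \<open>s\<close>. The square keeps the denominator positive
    on the whole line, so that \<open>q n\<close> can be composed with \<open>P\<close>.\<close>
  define q where "q n s = 1 - inverse (1 + real n * s\<^sup>2)" for n and s :: real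
  have pos: "1 + real n * s\<^sup>2 \<noteq> 0" "1 + real n * s\<^sup>2 > 0" for n s
  proof -
    have "0 \<le> real n * s\<^sup>2" by simp
    then show "1 + real n * s\<^sup>2 \<noteq> 0" "1 + real n * s\<^sup>2 > 0" by linarith+
  qed
  have dq: "(q n has_real_derivative 2 * real n * s * (inverse (1 + real n * s\<^sup>2))\<^sup>2) (at s)" for n s
  proof -
    have "((\<lambda>s. 1 + real n * s\<^sup>2) has_real_derivative real n * (2 * s)) (at s)"
      by (auto intro!: derivative_eq_intros)
    from DERIV_diff[OF DERIV_const[of 1] DERIV_inverse_fun[OF this pos(1)]]
    show ?thesis by (simp add: q_def[abs_def] power2_eq_square mult_ac)
  qed
  have cq: "continuous_on UNIV (\<lambda>s. 2 * real n * s * (inverse (1 + real n * s\<^sup>2))\<^sup>2)" for n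
    using pos by (auto intro!: continuous_intros)
  show ?thesis
  proof (rule that[of "\<lambda>n x. q n (P x)"])
    show "C1_with_gradient (\<lambda>x. q n (P x)) (\<lambda>x. (2 * real n * P x * (inverse (1 + real n * (P x)\<^sup>2))\<^sup>2) *\<^sub>R D x)" for n
      by (rule C1_with_gradient_compose[OF D dq cq])
    show "q n (P x) = 0" if "x \<notin> box a b" for n x
      using that Ppos[of x] P0[of x] by (simp add: q_def)
    show "0 \<le> q n (P x)" "q n (P x) \<le> 1" for n x
      using pos[of n "P x"] by (auto simp: q_def inverse_le_1_iff)
    show "(\<lambda>n. q n (P x)) \<longlonglongrightarrow> indicator (box a b) x" for x
    proof (cases "x \<in> box a b")
      case False
      then show ?thesis using Ppos[of x] P0[of x] by (simp add: q_def)
    next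
      case True
      then have "(P x)\<^sup>2 > 0" using Ppos[of x] by simp
      have "filterlim (\<lambda>n. (P x)\<^sup>2 * real n) at_top sequentially"
        by (rule filterlim_tendsto_pos_mult_at_top[OF tendsto_const \<open>(P x)\<^sup>2 > 0\<close> filterlim_real_sequentially])
      then have "filterlim (\<lambda>n. 1 + (P x)\<^sup>2 * real n) at_top sequentially"
        by (rule filterlim_tendsto_add_at_top[OF tendsto_const])
      then have "(\<lambda>n. inverse (1 + (P x)\<^sup>2 * real n)) \<longlonglongrightarrow> 0"
        by (rule tendsto_inverse_0_at_top)
      then have "(\<lambda>n. 1 - inverse (1 + (P x)\<^sup>2 * real n)) \<longlonglongrightarrow> 1 - 0"
        by (intro tendsto_intros)
      then show ?thesis using True by (simp add: q_def mult.commute)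
    qed
  qed
qed

section \<open>The fundamental lemma of the calculus of variations\<close>

lemma AE_zero_if_box_integrals_zero:
  fixes f :: "'a::euclidean_space \<Rightarrow> real"
  assumes f: "integrable lborel f"
    and box0: "\<And>a b. set_lebesgue_integral lborel (box a b) f = 0"
  shows "AE x in lborel. f x = 0"
proof (rule sigma_finite_measure.density_zero[OF lborel.sigma_finite_measure_axioms f])
  have sint: "set_integrable lborel A f" if "A \<in> sets borel" for A
    using that integrable_mult_indicator[OF _ f, of A] by (simp add: set_integrable_def)
  \<comment> \<open>The whole space is not a box; its integral is the limit over growing boxes. It
    is needed for the complement case of the Dynkin argument below, which runs over the
    intersection-stable generator of boxes.\<close>
  have U: "set_lebesgue_integral lborel UNIV f = 0"
  proof -
    let ?B = "\<lambda>n::nat. box (- real n *\<^sub>R One) (real n *\<^sub>R One) :: 'a set"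
    have U: "(\<Union>n. ?B n) = UNIV"
      using UN_box_eq_UNIV by simp
    have "(\<lambda>n. set_lebesgue_integral lborel (?B n) f) \<longlonglongrightarrow> set_lebesgue_integral lborel (\<Union>n. ?B n) f"
    proof (rule set_integral_cont_up)
      show "incseq ?B"
      proof (rule incseq_SucI, rule subsetI)
        fix n x assume "x \<in> ?B n"
        then have "- real n < x \<bullet> i \<and> x \<bullet> i < real n" if "i \<in> Basis" for i
          using that by (simp add: mem_box)
        then show "x \<in> ?B (Suc n)" by (fastforce simp: mem_box)
      qed
      show "set_integrable lborel (\<Union>n. ?B n) f" by (rule sint) auto
    qed auto
    then show ?thesis unfolding box0 U by (simp add: LIMSEQ_const_iff)
  qed
  fix A :: "'a set" assume A: "A \<in> sets lborel"
  have "box a b \<inter> box c d \<in> range (\<lambda>(a, b). box a b)" for a b c d :: 'a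
    unfolding box_Int_box by auto
  then have "Int_stable (range (\<lambda>(a, b). box a b :: 'a set))"
    by (auto simp: Int_stable_def)
  moreover have "(range (\<lambda>(a, b). box a b :: 'a set)) \<subseteq> Pow UNIV"
    by auto
  moreover have "A \<in> sigma_sets UNIV (range (\<lambda>(a, b). box a b))"
    using A by (simp add: borel_eq_box)
  ultimately show "set_lebesgue_integral lborel A f = 0"
  proof (induction rule: sigma_sets_induct_disjoint)
    case (basic A)
    then show ?case using box0 by auto
  next
    case empty
    then show ?case by (simp add: set_lebesgue_integral_def)
  next
    case (compl A)
    then have A: "A \<in> sets borel" by (simp add: borel_eq_box)
    have "set_lebesgue_integral lborel (A \<union> (UNIV - A)) f =
        set_lebesgue_integral lborel A f + set_lebesgue_integral lborel (UNIV - A) f"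
      by (rule set_integral_Un) (use A in \<open>auto intro!: sint\<close>)
    then show ?case using U compl by simp
  next
    case (union A)
    then have A: "A i \<in> sets borel" for i by (auto simp: borel_eq_box)
    have "set_lebesgue_integral lborel (\<Union>i. A i) f = (\<Sum>i. set_lebesgue_integral lborel (A i) f)"
    proof (rule lebesgue_integral_countable_add)
      show "set_integrable lborel (\<Union>i. A i) f"
        using A by (intro sint sets.countable_UN) auto
      show "A i \<in> sets lborel" for i using A by simp
      show "A i \<inter> A j = {}" if "i \<noteq> j" for i j
        using union(1) that by (simp add: disjoint_family_on_def)
    qed
    then show ?case using union by simp
  qed
qed

lemma integrable_test_mult:
  fixes f w :: "'a::euclidean_space \<Rightarrow> real"
  assumes f: "set_integrable lebesgue (cbox a b) f" and w: "w \<in> borel_measurable lborel" "\<And>x. \<bar>w x\<bar> \<le> B" "\<And>x. x \<notin> cbox a b \<Longrightarrow> w x = 0"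
  shows "integrable lebesgue (\<lambda>x. w x * f x)"
proof -
  have "integrable lebesgue (\<lambda>x. w x * (indicator (cbox a b) x *\<^sub>R f x))"
  proof (rule Bochner_Integration.integrable_bound)
    show "integrable lebesgue (\<lambda>x. B * (indicator (cbox a b) x *\<^sub>R f x))"
      using f by (intro integrable_mult_right) (simp add: set_integrable_def)
    show "(\<lambda>x. w x * (indicator (cbox a b) x *\<^sub>R f x)) \<in> borel_measurable lebesgue"
      using f w(1) by (intro borel_measurable_times)
         (auto simp: set_integrable_def intro: measurable_completion borel_measurable_integrable)
    show "AE x in lebesgue. norm (w x * (indicator (cbox a b) x *\<^sub>R f x)) \<le> norm (B * (indicator (cbox a b) x *\<^sub>R f x))"
    proof (rule AE_I2)
      fix x
      have "\<bar>w x\<bar> \<le> \<bar>B\<bar>" using w(2)[of x] by linarith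
      then show "norm (w x * (indicator (cbox a b) x *\<^sub>R f x)) \<le> norm (B * (indicator (cbox a b) x *\<^sub>R f x))"
        by (simp add: abs_mult mult_right_mono)
    qed
  qed
  moreover have "(\<lambda>x. w x * (indicator (cbox a b) x *\<^sub>R f x)) = (\<lambda>x. w x * f x)"
    using w(3) by (force simp: indicator_def)
  ultimately show ?thesis by simp
qed

text \<open>Test functions increasing to the indicator of a box show, by dominated convergence, that
  all box integrals vanish. This gives \<open>f = 0\<close> almost everywhere on each box inside
  \<open>U\<close>, and countably many boxes cover \<open>U\<close>.\<close>

proposition AE_zero_if_test_integrals_zero:
  fixes f :: "'a::euclidean_space \<Rightarrow> real"
  assumes U: "open U"
    and f: "\<And>a b. cbox a b \<subseteq> U \<Longrightarrow> set_integrable lebesgue (cbox a b) f"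
    and zero: "\<And>w D. test_function U w D \<Longrightarrow> (LINT x|lebesgue. w x * f x) = 0"
  shows "AE x in lebesgue. x \<in> U \<longrightarrow> f x = 0"
proof -
  have box0: "(LINT x|lebesgue. indicator (box a b) x * f x) = 0" if ab: "cbox a b \<subseteq> U" for a b
  proof -
    obtain w D where w: "\<And>n::nat. C1_with_gradient (w n) (D n)" "\<And>n x. x \<notin> box a b \<Longrightarrow> w n x = 0"
      "\<And>n x. 0 \<le> w n x" "\<And>n x. w n x \<le> 1" "\<And>x. (\<lambda>n. w n x) \<longlonglongrightarrow> indicator (box a b) x"
      using box_test_function_sequence by blast
    have w_out: "w n x = 0" if "x \<notin> cbox a b" for n x
      using w(2)[of x n] box_subset_cbox[of a b] that by blast
    have meas: "w n \<in> borel_measurable lborel" for n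
      using C1_with_gradientD(3)[OF w(1)] by (simp add: borel_measurable_continuous_onI)
    have int: "integrable lebesgue (\<lambda>x. w n x * f x)" for n
      by (rule integrable_test_mult[OF f[OF ab] meas, where B=1]) (use w w_out in auto)
    have "(LINT x|lebesgue. w n x * f x) = 0" for n
      by (rule zero, rule test_functionI[OF w(1), of "cbox a b"]) (use ab U w_out in \<open>auto simp: interior_open\<close>)
    moreover have "(\<lambda>n. LINT x|lebesgue. w n x * f x) \<longlonglongrightarrow> (LINT x|lebesgue. indicator (box a b) x * f x)"
    proof (rule integral_dominated_convergence)
      show "integrable lebesgue (\<lambda>x. norm (indicator (box a b) x * f x))"
        by (intro integrable_norm integrable_test_mult[OF f[OF ab], where B=1])
          (use box_subset_cbox[of a b] in \<open>auto simp: indicator_def\<close>)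
      then show "(\<lambda>x. indicator (box a b) x * f x) \<in> borel_measurable lebesgue"
        using integrable_test_mult[OF f[OF ab], where w="indicator (box a b)" and B=1] box_subset_cbox[of a b]
        by (auto simp: indicator_def)
      show "(\<lambda>x. w n x * f x) \<in> borel_measurable lebesgue" for n using int[of n] by auto
      show "AE x in lebesgue. (\<lambda>n. w n x * f x) \<longlonglongrightarrow> indicator (box a b) x * f x"
        by (intro AE_I2 tendsto_intros w)
      show "AE x in lebesgue. norm (w n x * f x) \<le> norm (indicator (box a b) x * f x)" for n
      proof (rule AE_I2)
        fix x
        show "norm (w n x * f x) \<le> norm (indicator (box a b) x * f x)"
          using w(2)[of x n] w(3)[of n x] w(4)[of n x]
          by (auto simp: indicator_def abs_mult intro: mult_left_le_one_le)
      qed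
    qed
    ultimately show ?thesis by (simp add: LIMSEQ_const_iff)
  qed
  have on_box: "AE x in lebesgue. x \<in> box a b \<longrightarrow> f x = 0" if ab: "cbox a b \<subseteq> U" for a b
  proof -
    let ?F = "\<lambda>x. indicator (box a b) x * f x"
    have F: "integrable lebesgue ?F"
      by (intro integrable_test_mult[OF f[OF ab], where B=1])
         (use box_subset_cbox[of a b] in \<open>auto simp: indicator_def\<close>)
    \<comment> \<open>\<open>f\<close> is only Lebesgue measurable, while the criterion on box
      integrals concerns Borel functions; hence the passage to a Borel version.\<close>
    obtain F' where F': "F' \<in> borel_measurable lborel" "AE x in lborel. ?F x = F' x"
      using completion_ex_borel_measurable_real[of ?F lborel] F by auto
    have F'i: "integrable lborel F'"
    proof -
      have "F' \<in> borel_measurable lebesgue" using F'(1) by (rule measurable_completion)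
      then have "integrable lebesgue F'"
        using F AE_completion[OF F'(2)] integrable_cong_AE[of ?F lebesgue F'] by auto
      then show ?thesis using F'(1) by (simp add: integrable_completion)
    qed
    have "AE x in lborel. F' x = 0"
    proof (rule AE_zero_if_box_integrals_zero[OF F'i])
      fix c d :: 'a
      obtain p q where pq: "box a b \<inter> box c d = box p q" unfolding box_Int_box by blast
      have 0: "(LINT x|lebesgue. indicator (box p q) x * f x) = 0"
      proof (cases "box p q = {}")
        case False
        then have "cbox p q = closure (box p q)" by simp
        also have "\<dots> \<subseteq> closure (box a b)" using pq by (intro closure_mono) auto
        also have "\<dots> \<subseteq> cbox a b" by (intro closure_minimal box_subset_cbox closed_cbox)
        finally show ?thesis using ab by (intro box0) auto
      qed simp
      have "set_lebesgue_integral lborel (box c d) F' = (LINT x|lebesgue. indicator (box c d) x * F' x)"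
        unfolding set_lebesgue_integral_def
        by (subst integral_completion) (use F'(1) in auto)
      also have "\<dots> = (LINT x|lebesgue. indicator (box c d) x * ?F x)"
      proof (rule integral_cong_AE)
        show "AE x in lebesgue. indicator (box c d) x * F' x = indicator (box c d) x * ?F x"
          using AE_completion[OF F'(2)] by eventually_elim simp
        show "(\<lambda>x. indicator (box c d) x * F' x) \<in> borel_measurable lebesgue"
          using F'(1) by (intro measurable_completion) auto
        show "(\<lambda>x. indicator (box c d) x * ?F x) \<in> borel_measurable lebesgue"
          by (intro borel_measurable_times[OF _ borel_measurable_integrable[OF F]] measurable_completion) simp
      qed
      also have "(\<lambda>x. indicator (box c d) x * ?F x) = (\<lambda>x. indicator (box p q) x * f x)"
        unfolding pq[symmetric] by (auto simp: indicator_def)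
      finally show "set_lebesgue_integral lborel (box c d) F' = 0" using 0 by simp
    qed
    then have "AE x in lborel. ?F x = 0" using F'(2) by eventually_elim simp
    then show ?thesis
      by (intro AE_completion) (auto elim: eventually_mono simp: indicator_def)
  qed
  \<comment> \<open>The covering boxes are closed and the previous step speaks of open ones; the
    faces of each box form a null set.\<close>
  obtain \<D> where \<D>: "countable \<D>" "\<D> \<subseteq> Pow U" "\<And>X. X \<in> \<D> \<Longrightarrow> \<exists>a b. X = cbox a b" "\<Union>\<D> = U"
    using open_countable_Union_open_cbox[OF U] by metis
  have "AE x in lebesgue. x \<in> X \<longrightarrow> f x = 0" if XD: "X \<in> \<D>" for X
  proof -
    obtain a b where X: "X = cbox a b" using \<D>(3)[OF XD] by blast
    have "AE x in lebesgue. x \<notin> frontier (cbox a b)"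
      using negligible_frontier_interval[of a b] unfolding frontier_cbox
      by (intro AE_not_in) (simp add: negligible_iff_null_sets)
    moreover have "AE x in lebesgue. x \<in> box a b \<longrightarrow> f x = 0"
      using XD \<D>(2) X by (intro on_box) auto
    ultimately show ?thesis
      unfolding X by eventually_elim (auto simp: frontier_cbox split: if_splits)
  qed
  then have "AE x in lebesgue. \<forall>X\<in>\<D>. x \<in> X \<longrightarrow> f x = 0"
    by (subst AE_ball_countable[OF \<D>(1)]) blast
  then show ?thesis
    by eventually_elim (use \<D>(4) in auto)
qed

subsection \<open>Functions of one variable and push-forwards of densities\<close>

text \<open>\<open>F\<close> is the integral from 0. To the right of \<open>b\<close> it equals the
  total mass of \<open>f\<close>, hence the condition on the integral in the second clause. The
  clause is conditional because the antiderivative is also wanted for \<open>f\<close> of non-zero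
  mass.\<close>

lemma has_antiderivative_compact_support:
  fixes f :: "real \<Rightarrow> real"
  assumes f: "continuous_on UNIV f" and ab: "0 < a" "b < 1" "\<And>t. t \<notin> {a..b} \<Longrightarrow> f t = 0"
  obtains F where "\<And>t. (F has_real_derivative f t) (at t)"
    "\<And>t. integral {0..1} f = 0 \<Longrightarrow> t \<notin> {a..b} \<Longrightarrow> F t = 0"
proof
  let ?F = "\<lambda>t. integral {0..t} f"
  have fi: "f integrable_on {c..d}" for c d
    by (intro integrable_continuous_interval continuous_on_subset[OF f]) auto
  have F0: "?F t = 0" if "t < a" for t
    using that ab(3) by (intro integral_unique has_integral_is_0) auto
  show "?F t = 0" if int: "integral {0..1} f = 0" and "t \<notin> {a..b}" for t
  proof (cases "t < a")
    case False
    then have t: "b < t" "0 < t" using that ab(1) by auto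
    show ?thesis
    proof (cases "t \<le> 1")
      case True
      have "integral {0..t} f + integral {t..1} f = integral {0..1} f"
        using True t by (intro Henstock_Kurzweil_Integration.integral_combine fi) auto
      moreover have "integral {t..1} f = 0"
        using t ab(3) by (intro integral_unique has_integral_is_0) auto
      ultimately show ?thesis using int by simp
    next
      case False
      then have "integral {0..1} f + integral {1..t} f = integral {0..t} f"
        using t by (intro Henstock_Kurzweil_Integration.integral_combine fi) auto
      moreover have "integral {1..t} f = 0"
        using ab(2,3) by (intro integral_unique has_integral_is_0) auto
      ultimately show ?thesis using int by simp
    qed
  qed (use F0 in auto)
  show "(?F has_real_derivative f t) (at t)" for t
  proof (cases "t < a")
    case True
    have "((\<lambda>_. 0) has_real_derivative f t) (at t)"
      using ab(3)[of t] True by simp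
    then show ?thesis
      by (rule has_field_derivative_transform_within_open[where S="{..<a}"]) (use True F0 in auto)
  next
    case False
    then have t: "t \<in> {0<..<t+1}" using ab(1) by auto
    have "(?F has_real_derivative f t) (at t within {0..t+1})"
      using t by (intro integral_has_real_derivative continuous_on_subset[OF f]) auto
    then have "(?F has_real_derivative f t) (at t within {0<..<t+1})"
      by (rule DERIV_subset) auto
    then show ?thesis
      using t by (simp add: at_within_open[OF t])
  qed
qed

text \<open>The bounds \<open>a \<le> 1/4\<close> and \<open>3/4 \<le> b\<close> make the interval
  contain the support of the bump in \<open>unit_mass_bump\<close> as well, so that combinations of
  a test function with this bump are supported in \<open>{a..b}\<close>.\<close>

lemma compact_subset_unit_interval:
  fixes K :: "real set"
  assumes K: "compact K" "K \<subseteq> {0<..<1}"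
  obtains a b where "0 < a" "b < 1" "K \<subseteq> {a..b}" "a \<le> 1/4" "3/4 \<le> b"
proof (cases "K = {}")
  case True
  show ?thesis by (rule that[of "1/4" "3/4"]) (use True in auto)
next
  case False
  obtain l where l: "l \<in> K" "\<And>t. t \<in> K \<Longrightarrow> l \<le> t"
    using compact_attains_inf[OF K(1) False] by blast
  obtain m where m: "m \<in> K" "\<And>t. t \<in> K \<Longrightarrow> t \<le> m"
    using compact_attains_sup[OF K(1) False] by blast
  show ?thesis
    by (rule that[of "min l (1/4)" "max m (3/4)"])
      (use l m K(2) in \<open>auto simp: min_le_iff_disj le_max_iff_disj\<close>)
qed

lemma unit_mass_bump:
  obtains \<eta> :: "real \<Rightarrow> real" and D
  where "C1_with_gradient \<eta> D" "\<And>t. t \<notin> {1/4..3/4} \<Longrightarrow> \<eta> t = 0" "integral {0..1} \<eta> = 1"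
proof -
  let ?b = "\<lambda>t::real. (max 0 (((t - 1/4) \<bullet> 1) * (0 - (t - 3/4) \<bullet> 1)))\<^sup>2"
  obtain D where D: "C1_with_gradient ?b D"
    using C1_with_gradient_square_max[OF C1_with_gradient_mult[OF C1_with_gradient_inner
        C1_with_gradient_diff[OF C1_with_gradient_const C1_with_gradient_inner]]] by blast
  have out: "?b t = 0" if "t \<notin> {1/4..3/4}" for t
  proof -
    have "((t - 1/4) \<bullet> 1) * (0 - (t - 3/4) \<bullet> 1) \<le> 0"
      using that by (auto simp: mult_le_0_iff)
    then show ?thesis by simp
  qed
  define I where "I = integral {0..1} ?b"
  have "I \<noteq> 0"
  proof
    assume "I = 0"
    moreover have "continuous_on {0..1} ?b" by (rule C1_with_gradientD[OF D])

    then have "(integral {0..1} ?b = 0) = (\<forall>t\<in>{0..1}. ?b t = 0)"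
      by (rule integral_eq_0_iff) auto
    ultimately have "\<forall>t\<in>{0..1}. ?b t = 0"
      unfolding I_def by blast
    then have "?b (1/2) = 0" by (rule bspec) auto
    then show False by (simp add: max_def)
  qed
  show ?thesis
  proof (rule that)
    show "C1_with_gradient (\<lambda>t. inverse I * ?b t) (\<lambda>t. inverse I *\<^sub>R D t + ?b t *\<^sub>R 0)"
      by (rule C1_with_gradient_mult[OF C1_with_gradient_const D])
    show "inverse I * ?b t = 0" if "t \<notin> {1/4..3/4}" for t using out[OF that] by simp
    show "integral {0..1} (\<lambda>t. inverse I * ?b t) = 1"
      using \<open>I \<noteq> 0\<close> by (simp only: integral_mult_right I_def[symmetric]) simp
  qed
qed

text \<open>The du Bois-Reymond lemma. Every test function is a multiple of a fixed bump of mass 1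
  plus the derivative of another test function, so \<open>u\<close> acts like the constant
  \<open>c\<close> that it assigns to the bump.\<close>

proposition AE_const_if_derivative_tests_zero:
  fixes u :: "real \<Rightarrow> real"
  assumes u: "\<And>a b. 0 < a \<Longrightarrow> b < 1 \<Longrightarrow> set_integrable lebesgue {a..b} u"
    and zero: "\<And>\<kappa> \<kappa>'. test_function {0<..<1} \<kappa> \<kappa>' \<Longrightarrow> (LINT t|lebesgue. \<kappa>' t * u t) = 0"
  obtains c where "AE t in lebesgue. t \<in> {0<..<1} \<longrightarrow> u t = c"
proof -
  obtain \<eta> D\<eta> where \<eta>: "C1_with_gradient \<eta> D\<eta>" "\<And>t::real. t \<notin> {1/4..3/4} \<Longrightarrow> \<eta> t = 0" "integral {0..1} \<eta> = 1"
    using unit_mass_bump by blast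
  have int: "integrable lebesgue (\<lambda>t. w t * u t)"
    if "continuous_on UNIV w" "0 < a" "b < 1" "\<And>t. t \<notin> {a..b} \<Longrightarrow> w t = 0" for a b w
  proof -
    have "compact (w ` {a..b})"
      by (intro compact_continuous_image continuous_on_subset[OF that(1)]) auto
    then obtain B where B: "\<And>t. t \<in> {a..b} \<Longrightarrow> \<bar>w t\<bar> \<le> B"
      using compact_imp_bounded[THEN bounded_iff[THEN iffD1]] by fastforce
    have "\<bar>w t\<bar> \<le> \<bar>B\<bar>" for t
      using B[of t] that(4)[of t] by (cases "t \<in> {a..b}") auto
    then show ?thesis
      using that u[OF that(2,3)] borel_measurable_continuous_onI[OF that(1)]
      by (intro integrable_test_mult[where a=a and b=b and B="\<bar>B\<bar>"]) auto
  qed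
  define c where "c = (LINT t|lebesgue. \<eta> t * u t)"
  have "AE t in lebesgue. t \<in> {0<..<1} \<longrightarrow> u t - c = 0"
  proof (rule AE_zero_if_test_integrals_zero)
    fix a b :: real assume ab: "cbox a b \<subseteq> {0<..<1}"
    show "set_integrable lebesgue (cbox a b) (\<lambda>t. u t - c)"
    proof (cases "a \<le> b")
      case True
      then have "0 < a" "b < 1" using ab by auto
      then have "set_integrable lebesgue {a..b} u" by (rule u)
      moreover have "set_integrable lebesgue {a..b} (\<lambda>t. c)"
        unfolding set_integrable_def by (intro integrable_scaleR_left) (auto intro!: integrable_real_indicator simp: emeasure_lborel_Icc_eq)
      ultimately show ?thesis by (auto intro: set_integral_diff)
    qed (simp add: set_integrable_def)
  next
    fix w D assume w: "test_function {0<..<1::real} w D"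
    from test_functionD[OF w] obtain K where c1: "C1_with_gradient w D"
      and K: "compact K" "K \<subseteq> {0<..<1}" "\<And>t. t \<notin> K \<Longrightarrow> w t = 0"
      by (auto simp: interior_open)
    obtain a b where ab: "0 < a" "b < 1" "K \<subseteq> {a..b}" "a \<le> 1/4" "3/4 \<le> b"
      using compact_subset_unit_interval[OF K(1,2)] by blast
    have wab: "w t = 0" "\<eta> t = 0" if "t \<notin> {a..b}" for t
    proof -
      have "t \<notin> K" using that ab(3) by blast
      then show "w t = 0" by (rule K(3))
      have "t \<notin> {1/4..3/4}" using that ab(4,5) by auto
      then show "\<eta> t = 0" by (rule \<eta>(2))
    qed
    define J where "J = integral {0..1} w"
    \<comment> \<open>Removing the mass \<open>J\<close> makes the integral of \<open>f\<close>
      zero, so that its antiderivative has compact support and is itself a test function.\<close>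
    define f where "f t = w t - J * \<eta> t" for t
    have cf: "continuous_on UNIV f"
      unfolding f_def by (intro continuous_intros C1_with_gradientD[OF c1] C1_with_gradientD[OF \<eta>(1)])
    have f0: "f t = 0" if "t \<notin> {a..b}" for t
      using wab[OF that] by (simp add: f_def)
    have "integral {0..1} f = integral {0..1} w - integral {0..1} (\<lambda>t. J * \<eta> t)"
      unfolding f_def
      by (rule Henstock_Kurzweil_Integration.integral_diff; rule integrable_continuous_interval)
        (intro continuous_on_mult continuous_on_const C1_with_gradientD(4)[OF c1] C1_with_gradientD(4)[OF \<eta>(1)])+
    then have "integral {0..1} f = 0" by (simp add: J_def \<eta>(3))
    moreover obtain F where "\<And>t. (F has_real_derivative f t) (at t)"
        "\<And>t. integral {0..1} f = 0 \<Longrightarrow> t \<notin> {a..b} \<Longrightarrow> F t = 0"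
      using has_antiderivative_compact_support[OF cf ab(1,2) f0] by metis
    ultimately have F: "\<And>t. (F has_real_derivative f t) (at t)" "\<And>t. t \<notin> {a..b} \<Longrightarrow> F t = 0"
      by simp_all
    have "C1_with_gradient F f" using F(1) cf by (simp add: C1_with_gradient_def)
    then have "test_function {0<..<1} F f"
      by (rule test_functionI[of _ _ "{a..b}"]) (use F(2) ab in \<open>auto simp: interior_open\<close>)
    then have "(LINT t|lebesgue. f t * u t) = 0" by (rule zero)
    moreover have "(\<lambda>t. f t * u t) = (\<lambda>t. w t * u t - J * (\<eta> t * u t))"
      by (rule ext) (simp add: f_def left_diff_distrib)
    moreover have i1: "integrable lebesgue (\<lambda>t. w t * u t)" "integrable lebesgue (\<lambda>t. \<eta> t * u t)"
      using int[OF C1_with_gradientD(3)[OF c1] ab(1,2)] int[OF C1_with_gradientD(3)[OF \<eta>(1)] ab(1,2)] wab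
      by auto
    ultimately have 1: "(LINT t|lebesgue. w t * u t) = J * c"
      by (simp add: c_def)
    have wi: "(w has_integral J) {0..1}"
      unfolding J_def by (intro integrable_integral integrable_continuous_interval C1_with_gradientD[OF c1])
    have wl: "set_integrable lebesgue {0..1} w"
      using borel_integrable_atLeastAtMost'[OF C1_with_gradientD(4)[OF c1, of "{0..1}"]]
      by (simp add: set_integrable_def integrable_completion)
    have "(\<lambda>t. indicator {0..1} t *\<^sub>R w t) = w"
    proof
      fix t
      show "indicator {0..1} t *\<^sub>R w t = w t"
        using wab(1)[of t] ab(1,2) by (cases "t \<in> {0..1}") (auto simp: indicator_def)
    qed
    then have 2: "integrable lebesgue w" "(LINT t|lebesgue. w t) = J"
      using wl wi has_integral_set_lebesgue[OF wl]
      by (auto simp: set_integrable_def set_lebesgue_integral_def dest: has_integral_unique)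
    have "(LINT t|lebesgue. w t * (u t - c)) = (LINT t|lebesgue. w t * u t) - (LINT t|lebesgue. c * w t)"
      using i1 2 by (subst Bochner_Integration.integral_diff[symmetric]) (auto simp: algebra_simps)
    then show "(LINT t|lebesgue. w t * (u t - c)) = 0"
      using 1 2 by simp
  qed auto
  then show ?thesis by (intro that) simp
qed

section \<open>Square-integrable densities of push-forwards\<close>

lemma integrable_mult_of_squares:
  fixes u v :: "'a \<Rightarrow> real"
  assumes "u \<in> borel_measurable M" "v \<in> borel_measurable M"
    "integrable M (\<lambda>x. (u x)\<^sup>2)" "integrable M (\<lambda>x. (v x)\<^sup>2)"
  shows "integrable M (\<lambda>x. u x * v x)"
proof (rule Bochner_Integration.integrable_bound)
  show "integrable M (\<lambda>x. (u x)\<^sup>2 + (v x)\<^sup>2)" using assms by simp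
  show "(\<lambda>x. u x * v x) \<in> borel_measurable M" using assms by simp
  show "AE x in M. norm (u x * v x) \<le> norm ((u x)\<^sup>2 + (v x)\<^sup>2)"
  proof (rule AE_I2)
    fix x
    have "\<bar>u x\<bar> * \<bar>v x\<bar> * 2 \<le> \<bar>u x\<bar>\<^sup>2 + \<bar>v x\<bar>\<^sup>2" using sum_squares_bound[of "\<bar>u x\<bar>" "\<bar>v x\<bar>"] by simp
    then show "norm (u x * v x) \<le> norm ((u x)\<^sup>2 + (v x)\<^sup>2)"
      by (simp add: abs_mult) (smt (verit) mult_nonneg_nonneg abs_ge_zero)
  qed
qed

lemma (in finite_measure) integrable_of_square:
  fixes u :: "'a \<Rightarrow> real"
  assumes "u \<in> borel_measurable M" "integrable M (\<lambda>x. (u x)\<^sup>2)"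
  shows "integrable M u"
  using integrable_mult_of_squares[OF assms(1) borel_measurable_const[of 1] assms(2)] by simp

context finite_measure
begin

text \<open>\<open>h\<close> is the Radon-Nikodym derivative of the push-forward of
  \<open>u M\<close> by that of \<open>M\<close>; in other words \<open>h \<circ> X\<close> is the
  conditional expectation of \<open>u\<close> given \<open>X\<close>. Square integrability is
  inherited as usual for conditional expectations. Any Borel \<open>f\<close> is allowed since
  undefined integrals take the value 0 on both sides simultaneously.\<close>

lemma pushforward_density_nonneg:
  fixes u :: "'a \<Rightarrow> real" and X :: "'a \<Rightarrow> real"
  assumes X[measurable]: "X \<in> borel_measurable M" and u[measurable]: "u \<in> borel_measurable M"
    and u0: "\<And>x. 0 \<le> u x" and u2: "integrable M (\<lambda>x. (u x)\<^sup>2)"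
  obtains h where "h \<in> borel_measurable borel" "integrable (distr M borel X) (\<lambda>t. (h t)\<^sup>2)"
    "\<And>f::real \<Rightarrow> real. f \<in> borel_measurable borel \<Longrightarrow>
       (LINT x|M. u x * f (X x)) = (LINT t|distr M borel X. h t * f t)"
proof -
  let ?D = "distr M borel X"
  let ?N = "distr (density M (\<lambda>x. ennreal (u x))) borel X"
  interpret D: finite_measure ?D by (rule finite_measure_distr[OF X])
  have ui: "integrable M u" by (rule integrable_of_square[OF u u2])
  have "absolutely_continuous ?D ?N"
    unfolding absolutely_continuous_def
  proof safe
    fix A assume "A \<in> null_sets ?D"
    then have A: "A \<in> sets borel" "X -` A \<inter> space M \<in> null_sets M"
      by (auto simp: null_sets_def emeasure_distr)
    then have "X -` A \<inter> space M \<in> null_sets (density M (\<lambda>x. ennreal (u x)))"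
      using absolutely_continuousI_density[of "\<lambda>x. ennreal (u x)" M] u
      by (auto simp: absolutely_continuous_def)
    then show "A \<in> null_sets ?N"
      using A by (auto simp: null_sets_def emeasure_distr)
  qed
  then obtain k where k: "k \<in> borel_measurable ?D" "density ?D k = ?N"
    using D.Radon_Nikodym[of ?N] by auto
  then have [measurable]: "k \<in> borel_measurable borel" by simp
  have "(\<integral>\<^sup>+ t. k t \<partial>?D) = emeasure (density ?D k) UNIV"
    by (simp add: emeasure_density)
  also have "\<dots> = (\<integral>\<^sup>+ x. ennreal (u x) \<partial>M)"
    unfolding k(2) by (simp add: emeasure_distr emeasure_density)
  also have "\<dots> < \<infinity>"
    using ui u0 by (simp add: nn_integral_eq_integral)
  finally have kfin: "AE t in ?D. k t \<noteq> \<infinity>"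
    by (intro nn_integral_PInf_AE) auto
  define h where "h t = enn2real (k t)" for t
  have h[measurable]: "h \<in> borel_measurable borel" unfolding h_def by measurable
  have h0: "0 \<le> h t" for t by (simp add: h_def)
  have dens: "density ?D (\<lambda>t. ennreal (h t)) = ?N"
    unfolding k(2)[symmetric]
    by (rule density_cong) (use kfin in \<open>auto simp: h_def ennreal_enn2real_if elim!: eventually_mono\<close>)
  have eq: "(LINT x|M. u x * f (X x)) = (LINT t|?D. h t * f t)" 
    if f[measurable]: "f \<in> borel_measurable borel" for f :: "real \<Rightarrow> real"
  proof -
    have "(LINT x|M. u x * f (X x)) = (LINT x|density M (\<lambda>x. ennreal (u x)). f (X x))"
      using u0 by (subst integral_density) auto
    also have "\<dots> = (LINT t|?N. f t)" by (subst integral_distr) auto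
    also have "\<dots> = (LINT t|?D. h t * f t)"
      unfolding dens[symmetric] using h0 by (subst integral_density) auto
    finally show ?thesis .
  qed
  have hi: "integrable ?D h"
  proof -
    have "integrable ?N (\<lambda>t. 1::real)"
      by (subst integrable_distr_eq) (use ui u0 in \<open>auto simp: integrable_density\<close>)
    then show ?thesis
      unfolding dens[symmetric] using h0 by (subst (asm) integrable_density) auto
  qed
  \<comment> \<open>With the truncation \<open>f = min h n\<close>, the integral of
    \<open>h f\<close> is that of \<open>u f(X)\<close>, hence at most half the sum of the integrals
    of \<open>u^2\<close> and of \<open>f^2\<close>. As \<open>f^2 \<le> h f\<close>, the last term
    can be absorbed on the left; truncation keeps it finite. Fatou then removes the
    truncation.\<close>
  have bound: "integrable ?D (\<lambda>t. h t * min (h t) (real n))"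
    "(LINT t|?D. h t * min (h t) (real n)) \<le> (LINT x|M. (u x)\<^sup>2)" for n
  proof -
    let ?f = "\<lambda>t. min (h t) (real n)"
    show i: "integrable ?D (\<lambda>t. h t * ?f t)"
    proof (rule Bochner_Integration.integrable_bound)
      show "integrable ?D (\<lambda>t. real n * h t)" using hi by simp
      show "AE t in ?D. norm (h t * ?f t) \<le> norm (real n * h t)"
      proof (rule AE_I2)
        fix t
        have "h t * ?f t \<le> h t * real n" using h0 by (intro mult_left_mono) auto
        then show "norm (h t * ?f t) \<le> norm (real n * h t)"
          using h0[of t] by (simp add: abs_mult mult.commute)
      qed
    qed auto
    have i2: "integrable ?D (\<lambda>t. (?f t)\<^sup>2)"
      by (rule Bochner_Integration.integrable_bound[OF i])
        (use h0 in \<open>auto simp: power2_eq_square intro!: mult_mono AE_I2\<close>)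
    then have i3: "integrable M (\<lambda>x. (?f (X x))\<^sup>2)"
      by (subst (asm) integrable_distr_eq) auto
    have "(LINT t|?D. h t * ?f t) = (LINT x|M. u x * ?f (X x))" by (rule eq[symmetric]) simp
    also have "\<dots> \<le> (LINT x|M. ((u x)\<^sup>2 + (?f (X x))\<^sup>2) / 2)"
    proof (rule integral_mono)
      show "integrable M (\<lambda>x. u x * ?f (X x))"
        by (rule integrable_mult_of_squares) (use u2 i3 in auto)
      show "integrable M (\<lambda>x. ((u x)\<^sup>2 + (?f (X x))\<^sup>2) / 2)" using u2 i3 by simp
      show "u x * ?f (X x) \<le> ((u x)\<^sup>2 + (?f (X x))\<^sup>2) / 2" for x
        using sum_squares_bound[of "u x" "?f (X x)"] by simp
    qed
    also have "\<dots> = ((LINT x|M. (u x)\<^sup>2) + (LINT x|M. (?f (X x))\<^sup>2)) / 2"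
      using u2 i3 by simp
    finally have le: "(LINT t|?D. h t * ?f t) \<le> ((LINT x|M. (u x)\<^sup>2) + (LINT x|M. (?f (X x))\<^sup>2)) / 2" .
    have "(LINT x|M. (?f (X x))\<^sup>2) = (LINT t|?D. (?f t)\<^sup>2)"
      by (subst integral_distr) auto
    also have "\<dots> \<le> (LINT t|?D. h t * ?f t)"
      by (rule integral_mono[OF i2 i]) (use h0 in \<open>auto simp: power2_eq_square intro!: mult_right_mono\<close>)
    finally have le': "(LINT x|M. (?f (X x))\<^sup>2) \<le> (LINT t|?D. h t * ?f t)" .
    have "F \<le> H \<Longrightarrow> H \<le> (U + F) / 2 \<Longrightarrow> H \<le> U" for F H U :: real by simp
    from this[OF le' le] show "(LINT t|?D. h t * ?f t) \<le> (LINT x|M. (u x)\<^sup>2)" .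
  qed
  have "integrable ?D (\<lambda>t. (h t)\<^sup>2)"
  proof (rule integrableI_nonneg)
    have "(\<integral>\<^sup>+t. ennreal ((h t)\<^sup>2) \<partial>?D) \<le> (\<integral>\<^sup>+t. liminf (\<lambda>n. ennreal (h t * min (h t) (real n))) \<partial>?D)"
    proof (rule nn_integral_mono)
      fix t
      have "eventually (\<lambda>n. real n \<ge> h t) sequentially"
        by (rule eventually_sequentiallyI[of "nat \<lceil>h t\<rceil>"]) linarith
      then have "(\<lambda>n. ennreal (h t * min (h t) (real n))) \<longlonglongrightarrow> ennreal ((h t)\<^sup>2)"
        by (intro tendsto_eventually) (auto elim!: eventually_mono simp: power2_eq_square min_def)
      then show "ennreal ((h t)\<^sup>2) \<le> liminf (\<lambda>n. ennreal (h t * min (h t) (real n)))"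
        using lim_imp_Liminf[OF sequentially_bot] by (metis order_refl)
    qed
    also have "\<dots> \<le> liminf (\<lambda>n. \<integral>\<^sup>+t. ennreal (h t * min (h t) (real n)) \<partial>?D)"
      by (rule nn_integral_liminf) simp
    also have "\<dots> = liminf (\<lambda>n. ennreal (LINT t|?D. h t * min (h t) (real n)))"
      using bound(1) h0 by (simp add: nn_integral_eq_integral)
    also have "\<dots> \<le> ennreal (LINT x|M. (u x)\<^sup>2)"
      using bound(2) by (intro Liminf_le) (auto intro!: always_eventually ennreal_leI)
    finally show "(\<integral>\<^sup>+t. ennreal ((h t)\<^sup>2) \<partial>?D) < \<infinity>" by (rule le_less_trans) simp
  qed auto
  from that[OF h this eq] show ?thesis .
qed

text \<open>Positive and negative parts of \<open>u\<close> are treated separately. Square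
  integrability of \<open>f\<close> makes both resulting integrals finite, so that they may be
  subtracted.\<close>

proposition pushforward_density:
  fixes u :: "'a \<Rightarrow> real" and X :: "'a \<Rightarrow> real"
  assumes X[measurable]: "X \<in> borel_measurable M" and u[measurable]: "u \<in> borel_measurable M"
    and u2: "integrable M (\<lambda>x. (u x)\<^sup>2)"
  obtains h where "h \<in> borel_measurable borel" "integrable (distr M borel X) (\<lambda>t. (h t)\<^sup>2)"
    "\<And>f::real \<Rightarrow> real. f \<in> borel_measurable borel \<Longrightarrow> integrable (distr M borel X) (\<lambda>t. (f t)\<^sup>2) \<Longrightarrow>
       (LINT x|M. u x * f (X x)) = (LINT t|distr M borel X. h t * f t)"
proof -
  let ?D = "distr M borel X"
  have p2: "integrable M (\<lambda>x. (max 0 (s * u x))\<^sup>2)" if "\<bar>s\<bar> = 1" for s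
  proof (rule Bochner_Integration.integrable_bound[OF u2])
    show "AE x in M. norm ((max 0 (s * u x))\<^sup>2) \<le> norm ((u x)\<^sup>2)"
    proof (rule AE_I2)
      fix x
      have "\<bar>max 0 (s * u x)\<bar> \<le> \<bar>u x\<bar>"
        using that abs_mult[of s "u x"] by auto
      then have "(max 0 (s * u x))\<^sup>2 \<le> (u x)\<^sup>2" by (rule abs_le_square_iff[THEN iffD1])
      then show "norm ((max 0 (s * u x))\<^sup>2) \<le> norm ((u x)\<^sup>2)" by simp
    qed
  qed simp
  obtain p where p: "p \<in> borel_measurable borel" "integrable ?D (\<lambda>t. (p t)\<^sup>2)"
    "\<And>f::real \<Rightarrow> real. f \<in> borel_measurable borel \<Longrightarrow>
       (LINT x|M. max 0 (1 * u x) * f (X x)) = (LINT t|?D. p t * f t)"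
    by (rule pushforward_density_nonneg[OF X, of "\<lambda>x. max 0 (1 * u x)"]) (use p2[of 1] in auto)
  obtain q where q: "q \<in> borel_measurable borel" "integrable ?D (\<lambda>t. (q t)\<^sup>2)"
    "\<And>f::real \<Rightarrow> real. f \<in> borel_measurable borel \<Longrightarrow>
       (LINT x|M. max 0 (-1 * u x) * f (X x)) = (LINT t|?D. q t * f t)"
    by (rule pushforward_density_nonneg[OF X, of "\<lambda>x. max 0 (-1 * u x)"]) (use p2[of "-1"] in auto)
  note [measurable] = p(1) q(1)
  show ?thesis
  proof (rule that[of "\<lambda>t. p t - q t"])
    have "integrable ?D (\<lambda>t. (p t)\<^sup>2 + (q t)\<^sup>2 - 2 * (p t * q t))"
      using p(2) q(2) integrable_mult_of_squares[of p ?D q] by auto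
    then show "integrable ?D (\<lambda>t. (p t - q t)\<^sup>2)"
      by (simp add: power2_diff algebra_simps)
  next
    fix f :: "real \<Rightarrow> real" assume f[measurable]: "f \<in> borel_measurable borel" and f2: "integrable ?D (\<lambda>t. (f t)\<^sup>2)"
    have f2': "integrable M (\<lambda>x. (f (X x))\<^sup>2)"
      using f2 by (subst (asm) integrable_distr_eq) auto
    have i: "integrable M (\<lambda>x. max 0 (1 * u x) * f (X x))" "integrable M (\<lambda>x. max 0 (-1 * u x) * f (X x))"
      using p2[of 1] p2[of "-1"] f2' by (auto intro!: integrable_mult_of_squares)
    have "u x * f (X x) = max 0 (1 * u x) * f (X x) - max 0 (-1 * u x) * f (X x)" for x
      by (simp add: max_def)
    then have "(LINT x|M. u x * f (X x)) = (LINT t|?D. p t * f t) - (LINT t|?D. q t * f t)"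
      using i by (simp only: Bochner_Integration.integral_diff p(3)[OF f] q(3)[OF f])
    also have "\<dots> = (LINT t|?D. (p t - q t) * f t)"
      using integrable_mult_of_squares[of p ?D f] integrable_mult_of_squares[of q ?D f] p(2) q(2) f2
      by (simp add: left_diff_distrib)
    finally show "(LINT x|M. u x * f (X x)) = (LINT t|?D. (p t - q t) * f t)" .
  qed simp
qed

end

subsection \<open>Geometry of the radial coordinate\<close>

lemma facet_set_convex_compact:
  fixes L :: "'a::euclidean_space facet"
  shows "convex (facet_set L)" "compact (facet_set L)" "facet_set L \<noteq> {}"
  by (cases L; simp add: finite_imp_compact_convex_hull)+

text \<open>With \<open>p\<close> the foot of the perpendicular from \<open>z\<close> to the affine
  hull, \<open>N\<close> is \<open>p - z\<close> divided by its squared length.\<close>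

lemma facet_normal_exists:
  fixes F :: "'a::euclidean_space set"
  assumes "z \<notin> affine hull F" "F \<noteq> {}"
  shows "\<exists>N. \<forall>y\<in>F. N \<bullet> (y - z) = 1"
proof -
  let ?A = "affine hull F"
  define p where "p = closest_point ?A z"
  have A: "closed ?A" "convex ?A" "?A \<noteq> {}" using assms(2) by (auto simp: affine_imp_convex)
  have p: "p \<in> ?A" unfolding p_def by (rule closest_point_in_set[OF A(1,3)])
  have le: "(z - p) \<bullet> (y - p) \<le> 0" if "y \<in> ?A" for y
    unfolding p_def by (rule closest_point_dot[OF A(2,1) that])
  \<comment> \<open>The obtuse-angle inequality at the closest point also holds for the reflection
    \<open>2p - y\<close>, which again lies in the affine hull; the two inequalities give
    equality.\<close>
  have eq: "(z - p) \<bullet> (y - p) = 0" if "y \<in> ?A" for y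
  proof -
    have "2 *\<^sub>R p + (- 1) *\<^sub>R y \<in> ?A"
      by (rule mem_affine[OF affine_affine_hull p that]) simp
    from le[OF this] have "(z - p) \<bullet> (p - y) \<le> 0" by (simp add: scaleR_2 algebra_simps)
    then show ?thesis using le[OF that] by (simp add: inner_diff_right)
  qed
  have "p \<noteq> z" using p assms(1) by auto
  then have nz: "(p - z) \<bullet> (p - z) \<noteq> 0" by simp
  show ?thesis
  proof (intro exI ballI)
    fix y assume "y \<in> F"
    then have "(z - p) \<bullet> (y - p) = 0" by (intro eq hull_inc)
    then have "(p - z) \<bullet> (y - z) = (p - z) \<bullet> (p - z)"
      by (simp add: inner_diff_left inner_diff_right algebra_simps)
    then show "((1 / ((p - z) \<bullet> (p - z))) *\<^sub>R (p - z)) \<bullet> (y - z) = 1"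
      using nz by simp
  qed
qed

definition facet_normal :: "'a::euclidean_space \<Rightarrow> 'a facet \<Rightarrow> 'a" where
  "facet_normal z L = (SOME N. \<forall>y\<in>facet_set L. N \<bullet> (y - z) = 1)"

text \<open>On \<open>S\<close> this is the Minkowski gauge about \<open>z\<close>. Taking the
  maximum off \<open>S\<close> too gives a function that is Lipschitz and positively homogeneous
  about \<open>z\<close> on the whole space, as needed for difference quotients that may leave
  \<open>S\<close>.\<close>

definition radial_coord :: "'a::euclidean_space \<Rightarrow> 'a facet set \<Rightarrow> 'a \<Rightarrow> real" where
  "radial_coord z E x = Max ((\<lambda>L. facet_normal z L \<bullet> (x - z)) ` E)"

text \<open>Inside the sectors this is the gradient of \<open>\<xi>\<close>. The value 0 on the null
  set of sector boundaries and off \<open>S\<close> makes it Borel and bounded everywhere.\<close>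

definition radial_grad :: "'a::euclidean_space \<Rightarrow> 'a facet set \<Rightarrow> 'a \<Rightarrow> 'a" where
  "radial_grad z E x = (\<Sum>L\<in>E. indicator (interior (sector z L)) x *\<^sub>R facet_normal z L)"

locale scaled_element =
  fixes S :: "'a::euclidean_space set" and z :: 'a and E :: "'a facet set"
  assumes S_element: "S_element S z E"
begin

abbreviation "nrm \<equiv> facet_normal z"
abbreviation "\<xi> \<equiv> radial_coord z E"
abbreviation "G \<equiv> radial_grad z E"

lemma polytope_S: "polytope S" and interior_S: "interior S \<noteq> {}" and z_in_S: "z \<in> S"
  and finite_E: "finite E" and S_eq: "S = (\<Union>L\<in>E. sector z L)"
  using S_element unfolding S_element_def by blast+

lemma convex_S: "convex S" and compact_S: "compact S" and closed_S: "closed S" and bounded_S: "bounded S"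
  using polytope_S by (auto simp: polytope_imp_convex polytope_imp_compact polytope_imp_closed polytope_imp_bounded)

lemma S_sets[measurable]: "S \<in> sets borel" "S \<in> sets lebesgue" "S \<in> lmeasurable"
  using closed_S compact_S by (auto intro: borel_closed simp: lmeasurable_compact)

lemma E_nonempty: "E \<noteq> {}"
  using S_eq z_in_S by blast

lemma dim_ge_2: "2 \<le> DIM('a)"
  using S_element unfolding S_element_def by auto

lemma facet_frontier: "L \<in> E \<Longrightarrow> facet_set L \<subseteq> frontier S"
  and facet_nondegenerate: "L \<in> E \<Longrightarrow> nondegenerate_facet L"
  and apex_notin: "L \<in> E \<Longrightarrow> z \<notin> affine hull (facet_set L)"
  using S_element unfolding S_element_def by blast+

lemma sectors_disjoint:
  "L \<in> E \<Longrightarrow> L' \<in> E \<Longrightarrow> L \<noteq> L' \<Longrightarrow> interior (sector z L) \<inter> interior (sector z L') = {}"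
  using S_element unfolding S_element_def by blast

lemma nrm_facet: "L \<in> E \<Longrightarrow> y \<in> facet_set L \<Longrightarrow> nrm L \<bullet> (y - z) = 1"
  using someI_ex[OF facet_normal_exists[OF apex_notin facet_set_convex_compact(3)]]
  unfolding facet_normal_def by blast

lemma sector_iff: "x \<in> sector z L \<longleftrightarrow> (\<exists>t y. 0 \<le> t \<and> t \<le> 1 \<and> y \<in> facet_set L \<and> x = z + t *\<^sub>R (y - z))"
proof -
  have hull: "convex hull facet_set L = facet_set L"
    by (simp add: facet_set_convex_compact(1) hull_same)
  show ?thesis
    unfolding sector_def convex_hull_insert[OF facet_set_convex_compact(3)] hull
  proof safe
    fix u v b assume "0 \<le> u" "0 \<le> v" "u + v = (1::real)" "b \<in> facet_set L" "x = u *\<^sub>R z + v *\<^sub>R b"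
    then show "\<exists>t y. 0 \<le> t \<and> t \<le> 1 \<and> y \<in> facet_set L \<and> u *\<^sub>R z + v *\<^sub>R b = z + t *\<^sub>R (y - z)"
      by (intro exI[of _ v] exI[of _ b]) (auto simp: algebra_simps eq_diff_eq simp flip: scaleR_add_left)
  next
    fix t y assume "0 \<le> t" "t \<le> (1::real)" "y \<in> facet_set L"
    then show "\<exists>u\<ge>0. \<exists>v\<ge>0. \<exists>b. u + v = 1 \<and> b \<in> facet_set L \<and> z + t *\<^sub>R (y - z) = u *\<^sub>R z + v *\<^sub>R b"
      by (intro exI[of _ "1 - t"] conjI exI[of _ t] exI[of _ y]) (auto simp: algebra_simps)
  qed
qed

lemma convex_sector: "convex (sector z L)" and compact_sector: "compact (sector z L)"
  by (auto simp: sector_def compact_convex_hull facet_set_convex_compact)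

lemma sector_subset: "L \<in> E \<Longrightarrow> sector z L \<subseteq> S"
  using S_eq by blast

lemma aff_dim_facet: assumes "L \<in> E" shows "int (DIM('a)) - 1 \<le> aff_dim (facet_set L)"
proof -
  have "DIM('a) = 2 \<and> is_Segment L \<or> DIM('a) = 3 \<and> (is_Triangle L \<or> is_Quadrilateral L)"
    using S_element assms unfolding S_element_def by blast
  moreover have "nondegenerate_facet L" by (rule facet_nondegenerate[OF assms])
  ultimately show ?thesis
  proof (cases L)
    case (Quadrilateral a b c d)
    have "aff_dim {a, b, c} \<le> aff_dim {a, b, c, d}" by (rule aff_dim_subset) auto
    then show ?thesis
      using Quadrilateral \<open>nondegenerate_facet L\<close> \<open>_ \<or> _\<close> by (auto simp: collinear_aff_dim aff_dim_convex_hull)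
  qed (auto simp: collinear_aff_dim aff_dim_convex_hull aff_dim_2)
qed

lemma interior_sector: assumes "L \<in> E" shows "interior (sector z L) \<noteq> {}"
proof -
  have "aff_dim (sector z L) = aff_dim (facet_set L) + 1"
    using apex_notin[OF assms] by (simp add: sector_def aff_dim_convex_hull aff_dim_insert)
  then have "aff_dim (sector z L) = DIM('a)"
    using aff_dim_facet[OF assms] aff_dim_le_DIM[of "sector z L"] by linarith
  then have "rel_interior (sector z L) = interior (sector z L)"
    by (simp add: aff_dim_eq_full rel_interior_interior)
  moreover have "sector z L \<noteq> {}" by (simp add: sector_def)
  ultimately show ?thesis
    using rel_interior_eq_empty[OF convex_sector, of L] by simp
qed

lemma nrm_sector:
  assumes "L \<in> E" "0 \<le> t" "y \<in> facet_set L" shows "nrm L \<bullet> (z + t *\<^sub>R (y - z) - z) = t"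
  using nrm_facet[OF assms(1,3)] by simp

text \<open>A ball around an interior point \<open>p\<close> of the sector is projected from
  \<open>z\<close> to the plane of the facet. The inverse map
  \<open>y \<mapsto> z + t (y - z)\<close> has \<open>t \<le> 1\<close>, so it does not increase
  distances and the radius of the ball serves for the disc.\<close>

lemma facet_contains_disc:
  assumes L: "L \<in> E"
  obtains y0 \<delta> where "0 < \<delta>" "nrm L \<bullet> (y0 - z) = 1" "y0 \<in> facet_set L"
    "\<And>y. nrm L \<bullet> (y - z) = 1 \<Longrightarrow> dist y y0 < \<delta> \<Longrightarrow> y \<in> facet_set L"
proof -
  obtain p where p: "p \<in> interior (sector z L)" using interior_sector[OF L] by blast
  then obtain \<delta> where \<delta>: "0 < \<delta>" "ball p \<delta> \<subseteq> sector z L" by (auto simp: mem_interior)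
  obtain t y0 where ty: "0 \<le> t" "t \<le> 1" "y0 \<in> facet_set L" "p = z + t *\<^sub>R (y0 - z)"
    using \<delta> sector_iff[of p L] by (metis centre_in_ball subsetD)
  \<comment> \<open>Were \<open>p\<close> the apex, a small step against the normal would stay in
    the ball, although \<open>nrm L \<bullet> (x - z)\<close> is nonnegative on the sector.\<close>
  have "t \<noteq> 0"
  proof
    assume t0: "t = 0"
    let ?q = "z - (\<delta> / 2 / norm (nrm L)) *\<^sub>R nrm L"
    have N0: "nrm L \<noteq> 0" using nrm_facet[OF L ty(3)] by auto
    have "?q \<in> ball p \<delta>" using \<delta>(1) t0 ty(4) N0 by (simp add: dist_norm)
    then obtain s y where sy: "0 \<le> s" "y \<in> facet_set L" "?q = z + s *\<^sub>R (y - z)"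
      using \<delta>(2) sector_iff by blast
    then have "nrm L \<bullet> (?q - z) = s" using nrm_sector[OF L] by metis
    moreover have "nrm L \<bullet> (?q - z) < 0" using \<delta>(1) N0 by (simp add: divide_pos_pos)
    ultimately show False using sy by linarith
  qed
  show ?thesis
  proof (rule that[OF \<delta>(1) nrm_facet[OF L ty(3)] ty(3)])
    fix y assume y: "nrm L \<bullet> (y - z) = 1" "dist y y0 < \<delta>"
    let ?p = "z + t *\<^sub>R (y - z)"
    have "dist p ?p = t * dist y y0"
      using ty by (simp add: dist_norm norm_minus_commute flip: scaleR_diff_right)
    also have "\<dots> \<le> 1 * dist y y0" using ty by (intro mult_right_mono) auto
    finally have "?p \<in> ball p \<delta>" using y(2) by simp
    then obtain s y' where s: "0 \<le> s" "y' \<in> facet_set L" "?p = z + s *\<^sub>R (y' - z)"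
      using \<delta>(2) sector_iff by blast
    have "nrm L \<bullet> (?p - z) = s" using s nrm_sector[OF L] by metis
    moreover have "nrm L \<bullet> (?p - z) = t" using y(1) by simp
    ultimately have "s = t" by simp
    then have "y = y'" using s(3) \<open>t \<noteq> 0\<close> by simp
    then show "y \<in> facet_set L" using s(2) by simp
  qed
qed

text \<open>The plane of a facet supports the convex set \<open>S\<close>. A supporting hyperplane
  at the center \<open>y0\<close> of a disc inside the facet must contain the disc, so its normal is
  parallel to \<open>nrm L\<close>; the sign is settled by \<open>z \<in> S\<close>.\<close>

lemma nrm_le_1:
  assumes L: "L \<in> E" and x: "x \<in> S"
  shows "nrm L \<bullet> (x - z) \<le> 1"
proof -
  obtain y0 \<delta> where d: "0 < \<delta>" "nrm L \<bullet> (y0 - z) = 1" "y0 \<in> facet_set L"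
    "\<And>y. nrm L \<bullet> (y - z) = 1 \<Longrightarrow> dist y y0 < \<delta> \<Longrightarrow> y \<in> facet_set L"
    using facet_contains_disc[OF L] by metis
  have fS: "y \<in> S" if "y \<in> facet_set L" for y
    using facet_frontier[OF L] that closed_S by (auto simp: frontier_def)
  have "y0 \<in> frontier S" using facet_frontier[OF L] d(3) by blast
  then have "y0 \<notin> rel_interior S"
    using rel_interior_nonempty_interior[OF interior_S] by (auto simp: frontier_def)
  then obtain a where a: "a \<noteq> 0" "\<And>y. y \<in> S \<Longrightarrow> a \<bullet> y0 \<le> a \<bullet> y"
    using supporting_hyperplane_rel_boundary[OF convex_S fS[OF d(3)]] by metis
  have N0: "nrm L \<bullet> nrm L > 0" using d(2) by auto
  \<comment> \<open>\<open>e\<close> is the part of \<open>a\<close> orthogonal to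
    \<open>nrm L\<close>. If it were non-zero, moving from \<open>y0\<close> along
    \<open>- e\<close> inside the disc would decrease \<open>a \<bullet> y\<close> below its
    minimum.\<close>
  define c where "c = (a \<bullet> nrm L) / (nrm L \<bullet> nrm L)"
  define e where "e = a - c *\<^sub>R nrm L"
  have eN: "nrm L \<bullet> e = 0" using N0 by (simp add: e_def c_def inner_diff_right inner_commute)
  have ae: "a \<bullet> e = e \<bullet> e"
    using eN by (simp add: e_def inner_diff_left inner_commute inner_diff_right)
  have "e = 0"
  proof (rule ccontr)
    assume e0: "e \<noteq> 0"
    let ?y = "y0 - (\<delta> / 2 / norm e) *\<^sub>R e"
    have "nrm L \<bullet> (?y - z) = 1" using d(2) eN by (simp add: inner_diff_right algebra_simps)
    moreover have "dist ?y y0 < \<delta>" using d(1) e0 by (simp add: dist_norm)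
    ultimately have "?y \<in> S" by (intro fS d)
    from a(2)[OF this] have "(\<delta> / 2 / norm e) * (a \<bullet> e) \<le> 0" by (simp add: inner_diff_right)
    moreover have "(\<delta> / 2 / norm e) * (a \<bullet> e) > 0" unfolding ae using d(1) e0 by simp
    ultimately show False by linarith
  qed
  then have ac: "a = c *\<^sub>R nrm L" by (simp add: e_def)
  have "a \<bullet> y0 \<le> a \<bullet> z" by (rule a(2)[OF z_in_S])
  then have "c \<le> 0" unfolding ac
  proof -
    assume "c *\<^sub>R nrm L \<bullet> y0 \<le> c *\<^sub>R nrm L \<bullet> z"
    then have "c * (nrm L \<bullet> (y0 - z)) \<le> 0" by (simp add: inner_diff_right algebra_simps)
    then show "c \<le> 0" using d(2) by simp
  qed
  then have "c < 0" using a(1) ac by force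
  moreover have "a \<bullet> y0 \<le> a \<bullet> x" by (rule a(2)[OF x])
  ultimately have "nrm L \<bullet> x \<le> nrm L \<bullet> y0"
    unfolding ac by (simp add: mult_le_cancel_left)
  then show ?thesis using d(2) by (simp add: inner_diff_right)
qed

section \<open>The radial coordinate as a maximum of facet functionals\<close>

lemma xi_ge: "L \<in> E \<Longrightarrow> nrm L \<bullet> (x - z) \<le> \<xi> x"
  unfolding radial_coord_def using finite_E by (intro Max_ge) auto

lemma xi_attained: obtains L where "L \<in> E" "\<xi> x = nrm L \<bullet> (x - z)"
proof -
  have "\<xi> x \<in> (\<lambda>L. nrm L \<bullet> (x - z)) ` E"
    unfolding radial_coord_def using finite_E E_nonempty by (intro Max_in) auto
  then show ?thesis using that by blast
qed

text \<open>For \<open>x = z + t (y - z)\<close> with \<open>y\<close> in the facet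
  \<open>L\<close>, the functional of \<open>L\<close> takes the value \<open>t\<close>. By
  \<open>nrm_le_1\<close> at \<open>y\<close> every other functional is at most
  \<open>t\<close>.\<close>

lemma xi_sector: assumes "L \<in> E" "x \<in> sector z L" shows "\<xi> x = nrm L \<bullet> (x - z)"
proof (rule antisym)
  obtain t y where ty: "0 \<le> t" "t \<le> 1" "y \<in> facet_set L" "x = z + t *\<^sub>R (y - z)"
    using assms(2) sector_iff by blast
  have "y \<in> S" using facet_frontier[OF assms(1)] ty(3) closed_S by (auto simp: frontier_def)
  obtain L' where L': "L' \<in> E" "\<xi> x = nrm L' \<bullet> (x - z)" by (rule xi_attained)
  have "nrm L' \<bullet> (x - z) = t * (nrm L' \<bullet> (y - z))" using ty by simp
  also have "\<dots> \<le> t * 1" using nrm_le_1[OF L'(1) \<open>y \<in> S\<close>] ty by (intro mult_left_mono) auto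
  also have "\<dots> = nrm L \<bullet> (x - z)" using nrm_sector[OF assms(1) ty(1,3)] ty(4) by simp
  finally show "\<xi> x \<le> nrm L \<bullet> (x - z)" using L' by simp
qed (rule xi_ge[OF assms(1)])

lemma xi_point:
  assumes "0 \<le> t" "t \<le> 1" "y \<in> scaled_boundary E" shows "\<xi> (z + t *\<^sub>R (y - z)) = t"
proof -
  obtain L where L: "L \<in> E" "y \<in> facet_set L" using assms(3) by (auto simp: scaled_boundary_def)
  have "z + t *\<^sub>R (y - z) \<in> sector z L" using assms L by (auto simp: sector_iff)
  then show ?thesis using xi_sector[OF L(1)] nrm_sector[OF L(1) assms(1) L(2)] by metis
qed

lemma S_point:
  assumes "x \<in> S" obtains t y where "0 \<le> t" "t \<le> 1" "y \<in> scaled_boundary E" "x = z + t *\<^sub>R (y - z)"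
  using assms S_eq sector_iff unfolding scaled_boundary_def by blast

lemma xi_range: assumes "x \<in> S" shows "0 \<le> \<xi> x" "\<xi> x \<le> 1"
  using S_point[OF assms] xi_point by metis+

lemma xi_eq_0: assumes "x \<in> S" "\<xi> x = 0" shows "x = z"
  using S_point[OF assms(1)] xi_point assms(2) by (metis scaleR_zero_left add.right_neutral)

lemma xi_scale: assumes "0 \<le> t" shows "\<xi> (z + t *\<^sub>R (x - z)) = t * \<xi> x"
proof (rule antisym)
  obtain L where L: "L \<in> E" "\<xi> (z + t *\<^sub>R (x - z)) = nrm L \<bullet> (z + t *\<^sub>R (x - z) - z)" by (rule xi_attained)
  then show "\<xi> (z + t *\<^sub>R (x - z)) \<le> t * \<xi> x"
    using xi_ge[OF L(1), of x] assms by (simp add: mult_left_mono)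
  obtain L where L: "L \<in> E" "\<xi> x = nrm L \<bullet> (x - z)" by (rule xi_attained)
  then show "t * \<xi> x \<le> \<xi> (z + t *\<^sub>R (x - z))"
    using xi_ge[OF L(1), of "z + t *\<^sub>R (x - z)"] by simp
qed

definition "nrm_bound = Max ((\<lambda>L. norm (nrm L)) ` E)"

lemma nrm_bound: "L \<in> E \<Longrightarrow> norm (nrm L) \<le> nrm_bound" and nrm_bound_nonneg: "0 \<le> nrm_bound"
proof -
  show *: "L \<in> E \<Longrightarrow> norm (nrm L) \<le> nrm_bound" for L
    unfolding nrm_bound_def using finite_E by (intro Max_ge) auto
  obtain L where "L \<in> E" using E_nonempty by blast
  from *[OF this] show "0 \<le> nrm_bound" by (rule order_trans[OF norm_ge_zero])
qed

lemma xi_diff_le: "\<xi> x - \<xi> y \<le> nrm_bound * dist x y"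
proof -
  obtain L where L: "L \<in> E" "\<xi> x = nrm L \<bullet> (x - z)" by (rule xi_attained)
  have "\<xi> x - \<xi> y \<le> nrm L \<bullet> (x - z) - nrm L \<bullet> (y - z)"
    using L xi_ge[OF L(1), of y] by simp
  also have "\<dots> = nrm L \<bullet> (x - y)" by (simp add: inner_diff_right)
  also have "\<dots> \<le> norm (nrm L) * norm (x - y)" by (rule norm_cauchy_schwarz)
  also have "\<dots> \<le> nrm_bound * dist x y"
    using nrm_bound[OF L(1)] by (simp add: dist_norm mult_right_mono)
  finally show ?thesis .
qed

lemma xi_lipschitz: "\<bar>\<xi> x - \<xi> y\<bar> \<le> nrm_bound * dist x y"
  using xi_diff_le[of x y] xi_diff_le[of y x] by (simp add: dist_commute abs_le_iff)

lemma continuous_xi: "continuous_on UNIV \<xi>"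
proof -
  have "nrm_bound-lipschitz_on UNIV \<xi>"
    by (rule lipschitz_onI) (use xi_lipschitz nrm_bound_nonneg in \<open>auto simp: dist_real_def\<close>)
  then show ?thesis by (rule lipschitz_on_continuous_on)
qed

lemma xi_measurable[measurable]: "\<xi> \<in> borel_measurable borel"
  by (rule borel_measurable_continuous_onI[OF continuous_xi])

lemma G_measurable[measurable]: "G \<in> borel_measurable borel"
proof -
  have [measurable]: "interior (sector z L) \<in> sets borel" for L by simp
  show ?thesis unfolding radial_grad_def by measurable
qed

lemma G_sector: assumes "L \<in> E" "x \<in> interior (sector z L)" shows "G x = nrm L"
proof -
  have "indicator (interior (sector z L')) x = (if L' = L then 1 else 0 :: real)" if "L' \<in> E" for L'
    using sectors_disjoint[OF assms(1) that] assms(2) by (auto simp: indicator_def)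
  then have "G x = (\<Sum>L'\<in>E. (if L' = L then 1 else 0) *\<^sub>R nrm L')"
    unfolding radial_grad_def by (intro sum.cong) auto
  also have "\<dots> = (\<Sum>L'\<in>E. if L' = L then nrm L' else 0)" by (intro sum.cong) auto
  finally show ?thesis using finite_E assms(1) by simp
qed

lemma AE_interior_sector: "AE x in lebesgue. x \<in> S \<longrightarrow> (\<exists>L\<in>E. x \<in> interior (sector z L))"
proof -
  have "negligible (\<Union>L\<in>E. frontier (sector z L))"
    using finite_E by (intro negligible_Union) (auto intro: negligible_convex_frontier convex_sector)
  then have "AE x in lebesgue. x \<notin> (\<Union>L\<in>E. frontier (sector z L))"
    by (intro AE_not_in) (simp add: negligible_iff_null_sets)
  then show ?thesis
  proof eventually_elim
    case (elim x)
    show ?case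
    proof
      assume "x \<in> S"
      then obtain L where L: "L \<in> E" "x \<in> sector z L" using S_eq by blast
      then show "\<exists>L\<in>E. x \<in> interior (sector z L)"
        using elim closure_subset[of "sector z L"] by (intro bexI[of _ L]) (auto simp: frontier_def)
    qed
  qed
qed

lemma gderiv_xi: assumes "L \<in> E" "x \<in> interior (sector z L)" shows "GDERIV \<xi> x :> G x"
proof -
  have "((\<lambda>x. nrm L \<bullet> (x - z)) has_derivative (\<lambda>h. h \<bullet> nrm L)) (at x)"
    by (auto intro!: derivative_eq_intros simp: inner_commute)
  then have "(\<xi> has_derivative (\<lambda>h. h \<bullet> nrm L)) (at x)"
  proof (rule has_derivative_transform_within_open)
    show "open (interior (sector z L))" "x \<in> interior (sector z L)" using assms by auto
    show "nrm L \<bullet> (y - z) = \<xi> y" if "y \<in> interior (sector z L)" for y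
      using xi_sector[OF assms(1)] interior_subset that by fastforce
  qed
  then show ?thesis unfolding G_sector[OF assms] gderiv_def .
qed

text \<open>Euler's identity for a function homogeneous of degree 1 about \<open>z\<close>.\<close>

lemma G_radial: assumes "L \<in> E" "x \<in> interior (sector z L)" shows "G x \<bullet> (x - z) = \<xi> x"
  using xi_sector[OF assms(1), of x] assms(2) interior_subset[of "sector z L"] G_sector[OF assms] by auto

lemma norm_G_le: "x \<in> interior (sector z L) \<Longrightarrow> L \<in> E \<Longrightarrow> norm (G x) \<le> nrm_bound"
  using G_sector nrm_bound by metis

text \<open>Stated in the form that \<open>pushforward_homogeneous\<close> needs: after the
  substitution by a dilation, the indicator of the part \<open>\<xi> \<le> t\<close> of the sector
  becomes the indicator of the whole sector.\<close>

lemma sector_scale: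
  assumes "L \<in> E" "0 < t" "t \<le> 1"
  shows "z + t *\<^sub>R (x - z) \<in> sector z L \<and> \<xi> (z + t *\<^sub>R (x - z)) \<le> t \<longleftrightarrow> x \<in> sector z L"
proof
  assume *: "z + t *\<^sub>R (x - z) \<in> sector z L \<and> \<xi> (z + t *\<^sub>R (x - z)) \<le> t"
  then obtain s y where sy: "0 \<le> s" "y \<in> facet_set L" "z + t *\<^sub>R (x - z) = z + s *\<^sub>R (y - z)"
    using sector_iff by blast
  moreover have "\<xi> (z + t *\<^sub>R (x - z)) = s"
    using xi_sector[OF assms(1)] * nrm_sector[OF assms(1) sy(1,2)] sy(3) by metis
  moreover have "x = z + (s / t) *\<^sub>R (y - z)"
  proof -
    have "t *\<^sub>R (x - z) = s *\<^sub>R (y - z)" using sy(3) by simp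
    then have "(1 / t) *\<^sub>R t *\<^sub>R (x - z) = (1 / t) *\<^sub>R s *\<^sub>R (y - z)" by simp
    then have "x - z = (s / t) *\<^sub>R (y - z)" using assms(2) by simp
    then show ?thesis by (simp add: algebra_simps)
  qed
  ultimately show "x \<in> sector z L"
    using * assms(2) unfolding sector_iff by (intro exI[of _ "s / t"] exI[of _ y]) simp
next
  assume x: "x \<in> sector z L"
  then obtain s y where sy: "0 \<le> s" "s \<le> 1" "y \<in> facet_set L" "x = z + s *\<^sub>R (y - z)"
    using sector_iff by blast
  have "z + t *\<^sub>R (x - z) \<in> sector z L"
    unfolding sector_iff using sy assms(2,3)
    by (intro exI[of _ "t * s"] exI[of _ y]) (auto simp: mult_le_one)
  moreover have "\<xi> (z + t *\<^sub>R (x - z)) \<le> t"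
    using assms(2) xi_range(2)[of x] x sector_subset[OF assms(1)] by (auto simp: xi_scale)
  ultimately show "z + t *\<^sub>R (x - z) \<in> sector z L \<and> \<xi> (z + t *\<^sub>R (x - z)) \<le> t" by blast
qed

lemma S_scale:
  assumes "0 < t" "t \<le> 1"
  shows "z + t *\<^sub>R (x - z) \<in> S \<and> \<xi> (z + t *\<^sub>R (x - z)) \<le> t \<longleftrightarrow> x \<in> S"
  using sector_scale[OF _ assms, of _ x] S_eq by blast

end

subsection \<open>Weak derivatives of Lipschitz functions\<close>

lemma GDERIV_directional_sequence:
  assumes "GDERIV f x :> d"
  shows "(\<lambda>n. (f (x + inverse (real (Suc n)) *\<^sub>R v) - f x) / inverse (real (Suc n))) \<longlonglongrightarrow> v \<bullet> d"
proof -
  have "((\<lambda>t. x + t *\<^sub>R v) has_derivative (\<lambda>t. t *\<^sub>R v)) (at 0)"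
    by (auto intro!: derivative_eq_intros)
  moreover have "(f has_derivative (\<lambda>h. h \<bullet> d)) (at (x + 0 *\<^sub>R v))"
    using assms by (simp add: gderiv_def)
  ultimately have "((\<lambda>t. f (x + t *\<^sub>R v)) has_derivative (\<lambda>t. (t *\<^sub>R v) \<bullet> d)) (at 0)"
    by (rule has_derivative_compose)
  then have "((\<lambda>t. f (x + t *\<^sub>R v)) has_real_derivative (v \<bullet> d)) (at 0)"
    by (simp add: has_field_derivative_def mult.commute[of _ "v \<bullet> d"])
  then have "((\<lambda>t. (f (x + t *\<^sub>R v) - f x) / t) \<longlongrightarrow> v \<bullet> d) (at 0)"
    by (simp add: DERIV_def)
  moreover have "filterlim (\<lambda>n. inverse (real (Suc n))) (at 0) sequentially"
    using LIMSEQ_inverse_real_of_nat by (simp add: filterlim_at del: of_nat_Suc)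
  ultimately show ?thesis by (rule filterlim_compose)
qed

lemma C1_compact_support_lipschitz:
  fixes w :: "'a::euclidean_space \<Rightarrow> real"
  assumes w: "C1_with_gradient w D" and K: "compact K" "\<And>x. x \<notin> K \<Longrightarrow> D x = 0"
  obtains M where "0 \<le> M" "\<And>x y. \<bar>w x - w y\<bar> \<le> M * norm (x - y)" "\<And>x. norm (D x) \<le> M"
proof -
  have "compact (D ` K)" by (intro compact_continuous_image C1_with_gradientD[OF w] K)
  then have "bounded (D ` K)" by (rule compact_imp_bounded)
  then obtain B where B: "0 < B" "\<forall>y\<in>D ` K. norm y \<le> B"
    unfolding bounded_pos by blast
  have D: "norm (D x) \<le> B" for x using B K(2)[of x] by (cases "x \<in> K") (auto simp: less_imp_le)
  show ?thesis
  proof (rule that[of B])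
    show "\<bar>w x - w y\<bar> \<le> B * norm (x - y)" for x y
    proof -
      have "norm (w x - w y) \<le> B * norm (x - y)"
      proof (rule differentiable_bound[OF convex_UNIV])
        show "(w has_derivative (\<lambda>h. h \<bullet> D x)) (at x within UNIV)" for x
          using C1_with_gradientD(1)[OF w] by (simp add: gderiv_def)
        show "onorm (\<lambda>h. h \<bullet> D x) \<le> B" for x
        proof (rule onorm_le)
          fix h
          have "norm (h \<bullet> D x) \<le> norm h * norm (D x)" by (simp add: Cauchy_Schwarz_ineq2)
          also have "\<dots> \<le> norm h * B" by (intro mult_left_mono D) simp
          finally show "norm (h \<bullet> D x) \<le> B * norm h" by (simp add: mult.commute)
        qed
      qed auto
      then show ?thesis by simp
    qed
  qed (use D B in auto)
qed

lemma lborel_integral_translate: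
  fixes f :: "'a::euclidean_space \<Rightarrow> real"
  assumes "f \<in> borel_measurable borel"
  shows "(LINT x|lborel. f (c + x)) = (LINT x|lborel. f x)"
proof -
  have "(LINT x|lborel. f x) = (LINT x|distr lborel borel ((+) c). f x)"
    by (simp add: lborel_distr_plus)
  also have "\<dots> = (LINT x|lborel. f (c + x))"
    using assms by (subst integral_distr) auto
  finally show ?thesis by simp
qed

lemma test_function_integrable:
  fixes f :: "'a::euclidean_space \<Rightarrow> real"
  assumes "continuous_on UNIV f" "compact K" "\<And>x. x \<notin> K \<Longrightarrow> f x = 0"
  shows "integrable lborel f"
proof -
  have "integrable lborel (\<lambda>x. indicator K x *\<^sub>R f x)"
    using borel_integrable_compact[OF assms(2) continuous_on_subset[OF assms(1)]] by (simp add: mult.commute cong: if_cong)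
  moreover have "(\<lambda>x. indicator K x *\<^sub>R f x) = f"
    using assms(3) by (auto simp: fun_eq_iff indicator_def)
  ultimately show ?thesis by simp
qed

text \<open>Translation invariance moves the difference quotient in direction \<open>v\<close> from
  \<open>w\<close> to a quotient of \<open>u\<close> in direction \<open>- v\<close>. Both sides
  converge by dominated convergence, the Lipschitz constants of \<open>w\<close> and
  \<open>u\<close> providing the bounds.\<close>

proposition lipschitz_weak_derivative:
  fixes u :: "'a::euclidean_space \<Rightarrow> real"
  assumes u: "\<And>x y. \<bar>u x - u y\<bar> \<le> C * dist x y" and Du[measurable]: "Du \<in> borel_measurable borel"
    and deriv: "AE x in lborel. x \<in> interior S \<longrightarrow> GDERIV u x :> Du x"
    and w: "test_function S w D"
  shows "(LINT x|lborel. u x * (v \<bullet> D x)) = - (LINT x|lborel. w x * (v \<bullet> Du x))"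
proof -
  obtain K where c1: "C1_with_gradient w D" and K: "compact K" "K \<subseteq> interior S"
    "\<And>x. x \<notin> K \<Longrightarrow> w x = 0" "\<And>x. x \<notin> K \<Longrightarrow> D x = 0"
    using test_functionD[OF w] by blast
  obtain M where M: "0 \<le> M" "\<And>x y. \<bar>w x - w y\<bar> \<le> M * norm (x - y)" "\<And>x. norm (D x) \<le> M"
    using C1_compact_support_lipschitz[OF c1 K(1,4)] by blast
  have C: "0 \<le> C"
  proof -
    obtain b :: 'a where "b \<in> Basis" using nonempty_Basis by blast
    then have "0 \<le> C * 1" using u[of b 0] by (metis abs_ge_zero order_trans dist_0_norm dist_commute norm_Basis)
    then show ?thesis by simp
  qed
  have cu: "continuous_on UNIV u"
    by (rule lipschitz_on_continuous_on[of C]) (use u C in \<open>auto intro!: lipschitz_onI simp: dist_real_def\<close>)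
  have cw: "continuous_on UNIV w" by (rule C1_with_gradientD[OF c1])
  note [measurable] = borel_measurable_continuous_onI[OF cu] borel_measurable_continuous_onI[OF cw]
    borel_measurable_continuous_onI[OF C1_with_gradientD(2)[OF c1]]
  define \<tau> where "\<tau> n = inverse (real (Suc n))" for n
  have \<tau>: "0 < \<tau> n" "\<tau> n \<le> 1" for n by (auto simp: \<tau>_def inverse_le_1_iff)
  \<comment> \<open>As \<open>\<tau> n \<le> 1\<close>, all translates of \<open>w\<close> that
    occur are supported in this one compact set.\<close>
  define K' where "K' = {x + y |x y. x \<in> K \<and> y \<in> cball 0 (norm v)}"
  have K': "compact K'" unfolding K'_def by (intro compact_sums K compact_cball)
  have w_out: "w (x + \<tau> n *\<^sub>R v) = 0" if "x \<notin> K'" for x n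
  proof (rule K(3))
    show "x + \<tau> n *\<^sub>R v \<notin> K"
    proof
      assume "x + \<tau> n *\<^sub>R v \<in> K"
      moreover have "- (\<tau> n *\<^sub>R v) \<in> cball 0 (norm v)" using \<tau>[of n] by (simp add: mult_left_le_one_le)
      ultimately have "(x + \<tau> n *\<^sub>R v) + - (\<tau> n *\<^sub>R v) \<in> K'" unfolding K'_def by blast
      then show False using that by simp
    qed
  qed
  have KK': "K \<subseteq> K'" unfolding K'_def by (force intro: exI[of _ "0::'a"])
  have shift_cont: "continuous_on UNIV (\<lambda>x. u x * w (x + \<tau> n *\<^sub>R v))" for n
    by (intro continuous_on_mult cu continuous_on_compose2[OF cw]) (auto intro!: continuous_intros)
  have uw_int: "integrable lborel (\<lambda>x. u x * w x)"
    by (rule test_function_integrable[OF _ K(1)]) (use K(3) cu cw in \<open>auto intro!: continuous_on_mult\<close>)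
  have us_int: "integrable lborel (\<lambda>x. u x * w (x + \<tau> n *\<^sub>R v))" for n
    by (rule test_function_integrable[OF shift_cont K']) (use w_out in auto)
  have us_int': "integrable lborel (\<lambda>x. u (x + \<tau> n *\<^sub>R (- v)) * w x)" for n
    by (rule test_function_integrable[OF _ K(1)])
      (use K(3) in \<open>auto intro!: continuous_on_mult cw continuous_on_compose2[OF cu] continuous_intros\<close>)
  let ?a = "\<lambda>n x. u x * ((w (x + \<tau> n *\<^sub>R v) - w x) / \<tau> n)"
  let ?b = "\<lambda>n x. ((u (x + \<tau> n *\<^sub>R (- v)) - u x) / \<tau> n) * w x"
  have ab: "(LINT x|lborel. ?a n x) = (LINT x|lborel. ?b n x)" for n
  proof -
    have "(LINT x|lborel. u x * w (x + \<tau> n *\<^sub>R v)) = (LINT x|lborel. u (\<tau> n *\<^sub>R (- v) + x) * w (\<tau> n *\<^sub>R (- v) + x + \<tau> n *\<^sub>R v))"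
      by (rule lborel_integral_translate[symmetric]) measurable
    also have "\<dots> = (LINT x|lborel. u (x + \<tau> n *\<^sub>R (- v)) * w x)"
      by (simp add: algebra_simps)
    finally have eq: "(LINT x|lborel. u x * w (x + \<tau> n *\<^sub>R v)) = (LINT x|lborel. u (x + \<tau> n *\<^sub>R (- v)) * w x)" .
    have "(LINT x|lborel. ?a n x) = (LINT x|lborel. (u x * w (x + \<tau> n *\<^sub>R v) - u x * w x) / \<tau> n)"
      by (simp add: right_diff_distrib)
    also have "\<dots> = (LINT x|lborel. (u (x + \<tau> n *\<^sub>R (- v)) * w x - u x * w x) / \<tau> n)"
      using us_int us_int' uw_int eq by simp
    also have "\<dots> = (LINT x|lborel. ?b n x)" by (simp add: left_diff_distrib)
    finally show ?thesis .
  qed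
  have "(\<lambda>n. LINT x|lborel. ?a n x) \<longlonglongrightarrow> (LINT x|lborel. u x * (v \<bullet> D x))"
  proof (rule integral_dominated_convergence[where w="\<lambda>x. indicator K' x *\<^sub>R (\<bar>u x\<bar> * (M * norm v))"])
    show "integrable lborel (\<lambda>x. indicator K' x *\<^sub>R (\<bar>u x\<bar> * (M * norm v)))"
      using borel_integrable_compact[OF K', of "\<lambda>x. \<bar>u x\<bar> * (M * norm v)"] continuous_on_subset[OF cu, of K']
      by (simp add: continuous_intros mult.commute cong: if_cong)
    show "AE x in lborel. (\<lambda>n. ?a n x) \<longlonglongrightarrow> u x * (v \<bullet> D x)"
      unfolding \<tau>_def by (intro AE_I2 tendsto_mult_left GDERIV_directional_sequence C1_with_gradientD[OF c1])
    show "AE x in lborel. norm (?a n x) \<le> indicator K' x *\<^sub>R (\<bar>u x\<bar> * (M * norm v))" for n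
    proof (rule AE_I2)
      fix x
      show "norm (?a n x) \<le> indicator K' x *\<^sub>R (\<bar>u x\<bar> * (M * norm v))"
      proof (cases "x \<in> K'")
        case True
        have "\<bar>w (x + \<tau> n *\<^sub>R v) - w x\<bar> \<le> M * (\<tau> n * norm v)"
          using M(2)[of "x + \<tau> n *\<^sub>R v" x] \<tau>[of n] by simp
        then have "\<bar>w (x + \<tau> n *\<^sub>R v) - w x\<bar> / \<tau> n \<le> M * norm v"
          using \<tau>(1)[of n] by (simp add: field_simps)
        then have "\<bar>u x\<bar> * (\<bar>w (x + \<tau> n *\<^sub>R v) - w x\<bar> / \<tau> n) \<le> \<bar>u x\<bar> * (M * norm v)"
          by (intro mult_left_mono) auto
        then show ?thesis using True \<tau>(1)[of n] by (simp add: abs_mult)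
      next
        case False
        then show ?thesis using w_out[OF False] K(3)[of x] KK' by auto
      qed
    qed
  qed measurable
  moreover have "(\<lambda>n. LINT x|lborel. ?b n x) \<longlonglongrightarrow> (LINT x|lborel. ((- v) \<bullet> Du x) * w x)"
  proof (rule integral_dominated_convergence[where w="\<lambda>x. (C * norm v) * \<bar>w x\<bar>"])
    show "integrable lborel (\<lambda>x. (C * norm v) * \<bar>w x\<bar>)"
      using test_function_integrable[OF cw K(1,3)] by simp
    show "AE x in lborel. (\<lambda>n. ?b n x) \<longlonglongrightarrow> ((- v) \<bullet> Du x) * w x"
      using deriv
    proof eventually_elim
      case (elim x)
      show ?case
      proof (cases "x \<in> K")
        case True
        then have "GDERIV u x :> Du x" using elim K(2) by auto
        then show ?thesis unfolding \<tau>_def by (intro tendsto_mult_right GDERIV_directional_sequence)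
      qed (simp add: K(3))
    qed
    show "AE x in lborel. norm (?b n x) \<le> (C * norm v) * \<bar>w x\<bar>" for n
    proof (rule AE_I2)
      fix x
      have "\<bar>u (x + \<tau> n *\<^sub>R (- v)) - u x\<bar> \<le> C * (\<tau> n * norm v)"
        using u[of "x + \<tau> n *\<^sub>R (- v)" x] \<tau>[of n] by (simp add: dist_norm)
      then have "\<bar>u (x + \<tau> n *\<^sub>R (- v)) - u x\<bar> / \<tau> n \<le> C * norm v"
        using \<tau>(1)[of n] by (simp add: field_simps)
      then have "\<bar>u (x + \<tau> n *\<^sub>R (- v)) - u x\<bar> / \<tau> n * \<bar>w x\<bar> \<le> (C * norm v) * \<bar>w x\<bar>"
        by (intro mult_right_mono) auto
      then show "norm (?b n x) \<le> (C * norm v) * \<bar>w x\<bar>"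
        using \<tau>(1)[of n] by (simp add: abs_mult)
    qed
  qed measurable
  ultimately have "(LINT x|lborel. u x * (v \<bullet> D x)) = (LINT x|lborel. ((- v) \<bullet> Du x) * w x)"
    unfolding ab by (rule LIMSEQ_unique)
  then show ?thesis by (simp add: mult.commute)
qed

subsection \<open>Calculus of weak gradients\<close>

lemma C1_compact_support_bounded:
  fixes w :: "'a::euclidean_space \<Rightarrow> 'b::euclidean_space"
  assumes "continuous_on UNIV w" "compact K" "\<And>x. x \<notin> K \<Longrightarrow> w x = 0"
  obtains B where "0 \<le> B" "\<And>x. norm (w x) \<le> B"
proof -
  have "bounded (w ` K)"
    by (intro compact_imp_bounded compact_continuous_image continuous_on_subset[OF assms(1)] assms(2)) auto
  then obtain B where B: "0 < B" "\<forall>y\<in>w ` K. norm y \<le> B"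
    unfolding bounded_pos by blast
  have "norm (w x) \<le> B" for x
    using B assms(3)[of x] by (cases "x \<in> K") (auto simp: less_imp_le)
  then show ?thesis using that B(1) by (meson less_imp_le)
qed

lemma integrable_mult_bounded:
  fixes f g :: "'a \<Rightarrow> real"
  assumes f: "integrable M f" and [measurable]: "g \<in> borel_measurable M" and g: "\<And>x. \<bar>g x\<bar> \<le> B"
  shows "integrable M (\<lambda>x. f x * g x)"
proof (rule Bochner_Integration.integrable_bound)
  show "integrable M (\<lambda>x. B * f x)" using f by simp
  show "(\<lambda>x. f x * g x) \<in> borel_measurable M" using f by measurable
  have "\<bar>g x\<bar> \<le> \<bar>B\<bar>" for x using g[of x] by linarith
  then have "\<bar>f x\<bar> * \<bar>g x\<bar> \<le> \<bar>f x\<bar> * \<bar>B\<bar>" for x by (intro mult_left_mono) auto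
  then show "AE x in M. norm (f x * g x) \<le> norm (B * f x)"
    by (intro AE_I2) (simp add: abs_mult mult.commute)
qed

lemma borel_measurable_lebesgue_onI:
  "f \<in> borel_measurable borel \<Longrightarrow> f \<in> borel_measurable (lebesgue_on S)"
  by (intro measurable_restrict_space1 measurable_completion) simp

lemma square_integrable_scalar:
  "square_integrable S \<phi> \<longleftrightarrow> \<phi> \<in> borel_measurable (lebesgue_on S) \<and> integrable (lebesgue_on S) (\<lambda>x. (\<phi> x)\<^sup>2)"
  for \<phi> :: "_ \<Rightarrow> real"
  by (simp add: square_integrable_def)

lemma square_integrable_integrable:
  fixes g :: "'a::euclidean_space \<Rightarrow> 'b::euclidean_space"
  assumes S: "S \<in> lmeasurable" and g: "square_integrable S g"
  shows "integrable (lebesgue_on S) g"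
proof -
  have m: "g \<in> borel_measurable (lebesgue_on S)" and i: "integrable (lebesgue_on S) (\<lambda>x. (norm (g x))\<^sup>2)"
    using g by (simp_all add: square_integrable_def)
  have "integrable (lebesgue_on S) (\<lambda>x. norm (g x))"
    by (rule finite_measure.integrable_of_square[OF finite_measure_lebesgue_on[OF S] _ i])
      (use m in measurable)
  then show ?thesis using m by (simp only: integrable_norm_iff)
qed

lemma square_integrable_add:
  fixes f g :: "'a::euclidean_space \<Rightarrow> 'b::euclidean_space"
  assumes "square_integrable S f" "square_integrable S g"
  shows "square_integrable S (\<lambda>x. f x + g x)"
proof -
  have [measurable]: "f \<in> borel_measurable (lebesgue_on S)" "g \<in> borel_measurable (lebesgue_on S)" and
    int: "integrable (lebesgue_on S) (\<lambda>x. (norm (f x))\<^sup>2)" "integrable (lebesgue_on S) (\<lambda>x. (norm (g x))\<^sup>2)"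
    using assms by (auto simp: square_integrable_def)
  have "integrable (lebesgue_on S) (\<lambda>x. (norm (f x + g x))\<^sup>2)"
  proof (rule Bochner_Integration.integrable_bound)
    show "integrable (lebesgue_on S) (\<lambda>x. 2 * (norm (f x))\<^sup>2 + 2 * (norm (g x))\<^sup>2)" using int by simp
    show "AE x in lebesgue_on S. norm ((norm (f x + g x))\<^sup>2) \<le> norm (2 * (norm (f x))\<^sup>2 + 2 * (norm (g x))\<^sup>2)"
    proof (rule AE_I2)
      fix x
      have "(norm (f x + g x))\<^sup>2 \<le> (norm (f x) + norm (g x))\<^sup>2"
        by (intro power_mono norm_triangle_ineq) auto
      also have "\<dots> \<le> 2 * (norm (f x))\<^sup>2 + 2 * (norm (g x))\<^sup>2"
        using sum_squares_bound[of "norm (f x)" "norm (g x)"] by (simp add: power2_sum)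
      finally show "norm ((norm (f x + g x))\<^sup>2) \<le> norm (2 * (norm (f x))\<^sup>2 + 2 * (norm (g x))\<^sup>2)" by simp
    qed
  qed measurable
  then show ?thesis by (simp add: square_integrable_def)
qed

lemma square_integrable_cmult:
  fixes f :: "'a::euclidean_space \<Rightarrow> 'b::euclidean_space"
  shows "square_integrable S f \<Longrightarrow> square_integrable S (\<lambda>x. c *\<^sub>R f x)"
  by (auto simp: square_integrable_def power_mult_distrib)

lemma test_function_products_integrable:
  fixes f :: "'a::euclidean_space \<Rightarrow> real"
  assumes f: "integrable (lebesgue_on S) f" and w: "test_function S w D"
  shows "integrable (lebesgue_on S) (\<lambda>x. f x * (D x \<bullet> i))" "integrable (lebesgue_on S) (\<lambda>x. f x * w x)"
proof -
  from test_functionD[OF w] obtain K where c: "C1_with_gradient w D" and K: "compact K"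
    "\<And>x. x \<notin> K \<Longrightarrow> w x = 0" "\<And>x. x \<notin> K \<Longrightarrow> D x = 0" by blast
  have cD: "continuous_on UNIV (\<lambda>x. D x \<bullet> i)" by (intro continuous_intros C1_with_gradientD[OF c])
  obtain B where "\<And>x. norm (D x \<bullet> i) \<le> B"
    using C1_compact_support_bounded[OF cD K(1)] K(3) by (metis inner_zero_left)
  then show "integrable (lebesgue_on S) (\<lambda>x. f x * (D x \<bullet> i))"
    using cD by (intro integrable_mult_bounded[OF f] borel_measurable_lebesgue_onI borel_measurable_continuous_onI) auto
  obtain B where "\<And>x. norm (w x) \<le> B"
    using C1_compact_support_bounded[OF C1_with_gradientD(3)[OF c] K(1)] K(2) by metis
  then show "integrable (lebesgue_on S) (\<lambda>x. f x * w x)"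
    using C1_with_gradientD(3)[OF c]
    by (intro integrable_mult_bounded[OF f] borel_measurable_lebesgue_onI borel_measurable_continuous_onI) auto
qed

lemma integrable_scaleR_components:
  fixes f :: "'a \<Rightarrow> real" and g :: "'a \<Rightarrow> 'b::euclidean_space"
  assumes "\<And>i. i \<in> Basis \<Longrightarrow> integrable M (\<lambda>x. f x * (g x \<bullet> i))"
  shows "integrable M (\<lambda>x. f x *\<^sub>R g x)"
proof -
  have "integrable M (\<lambda>x. \<Sum>i\<in>Basis. (f x * (g x \<bullet> i)) *\<^sub>R i)"
    using assms by (intro Bochner_Integration.integrable_sum integrable_scaleR_left) auto
  moreover have "(\<Sum>i\<in>Basis. (f x * (g x \<bullet> i)) *\<^sub>R i) = f x *\<^sub>R g x" for x
    by (subst euclidean_representation[of "g x", symmetric]) (simp add: scaleR_sum_right)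
  ultimately show ?thesis by simp
qed

text \<open>Finite measure of \<open>S\<close> turns square integrable functions into integrable
  ones, and test functions are bounded. All integrands are thus integrable and the vector identity
  may be read componentwise.\<close>

lemma has_weak_gradient_iff_components:
  assumes S: "S \<in> lmeasurable"
  shows "has_weak_gradient S \<phi> g \<longleftrightarrow> square_integrable S \<phi> \<and> square_integrable S g \<and>
     (\<forall>w D. test_function S w D \<longrightarrow> (\<forall>i\<in>Basis.
        (LINT x|lebesgue_on S. \<phi> x * (D x \<bullet> i)) = - (LINT x|lebesgue_on S. (g x \<bullet> i) * w x)))"
proof -
  have "(LINT x|lebesgue_on S. \<phi> x *\<^sub>R D x) = - (LINT x|lebesgue_on S. w x *\<^sub>R g x) \<longleftrightarrow>
      (\<forall>i\<in>Basis. (LINT x|lebesgue_on S. \<phi> x * (D x \<bullet> i)) = - (LINT x|lebesgue_on S. (g x \<bullet> i) * w x))"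
    if sq: "square_integrable S \<phi>" "square_integrable S g" and w: "test_function S w D" for w D
  proof -
    note i1 = test_function_products_integrable(1)[OF square_integrable_integrable[OF S sq(1)] w]
    have gi: "integrable (lebesgue_on S) (\<lambda>x. g x \<bullet> i)" for i
      by (rule integrable_inner_left[OF square_integrable_integrable[OF S sq(2)]])
    note i2 = test_function_products_integrable(2)[OF gi w]
    have I1: "integrable (lebesgue_on S) (\<lambda>x. \<phi> x *\<^sub>R D x)"
      using i1 by (intro integrable_scaleR_components)
    have I2: "integrable (lebesgue_on S) (\<lambda>x. w x *\<^sub>R g x)"
      using i2 by (intro integrable_scaleR_components) (simp add: mult.commute)
    show ?thesis
      by (subst euclidean_eq_iff)
        (simp add: integral_inner_left[OF I1, symmetric] integral_inner_left[OF I2, symmetric] mult.commute)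
  qed
  then show ?thesis unfolding has_weak_gradient_def by blast
qed

lemma has_weak_gradient_add:
  assumes S: "S \<in> lmeasurable" and "has_weak_gradient S \<phi> g" "has_weak_gradient S \<psi> h"
  shows "has_weak_gradient S (\<lambda>x. \<phi> x + \<psi> x) (\<lambda>x. g x + h x)"
  unfolding has_weak_gradient_iff_components[OF S]
proof (intro conjI allI impI ballI)
  note A = assms(2,3)[unfolded has_weak_gradient_iff_components[OF S]]
  show "square_integrable S (\<lambda>x. \<phi> x + \<psi> x)" "square_integrable S (\<lambda>x. g x + h x)"
    using A by (auto intro: square_integrable_add)
  fix w D and i :: 'a assume w: "test_function S w D" and i: "i \<in> Basis"
  have sq: "square_integrable S \<phi>" "square_integrable S g" "square_integrable S \<psi>" "square_integrable S h" using A by auto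
  note int = sq[THEN square_integrable_integrable[OF S]]
  note p = test_function_products_integrable(1)[OF int(1) w, of i] test_function_products_integrable(1)[OF int(3) w, of i]
    test_function_products_integrable(2)[OF integrable_inner_left[OF int(2)] w, of i]
    test_function_products_integrable(2)[OF integrable_inner_left[OF int(4)] w, of i]
  show "(LINT x|lebesgue_on S. (\<phi> x + \<psi> x) * (D x \<bullet> i)) = - (LINT x|lebesgue_on S. ((g x + h x) \<bullet> i) * w x)"
    using A w i p by (simp add: distrib_right inner_add_left)
qed

lemma has_weak_gradient_cmult:
  assumes S: "S \<in> lmeasurable" and "has_weak_gradient S \<phi> g"
  shows "has_weak_gradient S (\<lambda>x. c * \<phi> x) (\<lambda>x. c *\<^sub>R g x)"
  unfolding has_weak_gradient_iff_components[OF S]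
proof (intro conjI allI impI ballI)
  note A = assms(2)[unfolded has_weak_gradient_iff_components[OF S]]
  show "square_integrable S (\<lambda>x. c * \<phi> x)" "square_integrable S (\<lambda>x. c *\<^sub>R g x)"
    using A square_integrable_cmult[of S \<phi> c] square_integrable_cmult[of S g c] by auto
  fix w D and i :: 'a assume "test_function S w D" "i \<in> Basis"
  then have "(LINT x|lebesgue_on S. \<phi> x * (D x \<bullet> i)) = - (LINT x|lebesgue_on S. (g x \<bullet> i) * w x)"
    using A by blast
  then show "(LINT x|lebesgue_on S. c * \<phi> x * (D x \<bullet> i)) = - (LINT x|lebesgue_on S. (c *\<^sub>R g x \<bullet> i) * w x)"
    by (simp add: mult.assoc)
qed

lemma has_weak_gradient_cong:
  assumes S: "S \<in> lmeasurable" and g: "has_weak_gradient S \<phi> g" and \<psi>: "square_integrable S \<psi>"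
    and ae: "AE x in lebesgue_on S. \<psi> x = \<phi> x"
  shows "has_weak_gradient S \<psi> g"
  unfolding has_weak_gradient_iff_components[OF S]
proof (intro conjI allI impI ballI)
  note A = g[unfolded has_weak_gradient_iff_components[OF S]]
  show "square_integrable S \<psi>" "square_integrable S g" using A \<psi> by auto
  fix w D and i :: 'a assume w: "test_function S w D" and i: "i \<in> Basis"
  have sq: "square_integrable S \<phi>" using A by auto
  have "(LINT x|lebesgue_on S. \<psi> x * (D x \<bullet> i)) = (LINT x|lebesgue_on S. \<phi> x * (D x \<bullet> i))"
  proof (rule integral_cong_AE)
    show "(\<lambda>x. \<psi> x * (D x \<bullet> i)) \<in> borel_measurable (lebesgue_on S)"
      "(\<lambda>x. \<phi> x * (D x \<bullet> i)) \<in> borel_measurable (lebesgue_on S)"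
      using test_function_products_integrable(1)[OF square_integrable_integrable[OF S \<psi>] w]
        test_function_products_integrable(1)[OF square_integrable_integrable[OF S sq] w]
      by (auto intro: borel_measurable_integrable)
    show "AE x in lebesgue_on S. \<psi> x * (D x \<bullet> i) = \<phi> x * (D x \<bullet> i)"
      using ae by eventually_elim simp
  qed
  then show "(LINT x|lebesgue_on S. \<psi> x * (D x \<bullet> i)) = - (LINT x|lebesgue_on S. (g x \<bullet> i) * w x)"
    using A w i by simp
qed

text \<open>The difference of the two gradients is a weak gradient of the zero function, to which
  the fundamental lemma applies in every component on the interior; the frontier is a null
  set.\<close>

lemma has_weak_gradient_unique:
  assumes S: "S \<in> lmeasurable" "negligible (frontier S)" and g: "has_weak_gradient S \<phi> g" "has_weak_gradient S \<phi> h"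
  shows "AE x in lebesgue_on S. g x = h x"
proof -
  have SS: "S \<in> sets lebesgue" using S(1) by auto
  have d: "has_weak_gradient S (\<lambda>x. \<phi> x + (- 1) * \<phi> x) (\<lambda>x. g x + (- 1) *\<^sub>R h x)"
    by (intro has_weak_gradient_add has_weak_gradient_cmult S g)
  let ?f = "\<lambda>i x. (g x + (- 1) *\<^sub>R h x) \<bullet> i"
  have int: "integrable lebesgue (\<lambda>x. indicator S x *\<^sub>R ?f i x)" for i
    using integrable_inner_left[OF square_integrable_integrable[OF S(1)]] d SS
    unfolding has_weak_gradient_def by (subst integrable_restrict_space[symmetric]) auto
  have "AE x in lebesgue. x \<in> interior S \<longrightarrow> ?f i x = 0" if i: "i \<in> Basis" for i
  proof (rule AE_zero_if_test_integrals_zero)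
    fix a b assume "cbox a b \<subseteq> interior S"
    then have "(\<lambda>x. indicator (cbox a b) x *\<^sub>R ?f i x) = (\<lambda>x. indicator (cbox a b) x *\<^sub>R (indicator S x *\<^sub>R ?f i x))"
      using interior_subset[of S] by (intro ext) (auto simp: indicator_def)
    then show "set_integrable lebesgue (cbox a b) (?f i)"
      unfolding set_integrable_def by (simp only: integrable_mult_indicator[OF _ int] lmeasurable_cbox fmeasurableD)
  next
    fix w D assume "test_function (interior S) w D"
    then have w: "test_function S w D" by (simp add: test_function_def)
    then have "(LINT x|lebesgue_on S. (\<phi> x + (- 1) * \<phi> x) * (D x \<bullet> i)) = - (LINT x|lebesgue_on S. ?f i x * w x)"
      using d[unfolded has_weak_gradient_iff_components[OF S(1)]] i by blast
    then have "0 = (LINT x|lebesgue_on S. ?f i x * w x)" by simp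
    also have "(LINT x|lebesgue_on S. ?f i x * w x) = (LINT x|lebesgue. indicator S x *\<^sub>R (?f i x * w x))"
      using SS by (subst integral_restrict_space) auto
    also have "(\<lambda>x. indicator S x *\<^sub>R (?f i x * w x)) = (\<lambda>x. w x * ?f i x)"
    proof
      fix x
      show "indicator S x *\<^sub>R (?f i x * w x) = w x * ?f i x"
      proof (cases "x \<in> S")
        case False
        then have "x \<notin> {x. w x \<noteq> 0}"
          using w interior_subset[of S] closure_subset[of "{x. w x \<noteq> 0}"] unfolding test_function_def by blast
        then show ?thesis by simp
      qed simp
    qed
    finally show "(LINT x|lebesgue. w x * ?f i x) = 0" by simp
  qed simp
  then have "AE x in lebesgue. \<forall>i\<in>Basis. x \<in> interior S \<longrightarrow> ?f i x = 0"
    by (intro AE_finite_allI) auto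
  moreover have "AE x in lebesgue. x \<notin> frontier S"
    using S(2) by (intro AE_not_in) (simp add: negligible_iff_null_sets)
  ultimately have "AE x in lebesgue. x \<in> S \<longrightarrow> g x = h x"
  proof eventually_elim
    case (elim x)
    show ?case
    proof
      assume "x \<in> S"
      then have "x \<in> interior S" using elim(2) closure_subset[of S] by (auto simp: frontier_def)
      then have "?f i x = 0" if "i \<in> Basis" for i using elim(1) that by blast
      then have "(g x - h x) \<bullet> i = 0" if "i \<in> Basis" for i using that by simp
      then have "g x - h x = 0" by (intro euclidean_all_zero_iff[THEN iffD1]) blast
      then show "g x = h x" by simp
    qed
  qed
  then show ?thesis using SS by (simp add: AE_restrict_space_iff)
qed

lemma has_weak_gradient_weak_gradient:
  "has_weak_gradient S \<phi> g \<Longrightarrow> has_weak_gradient S \<phi> (weak_gradient S \<phi>)"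
  unfolding weak_gradient_def by (rule someI[of "has_weak_gradient S \<phi>"])

text \<open>Removes the choice made in \<open>weak_gradient\<close>: the form may be computed with
  whichever weak gradients are at hand.\<close>

lemma grad_inner_eq:
  assumes S: "S \<in> lmeasurable" "negligible (frontier S)" and g: "has_weak_gradient S \<phi> g" "has_weak_gradient S \<psi> h"
  shows "grad_inner S \<phi> \<psi> = (LINT x|lebesgue_on S. g x \<bullet> h x)"
  unfolding grad_inner_def
proof (rule integral_cong_AE)
  note w = g[THEN has_weak_gradient_weak_gradient]
  have [measurable]: "weak_gradient S \<phi> \<in> borel_measurable (lebesgue_on S)" "weak_gradient S \<psi> \<in> borel_measurable (lebesgue_on S)"
    "g \<in> borel_measurable (lebesgue_on S)" "h \<in> borel_measurable (lebesgue_on S)"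
    using w g by (auto simp: has_weak_gradient_def square_integrable_def)
  show "(\<lambda>x. weak_gradient S \<phi> x \<bullet> weak_gradient S \<psi> x) \<in> borel_measurable (lebesgue_on S)"
    "(\<lambda>x. g x \<bullet> h x) \<in> borel_measurable (lebesgue_on S)" by measurable
  show "AE x in lebesgue_on S. weak_gradient S \<phi> x \<bullet> weak_gradient S \<psi> x = g x \<bullet> h x"
    using has_weak_gradient_unique[OF S w(1) g(1)] has_weak_gradient_unique[OF S w(2) g(2)]
    by eventually_elim simp
qed

subsection \<open>Push-forward of the volume under the radial coordinate\<close>

context scaled_element
begin

text \<open>The substitution \<open>x = z + a (y - z)\<close> has Jacobian \<open>a^d\<close>, and
  \<open>f\<close> contributes \<open>a^m\<close>, so the part \<open>\<xi> \<le> a\<close> carries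
  the mass \<open>C a^(d+m)\<close>. The instances are the volume of \<open>S\<close>, the volume of
  a sector, and the wedge bump with \<open>m = 4\<close>.\<close>

lemma pushforward_homogeneous:
  fixes f :: "'a \<Rightarrow> real"
  assumes A[measurable]: "A \<in> sets borel" and "A \<subseteq> S"
    and A_scale: "\<And>t x. 0 < t \<Longrightarrow> t \<le> 1 \<Longrightarrow> z + t *\<^sub>R (x - z) \<in> A \<and> \<xi> (z + t *\<^sub>R (x - z)) \<le> t \<longleftrightarrow> x \<in> A"
    and f[measurable]: "f \<in> borel_measurable borel" and f0: "\<And>x. 0 \<le> f x"
    and f_scale: "\<And>t x. 0 < t \<Longrightarrow> t \<le> 1 \<Longrightarrow> x \<in> A \<Longrightarrow> f (z + t *\<^sub>R (x - z)) = t ^ m * f x"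
    and int: "integrable lborel (\<lambda>x. indicator A x * f x)"
  defines "C \<equiv> LINT x|lborel. indicator A x * f x"
  defines "n \<equiv> DIM('a) + m"
  shows "distr (density lborel (\<lambda>x. ennreal (indicator A x * f x))) borel \<xi> =
    density lborel (\<lambda>t. ennreal (C * real n * t ^ (n - 1) * indicator {0..1} t))" (is "?M = ?N")
proof -
  let ?F = "\<lambda>x. ennreal (indicator A x * f x)"
  have n0: "0 < n" by (simp add: n_def)
  have C0: "0 \<le> C" unfolding C_def using f0 by (intro Bochner_Integration.integral_nonneg) auto
  have emM: "emeasure ?M B = (\<integral>\<^sup>+x. ?F x * indicator B (\<xi> x) \<partial>lborel)" if [measurable]: "B \<in> sets borel" for B
  proof -
    have "\<xi> -` B \<in> sets borel" using measurable_sets_borel[OF xi_measurable that] by simp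
    then show ?thesis
      by (subst emeasure_distr)
        (auto simp: emeasure_density vimage_def indicator_def of_bool_def intro!: nn_integral_cong)
  qed
  have tot: "(\<integral>\<^sup>+x. ?F x \<partial>lborel) = ennreal C"
    unfolding C_def using int f0 by (intro nn_integral_eq_integral) auto
  interpret M: finite_measure ?M
    by (rule finite_measureI) (simp add: emM tot)
  have MU: "measure ?M UNIV = C"
    using emM[of UNIV] C0 by (simp add: measure_def tot)
  have xiA: "0 \<le> \<xi> x" "\<xi> x \<le> 1" if "x \<in> A" for x
    using that \<open>A \<subseteq> S\<close> xi_range by auto
  have low: "measure ?M {..a} = C * a ^ n" if a: "0 \<le> a" "a \<le> 1" for a
  proof (cases "a = 0")
    case True
    have "AE x in lborel. x \<noteq> z" by (rule AE_lborel_singleton)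
    then have "AE x in lborel. ?F x * indicator {..0} (\<xi> x) = 0"
    proof eventually_elim
      case (elim x)
      then show ?case
        using xi_eq_0[of x] xiA[of x] \<open>A \<subseteq> S\<close> by (auto simp: indicator_def)
    qed
    then have "emeasure ?M {..0} = 0"
      by (subst emM) (auto simp: nn_integral_0_iff_AE)
    then show ?thesis using True n0 by (simp add: measure_def)
  next
    case False
    then have a0: "0 < a" using a by simp
    have "emeasure ?M {..a} = (\<integral>\<^sup>+x. ?F x * indicator {..a} (\<xi> x) \<partial>lborel)" by (rule emM) simp
    also have "\<dots> = (\<integral>\<^sup>+y. ennreal (a ^ DIM('a)) * (?F (z + a *\<^sub>R (y - z)) * indicator {..a} (\<xi> (z + a *\<^sub>R (y - z)))) \<partial>lborel)"
    proof -
      have eq: "(z - a *\<^sub>R z) + a *\<^sub>R y = z + a *\<^sub>R (y - z)" for y by (simp add: algebra_simps)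
      have [measurable]: "(\<lambda>y. z + a *\<^sub>R (y - z)) \<in> borel_measurable borel" by measurable
      show ?thesis
        using a0 by (subst lborel_affine[of a "z - a *\<^sub>R z"])
           (simp_all add: nn_integral_density nn_integral_distr eq)
    qed
    also have "\<dots> = (\<integral>\<^sup>+y. ennreal (a ^ n) * ?F y \<partial>lborel)"
    proof (rule nn_integral_cong)
      fix y
      show "ennreal (a ^ DIM('a)) * (?F (z + a *\<^sub>R (y - z)) * indicator {..a} (\<xi> (z + a *\<^sub>R (y - z)))) = ennreal (a ^ n) * ?F y"
      proof (cases "y \<in> A")
        case True
        then have "z + a *\<^sub>R (y - z) \<in> A" "\<xi> (z + a *\<^sub>R (y - z)) \<le> a"
          using A_scale[OF a0 a(2), of y] by auto
        then show ?thesis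
          using True f_scale[OF a0 a(2) True] a0 f0[of y] by (simp add: n_def power_add ennreal_mult' mult.assoc)
      next
        case False
        then have "\<not> (z + a *\<^sub>R (y - z) \<in> A \<and> \<xi> (z + a *\<^sub>R (y - z)) \<le> a)"
          using A_scale[OF a0 a(2), of y] by auto
        then show ?thesis using False by (auto simp: indicator_def)
      qed
    qed
    also have "\<dots> = ennreal (a ^ n) * ennreal C"
      by (subst nn_integral_cmult) (auto simp: tot)
    finally show ?thesis
      using a0 C0 by (simp add: measure_def mult.commute flip: ennreal_mult)
  qed
  have low': "measure ?M {..a} = C * (max 0 (min 1 a)) ^ n" for a
  proof (cases "0 \<le> a \<and> a \<le> 1")
    case True
    then show ?thesis using low[of a] by simp
  next
    case False
    then consider "a < 0" | "1 < a" by linarith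
    then show ?thesis
    proof cases
      case 1
      have "measure ?M {..a} \<le> measure ?M {..0}"
        using 1 by (intro M.finite_measure_mono) auto
      then have "measure ?M {..a} = 0"
        using low[of 0] n0 by (intro antisym measure_nonneg) (simp add: zero_power)
      then show ?thesis using 1 n0 by simp
    next
      case 2
      have "measure ?M {..1} \<le> measure ?M {..a}" "measure ?M {..a} \<le> measure ?M UNIV"
        using 2 by (intro M.finite_measure_mono; auto)+
      then show ?thesis using low[of 1] 2 MU by simp
    qed
  qed
  \<comment> \<open>Finite measures on the line that agree on the upper rays are equal. Clamping
    \<open>a\<close> to \<open>b \<in> [0, 1]\<close> covers rays starting outside the
    support.\<close>
  have "emeasure ?M {a<..} = emeasure ?N {a<..}" for a
  proof -
    define b where "b = max 0 (min 1 a)"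
    have b: "0 \<le> b" "b \<le> 1" by (auto simp: b_def)
    have "emeasure ?N {a<..} = (\<integral>\<^sup>+t. ennreal (C * real n * t ^ (n - 1) * indicator {0..1} t) * indicator {a<..} t \<partial>lborel)"
      by (simp add: emeasure_density)
    also have "\<dots> = (\<integral>\<^sup>+t. ennreal (C * real n * t ^ (n - 1)) * indicator {b..1} t \<partial>lborel)"
    proof (rule nn_integral_cong_AE)
      have "AE t in lborel. t \<noteq> a" "AE t in lborel. t \<noteq> (1::real)" by (rule AE_lborel_singleton)+
      then show "AE t in lborel. ennreal (C * real n * t ^ (n - 1) * indicator {0..1} t) * indicator {a<..} t =
          ennreal (C * real n * t ^ (n - 1)) * indicator {b..1} t"
        by eventually_elim (auto simp: b_def indicator_def)
    qed
    also have "\<dots> = ennreal (C * 1 ^ n - C * b ^ n)"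
    proof (rule nn_integral_FTC_Icc)
      show "DERIV (\<lambda>t. C * t ^ n) t :> C * real n * t ^ (n - 1)" for t
        by (auto intro!: derivative_eq_intros)
    qed (use C0 b in auto)
    also have "C * 1 ^ n - C * b ^ n = measure ?M UNIV - measure ?M {..a}"
      by (simp add: low' MU b_def)
    also have "\<dots> = measure ?M (UNIV - {..a})"
      using M.finite_measure_compl[of "{..a}"] by simp
    also have "UNIV - {..a} = {a<..}" by auto
    finally show ?thesis by (simp add: M.emeasure_eq_measure)
  qed
  moreover have "emeasure ?M {a<..} < \<infinity>" for a
    by (simp add: M.emeasure_finite less_top[symmetric])
  ultimately show ?thesis
    by (intro measure_eqI_lessThan) auto
qed

lemma integral_lebesgue_on_S:
  fixes f :: "'a \<Rightarrow> 'b::euclidean_space"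
  assumes "f \<in> borel_measurable borel"
  shows "(LINT x|lebesgue_on S. f x) = (LINT x|lborel. indicator S x *\<^sub>R f x)"
    and "integrable (lebesgue_on S) f \<longleftrightarrow> integrable lborel (\<lambda>x. indicator S x *\<^sub>R f x)"
  using assms by (simp_all add: integral_restrict_space integral_completion integrable_restrict_space integrable_completion)

lemma AE_lebesgue_on_S: "(AE x in lebesgue_on S. P x) \<longleftrightarrow> (AE x in lebesgue. x \<in> S \<longrightarrow> P x)"
  by (simp add: AE_restrict_space_iff)

lemma measurable_lebesgue_on_S: "f \<in> borel_measurable borel \<Longrightarrow> f \<in> borel_measurable (lebesgue_on S)"
  by (intro measurable_restrict_space1 measurable_completion) simp

lemma finite_measure_S: "finite_measure (lebesgue_on S)"
  using S_sets(3) by (intro finite_measure_lebesgue_on)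

definition "\<nu> = distr (lebesgue_on S) borel \<xi>"
definition "vol = measure lebesgue S"

lemma xi_measurable_S: "\<xi> \<in> borel_measurable (lebesgue_on S)"
  by (rule measurable_lebesgue_on_S) simp

lemma sets_nu[simp, measurable_cong]: "sets \<nu> = sets borel" and space_nu[simp]: "space \<nu> = UNIV"
  by (simp_all add: \<nu>_def)

lemma finite_measure_nu: "finite_measure \<nu>"
  unfolding \<nu>_def by (rule finite_measure.finite_measure_distr[OF finite_measure_S xi_measurable_S])

lemma vol_pos: "0 < vol"
proof -
  have "\<not> negligible S"
    using interior_S open_not_negligible[of "interior S"] negligible_subset[OF _ interior_subset] by blast
  then show ?thesis
    unfolding vol_def using S_sets(3) by (metis negligible_iff_measure0 measure_nonneg order_le_less)
qed

lemma nu_density: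
  "\<nu> = density lborel (\<lambda>t. ennreal (vol * real DIM('a) * t ^ (DIM('a) - 1) * indicator {0..1} t))"
proof -
  have int: "integrable lborel (\<lambda>x. indicator S x * (1::real))"
    using S_sets(3) integral_lebesgue_on_S(2)[of "\<lambda>_. 1::real"] finite_measure_S
    by (simp add: finite_measure.integrable_const)
  have vol: "(LINT x|lborel. indicator S x * (1::real)) = vol"
    by (simp add: vol_def)
  have "\<nu> = distr (density lborel (\<lambda>x. ennreal (indicator S x * 1))) borel \<xi>"
  proof (rule measure_eqI)
    fix B assume "B \<in> sets \<nu>"
    then have [measurable]: "B \<in> sets borel" by simp
    have [measurable]: "\<xi> -` B \<in> sets borel" using measurable_sets_borel[OF xi_measurable] by simp
    have "emeasure \<nu> B = emeasure (lebesgue_on S) (\<xi> -` B \<inter> S)"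
      unfolding \<nu>_def by (subst emeasure_distr[OF xi_measurable_S]) auto
    also have "\<dots> = emeasure lborel (\<xi> -` B \<inter> S)"
      by (subst emeasure_restrict_space) (auto simp: main_part_sets)
    also have "\<dots> = emeasure (density lborel (\<lambda>x. ennreal (indicator S x * 1))) (\<xi> -` B)"
    proof -
      have "(\<lambda>x. ennreal (indicator S x * 1) * indicator (\<xi> -` B) x) = indicator (\<xi> -` B \<inter> S)"
        by (auto simp: fun_eq_iff indicator_def)
      then show ?thesis by (simp add: emeasure_density)
    qed
    also have "\<dots> = emeasure (distr (density lborel (\<lambda>x. ennreal (indicator S x * 1))) borel \<xi>) B"
      by (subst emeasure_distr) auto
    finally show "emeasure \<nu> B = emeasure (distr (density lborel (\<lambda>x. ennreal (indicator S x * 1))) borel \<xi>) B" .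
  qed simp
  also have "\<dots> = density lborel (\<lambda>t. ennreal (vol * real DIM('a) * t ^ (DIM('a) - 1) * indicator {0..1} t))"
    using pushforward_homogeneous[OF S_sets(1) order_refl S_scale _ _ _ int, of 0] by (simp add: vol vol_def)
  finally show ?thesis .
qed

lemma integral_nu:
  fixes F :: "real \<Rightarrow> real"
  assumes [measurable]: "F \<in> borel_measurable borel"
  shows "(LINT t|\<nu>. F t) = (LINT t|lborel. vol * real DIM('a) * t ^ (DIM('a) - 1) * indicator {0..1} t * F t)"
    and "integrable \<nu> F \<longleftrightarrow> integrable lborel (\<lambda>t. vol * real DIM('a) * t ^ (DIM('a) - 1) * indicator {0..1} t * F t)"
  using vol_pos unfolding nu_density by (simp_all add: integral_density integrable_density indicator_def)

lemma integrable_nu_iff: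
  fixes F :: "real \<Rightarrow> real"
  assumes [measurable]: "F \<in> borel_measurable borel"
  shows "integrable \<nu> F \<longleftrightarrow> integrable (lebesgue_on S) (\<lambda>x. F (\<xi> x))"
    and "(LINT t|\<nu>. F t) = (LINT x|lebesgue_on S. F (\<xi> x))"
  unfolding \<nu>_def using xi_measurable_S by (simp_all add: integrable_distr_eq integral_distr)

text \<open>A homogeneous density on one sector is compared with the push-forward
  \<open>\<nu>\<close> of the volume: the two push-forwards have densities
  \<open>C (d+m) t^(d+m-1)\<close> and \<open>vol d t^(d-1)\<close>, whose quotient is the factor
  \<open>t^m\<close> times the stated constant.\<close>

lemma sector_integral:
  fixes f :: "'a \<Rightarrow> real" and F :: "real \<Rightarrow> real"
  assumes L: "L \<in> E" and f[measurable]: "f \<in> borel_measurable borel" and f0: "\<And>x. 0 \<le> f x"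
    and f_scale: "\<And>t x. 0 < t \<Longrightarrow> t \<le> 1 \<Longrightarrow> x \<in> sector z L \<Longrightarrow> f (z + t *\<^sub>R (x - z)) = t ^ m * f x"
    and int: "integrable lborel (\<lambda>x. indicator (sector z L) x * f x)"
    and [measurable]: "F \<in> borel_measurable borel"
  shows "(LINT x|lborel. indicator (sector z L) x * f x * F (\<xi> x)) =
    (LINT x|lborel. indicator (sector z L) x * f x) * (DIM('a) + m) / (vol * DIM('a)) * (LINT t|\<nu>. t ^ m * F t)"
proof -
  let ?f = "\<lambda>x. indicator (sector z L) x * f x"
  have [measurable]: "sector z L \<in> sets borel" using compact_sector by (simp add: borel_compact)
  have "(LINT x|lborel. ?f x * F (\<xi> x)) = (LINT t|distr (density lborel (\<lambda>x. ennreal (?f x))) borel \<xi>. F t)"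
    using f0 by (simp add: integral_distr integral_density)
  also have "\<dots> = (LINT t|lborel. ((LINT x|lborel. ?f x) * real (DIM('a) + m) * t ^ (DIM('a) + m - 1) * indicator {0..1} t) * F t)"
    using f0 by (subst pushforward_homogeneous[OF _ sector_subset[OF L] sector_scale[OF L] f f0 f_scale int])
      (auto simp: integral_density indicator_def intro!: Bochner_Integration.integral_nonneg)
  also have "\<dots> = (LINT t|lborel. (LINT x|lborel. ?f x) * (DIM('a) + m) / (vol * DIM('a)) *
      (vol * real DIM('a) * t ^ (DIM('a) - 1) * indicator {0..1} t * (t ^ m * F t)))"
  proof (rule Bochner_Integration.integral_cong)
    fix t :: real
    have "t ^ (DIM('a) + m - 1) = t ^ (DIM('a) - 1) * t ^ m"
      using dim_ge_2 by (simp flip: power_add)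
    then show "((LINT x|lborel. ?f x) * real (DIM('a) + m) * t ^ (DIM('a) + m - 1) * indicator {0..1} t) * F t =
      (LINT x|lborel. ?f x) * (DIM('a) + m) / (vol * DIM('a)) *
      (vol * real DIM('a) * t ^ (DIM('a) - 1) * indicator {0..1} t * (t ^ m * F t))"
      using vol_pos by (simp add: mult_ac)
  qed simp
  also have "\<dots> = (LINT x|lborel. ?f x) * (DIM('a) + m) / (vol * DIM('a)) * (LINT t|\<nu>. t ^ m * F t)"
    by (subst integral_nu(1)) (measurable, simp only: integral_mult_right_zero)
  finally show ?thesis .
qed

text \<open>\<open>\<nu>\<close> has a Lebesgue density that is zero outside \<open>[0, 1]\<close>,
  so null sets of \<open>(0, 1)\<close> pull back along \<open>\<xi>\<close> to null sets of
  \<open>S\<close>.\<close>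

lemma AE_xi:
  assumes "AE t in lebesgue. t \<in> {0<..<1} \<longrightarrow> P t"
  shows "AE x in lebesgue_on S. P (\<xi> x)"
proof -
  have "AE t in lborel. t \<in> {0<..<1} \<longrightarrow> P t" using assms by (simp add: AE_completion_iff)
  moreover have "AE t in lborel. t \<noteq> 0" "AE t in lborel. t \<noteq> (1::real)" by (rule AE_lborel_singleton)+
  ultimately have "AE t in lborel. 0 < ennreal (vol * real DIM('a) * t ^ (DIM('a) - 1) * indicator {0..1} t) \<longrightarrow> P t"
    by eventually_elim (auto simp: indicator_def)
  then have "AE t in \<nu>. P t" unfolding nu_density by (subst AE_density) auto
  then obtain N where N: "N \<in> null_sets \<nu>" "{t. \<not> P t} \<subseteq> N"
    by (auto simp: eventually_ae_filter)
  then have "\<xi> -` N \<inter> space (lebesgue_on S) \<in> null_sets (lebesgue_on S)"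
    using measurable_sets[OF xi_measurable_S, of N] xi_measurable_S
    by (auto simp: \<nu>_def null_sets_def emeasure_distr)
  then show ?thesis
    by (rule AE_I') (use N in auto)
qed

text \<open>The squared length of the gradient of \<open>\<xi>\<close> is constant on each sector,
  and each sector pushes its volume forward to a constant multiple of \<open>\<nu>\<close>. This
  lets a radial flux density be cancelled by a plain multiple of it.\<close>

lemma G_norm_integral:
  obtains A where "0 < A" "\<And>F::real \<Rightarrow> real. F \<in> borel_measurable borel \<Longrightarrow> integrable \<nu> F \<Longrightarrow>
    (LINT x|lebesgue_on S. (G x \<bullet> G x) * F (\<xi> x)) = A * (LINT t|\<nu>. F t)"
proof
  \<comment> \<open>\<open>c L\<close> is the volume fraction of the sector. The summand 0 is the
    degree \<open>m = 0\<close>, kept so that the expression matches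
    \<open>sector_integral\<close>.\<close>
  define c where "c L = (LINT x|lborel. indicator (sector z L) x * (1::real)) * (DIM('a) + 0) / (vol * DIM('a))" for L
  have Kb[measurable]: "sector z L \<in> sets borel" for L using compact_sector by (simp add: borel_compact)
  have vK: "0 < measure lborel (sector z L)" if "L \<in> E" for L
  proof -
    have "\<not> negligible (sector z L)"
      using interior_sector[OF that] open_not_negligible[of "interior (sector z L)"] negligible_subset[OF _ interior_subset] by blast
    then have "measure lebesgue (sector z L) > 0"
      using lmeasurable_compact[OF compact_sector] by (metis negligible_iff_measure0 measure_nonneg order_le_less)
    then show ?thesis by simp
  qed
  have c: "0 < c L" if "L \<in> E" for L
    unfolding c_def using vK[OF that] vol_pos by simp
  have N0: "0 < nrm L \<bullet> nrm L" if "L \<in> E" for L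
    using nrm_facet[OF that] facet_set_convex_compact(3)[of L] by fastforce
  show "0 < (\<Sum>L\<in>E. (nrm L \<bullet> nrm L) * c L)"
    using finite_E E_nonempty c N0 by (intro sum_pos) auto
  fix F :: "real \<Rightarrow> real" assume F[measurable]: "F \<in> borel_measurable borel" and iF: "integrable \<nu> F"
  have iS: "integrable lborel (\<lambda>x. indicator S x *\<^sub>R F (\<xi> x))"
    using iF integrable_nu_iff(1)[OF F] integral_lebesgue_on_S(2)[of "\<lambda>x. F (\<xi> x)"] by simp
  have iK: "integrable lborel (\<lambda>x. indicator (sector z L) x * 1 * F (\<xi> x))" if "L \<in> E" for L
  proof (rule Bochner_Integration.integrable_bound[OF iS])
    show "AE x in lborel. norm (indicator (sector z L) x * 1 * F (\<xi> x)) \<le> norm (indicator S x *\<^sub>R F (\<xi> x))"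
      using sector_subset[OF that] by (intro AE_I2) (auto simp: indicator_def)
  qed measurable
  have "(LINT x|lebesgue_on S. (G x \<bullet> G x) * F (\<xi> x)) = (LINT x|lborel. indicator S x *\<^sub>R ((G x \<bullet> G x) * F (\<xi> x)))"
    by (rule integral_lebesgue_on_S) measurable
  also have "\<dots> = (LINT x|lborel. (\<Sum>L\<in>E. (nrm L \<bullet> nrm L) * (indicator (sector z L) x * 1 * F (\<xi> x))))"
  proof (rule integral_cong_AE)
    have "negligible (\<Union>L\<in>E. frontier (sector z L))"
      using finite_E by (intro negligible_Union) (auto intro: negligible_convex_frontier convex_sector)
    then have "AE x in lebesgue. x \<notin> (\<Union>L\<in>E. frontier (sector z L))"
      by (intro AE_not_in) (simp add: negligible_iff_null_sets)
    then have "AE x in lborel. x \<notin> (\<Union>L\<in>E. frontier (sector z L))"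
      by (simp add: AE_completion_iff)
    then show "AE x in lborel. indicator S x *\<^sub>R ((G x \<bullet> G x) * F (\<xi> x)) =
        (\<Sum>L\<in>E. (nrm L \<bullet> nrm L) * (indicator (sector z L) x * 1 * F (\<xi> x)))"
    proof eventually_elim
      case (elim x)
      have K: "x \<in> sector z L \<longleftrightarrow> x \<in> interior (sector z L)" if "L \<in> E" for L
        using elim that closure_subset[of "sector z L"] interior_subset[of "sector z L"] by (auto simp: frontier_def)
      show ?case
      proof (cases "x \<in> S")
        case True
        then obtain L where L: "L \<in> E" "x \<in> interior (sector z L)" using S_eq K by blast
        have "(nrm L' \<bullet> nrm L') * (indicator (sector z L') x * 1 * F (\<xi> x)) =
            (if L' = L then (nrm L \<bullet> nrm L) * F (\<xi> x) else 0)" if "L' \<in> E" for L'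
          using K[OF that] sectors_disjoint[OF L(1) that] L by (auto simp: indicator_def)
        then have "(\<Sum>L\<in>E. (nrm L \<bullet> nrm L) * (indicator (sector z L) x * 1 * F (\<xi> x))) =
            (\<Sum>L'\<in>E. if L' = L then (nrm L \<bullet> nrm L) * F (\<xi> x) else 0)"
          by (intro sum.cong) auto
        also have "\<dots> = (nrm L \<bullet> nrm L) * F (\<xi> x)" using finite_E L by simp
        finally show ?thesis using True G_sector[OF L] by simp
      next
        case False
        then have "x \<notin> sector z L" if "L \<in> E" for L using sector_subset[OF that] by auto
        then show ?thesis using False by simp
      qed
    qed
  qed measurable
  also have "\<dots> = (\<Sum>L\<in>E. (nrm L \<bullet> nrm L) * (LINT x|lborel. indicator (sector z L) x * 1 * F (\<xi> x)))"
    using iK by (subst Bochner_Integration.integral_sum) auto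
  also have "\<dots> = (\<Sum>L\<in>E. (nrm L \<bullet> nrm L) * (c L * (LINT t|\<nu>. F t)))"
  proof (rule sum.cong)
    fix L assume L: "L \<in> E"
    have "integrable lborel (\<lambda>x. indicator (sector z L) x * (1::real))"
      using lmeasurable_compact[OF compact_sector, of L] emeasure_compact_finite[OF compact_sector, of L] by (simp add: integrable_indicator_iff)
    then have "(LINT x|lborel. indicator (sector z L) x * 1 * F (\<xi> x)) = c L * (LINT t|\<nu>. t ^ 0 * F t)"
      unfolding c_def by (intro sector_integral[OF L]) auto
    then show "(nrm L \<bullet> nrm L) * (LINT x|lborel. indicator (sector z L) x * 1 * F (\<xi> x)) =
        (nrm L \<bullet> nrm L) * (c L * (LINT t|\<nu>. F t))" by simp
  qed simp
  also have "\<dots> = (\<Sum>L\<in>E. (nrm L \<bullet> nrm L) * c L) * (LINT t|\<nu>. F t)"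
    by (simp add: sum_distrib_right mult.assoc)
  finally show "(LINT x|lebesgue_on S. (G x \<bullet> G x) * F (\<xi> x)) = (\<Sum>L\<in>E. (nrm L \<bullet> nrm L) * c L) * (LINT t|\<nu>. F t)" .
qed

end

subsection \<open>Radial functions and their weak gradients\<close>

context scaled_element
begin

lemma norm_G_bound: "norm (G x) \<le> nrm_bound"
proof (cases "\<exists>L\<in>E. x \<in> interior (sector z L)")
  case True
  then show ?thesis using norm_G_le by blast
next
  case False
  then have "G x = (\<Sum>L\<in>E. 0)" unfolding radial_grad_def by (intro sum.cong) auto
  then show ?thesis using nrm_bound_nonneg by simp
qed

lemma AE_gderiv_xi: "AE x in lborel. x \<in> S \<longrightarrow> GDERIV \<xi> x :> G x"
proof -
  have "AE x in lborel. x \<in> S \<longrightarrow> (\<exists>L\<in>E. x \<in> interior (sector z L))"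
    using AE_interior_sector by (simp add: AE_completion_iff)
  then show ?thesis by eventually_elim (use gderiv_xi in blast)
qed

text \<open>The regular case from which the general one is derived. Only the derivative
  \<open>f\<close> has compact support; \<open>F\<close> may approach different constants on the two
  sides, and it is still Lipschitz.\<close>

lemma radial_lipschitz_weak_derivative:
  assumes F: "C1_with_gradient F f" "compact K" "\<And>t::real. t \<notin> K \<Longrightarrow> f t = 0" and w: "test_function S w D"
  shows "(LINT x|lborel. F (\<xi> x) * (v \<bullet> D x)) = - (LINT x|lborel. w x * (v \<bullet> (f (\<xi> x) *\<^sub>R G x)))"
proof -
  obtain M where M: "0 \<le> M" "\<And>s t. \<bar>F s - F t\<bar> \<le> M * norm (s - t)" "\<And>t. norm (f t) \<le> M"
    using C1_compact_support_lipschitz[OF F] by metis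
  have lip: "\<bar>F (\<xi> x) - F (\<xi> y)\<bar> \<le> (M * nrm_bound) * dist x y" for x y
  proof -
    have "\<bar>F (\<xi> x) - F (\<xi> y)\<bar> \<le> M * \<bar>\<xi> x - \<xi> y\<bar>" using M(2)[of "\<xi> x" "\<xi> y"] by simp
    also have "\<dots> \<le> M * (nrm_bound * dist x y)" by (intro mult_left_mono xi_lipschitz M(1))
    finally show ?thesis by (simp add: mult.assoc)
  qed
  have [measurable]: "f \<in> borel_measurable borel"
    using C1_with_gradientD(2)[OF F(1)] by (rule borel_measurable_continuous_onI)
  show ?thesis
  proof (rule lipschitz_weak_derivative[OF lip _ _ w])
    show "AE x in lborel. x \<in> interior S \<longrightarrow> GDERIV (\<lambda>x. F (\<xi> x)) x :> f (\<xi> x) *\<^sub>R G x"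
      using AE_gderiv_xi
    proof eventually_elim
      case (elim x)
      show ?case
      proof
        assume "x \<in> interior S"
        then have "GDERIV \<xi> x :> G x" using elim interior_subset by blast
        moreover have "DERIV F (\<xi> x) :> f (\<xi> x)" using C1_with_gradientD(1)[OF F(1)] by simp
        ultimately show "GDERIV (\<lambda>x. F (\<xi> x)) x :> f (\<xi> x) *\<^sub>R G x" by (rule GDERIV_DERIV_compose)
      qed
    qed
  qed measurable
qed

lemma test_gradient_integral_zero:
  assumes w: "test_function S w D" shows "(LINT x|lborel. v \<bullet> D x) = 0"
  using radial_lipschitz_weak_derivative[OF C1_with_gradient_const[of 1] compact_empty _ w, of v] by simp

section \<open>The Lebesgue density of \<open>\<nu>\<close> and antiderivatives of radial
  profiles\<close>

definition "weight t = vol * real DIM('a) * t ^ (DIM('a) - 1) * indicator {0..1} (t::real)"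

lemma weight_measurable[measurable]: "weight \<in> borel_measurable borel"
  unfolding weight_def by measurable

lemma weight_nonneg: "0 \<le> weight t"
  using vol_pos by (simp add: weight_def indicator_def)

lemma weight_pos: "0 < t \<Longrightarrow> t \<le> 1 \<Longrightarrow> 0 < weight t"
  using vol_pos by (simp add: weight_def)

lemma weight_mono: "0 \<le> s \<Longrightarrow> s \<le> t \<Longrightarrow> t \<le> 1 \<Longrightarrow> weight s \<le> weight t"
  using vol_pos by (auto simp: weight_def intro!: mult_left_mono power_mono)

lemma weight_zero: "t \<notin> {0..1} \<Longrightarrow> weight t = 0"
  by (simp add: weight_def)

lemma integral_nu_weight:
  fixes F :: "real \<Rightarrow> real"
  assumes [measurable]: "F \<in> borel_measurable borel"
  shows "(LINT t|\<nu>. F t) = (LINT t|lborel. weight t * F t)"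
    and "integrable \<nu> F \<longleftrightarrow> integrable lborel (\<lambda>t. weight t * F t)"
  unfolding weight_def by (rule integral_nu; measurable)+

text \<open>The antiderivative of \<open>r\<close> on \<open>(0, 1]\<close> vanishing at 1. The base
  point is 1 because square integrability with respect to \<open>\<nu>\<close> gives integrability
  of \<open>r\<close> only away from 0.\<close>

definition tail_integral :: "(real \<Rightarrow> real) \<Rightarrow> real \<Rightarrow> real" where
  "tail_integral r s = - (LINT t|lborel. indicator {s<..<1} t * r t)"

lemma tail_integral_measurable[measurable]:
  assumes [measurable]: "r \<in> borel_measurable borel"
  shows "tail_integral r \<in> borel_measurable borel"
proof -
  have [measurable]: "Measurable.pred (borel \<Otimes>\<^sub>M borel) (\<lambda>p::real \<times> real. fst p < snd p \<and> snd p < 1)" by measurable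
  have eq: "indicator {s<..<1} t = (if s < t \<and> t < 1 then 1 else 0 :: real)" for s t :: real by auto
  show ?thesis
    unfolding tail_integral_def eq by measurable
qed

lemma square_integrable_imp_integrable_nu:
  fixes r :: "real \<Rightarrow> real"
  assumes "r \<in> borel_measurable borel" "integrable \<nu> (\<lambda>t. (r t)\<^sup>2)"
  shows "integrable \<nu> r"
  using finite_measure.integrable_of_square[OF finite_measure_nu _ assms(2)] assms(1) by simp

text \<open>The weight is increasing, hence bounded below by \<open>weight s > 0\<close> on
  \<open>(s, 1)\<close>.\<close>

lemma set_integrable_tail:
  fixes r :: "real \<Rightarrow> real"
  assumes [measurable]: "r \<in> borel_measurable borel" and r: "integrable \<nu> r" and s: "0 < s"
  shows "integrable lborel (\<lambda>t. indicator {s<..<1} t * r t)"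
proof (cases "s < 1")
  case False
  then have "(\<lambda>t. indicator {s<..<1} t * r t) = (\<lambda>t. 0)" by (auto simp: fun_eq_iff)
  then show ?thesis by simp
next
  case True
  have i: "integrable lborel (\<lambda>t. (1 / weight s) * (weight t * r t))"
    using r by (simp add: integral_nu_weight)
  show ?thesis
  proof (rule Bochner_Integration.integrable_bound[OF i])
    show "AE t in lborel. norm (indicator {s<..<1} t * r t) \<le> norm ((1 / weight s) * (weight t * r t))"
    proof (rule AE_I2)
      fix t
      show "norm (indicator {s<..<1} t * r t) \<le> norm ((1 / weight s) * (weight t * r t))"
      proof (cases "t \<in> {s<..<1}")
        case True
        then have "weight s \<le> weight t" "0 < weight s"
          using weight_mono[of s t] weight_pos[of s] s by auto
        then have "1 \<le> weight t / weight s" by simp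
        then have "1 * \<bar>r t\<bar> \<le> weight t / weight s * \<bar>r t\<bar>" by (intro mult_right_mono) auto
        then show ?thesis using True \<open>0 < weight s\<close> weight_nonneg[of t] by (simp add: abs_mult)
      qed simp
    qed
  qed measurable
qed

text \<open>A Cauchy-Schwarz estimate on \<open>(s, 1)\<close>, where the weight is at least
  \<open>weight s\<close>. The antiderivative grows at most like \<open>weight s\<close> to the
  power \<open>-1/2\<close>, which makes its square integrable for \<open>\<nu>\<close>.\<close>

lemma tail_integral_square_bound:
  fixes r :: "real \<Rightarrow> real"
  assumes [measurable]: "r \<in> borel_measurable borel" and r: "integrable \<nu> (\<lambda>t. (r t)\<^sup>2)"
  obtains C where "\<And>s. 0 < s \<Longrightarrow> s \<le> 1 \<Longrightarrow> weight s * (tail_integral r s)\<^sup>2 \<le> C"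
proof -
  define I where "I = (LINT t|lborel. weight t * (r t)\<^sup>2)"
  have Ii: "integrable lborel (\<lambda>t. weight t * (r t)\<^sup>2)" using r by (simp add: integral_nu_weight)
  have I0: "0 \<le> I" unfolding I_def using weight_nonneg by (intro Bochner_Integration.integral_nonneg) auto
  have r1: "integrable \<nu> r" by (rule square_integrable_imp_integrable_nu[OF assms])
  have "weight s * (tail_integral r s)\<^sup>2 \<le> ((1 + I) / 2)\<^sup>2" if s: "0 < s" "s \<le> 1" for s
  proof -
    have ws: "0 < weight s" by (rule weight_pos[OF s])
    \<comment> \<open>The scale in Young's inequality: since \<open>l^2 weight t \<ge> 1\<close> on
      \<open>(s, 1)\<close>, one has \<open>2 |r| \<le> l + l weight r^2\<close> there.\<close>
    define l where "l = 1 / sqrt (weight s)"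
    have l: "0 < l" "l\<^sup>2 = 1 / weight s" using ws by (auto simp: l_def power_divide)
    have i1: "integrable lborel (\<lambda>t. indicator {s<..<1} t * r t)" by (rule set_integrable_tail[OF assms(1) r1 s(1)])
    have i2: "integrable lborel (\<lambda>t. indicator {s<..<1} t * l / 2 + l * (weight t * (r t)\<^sup>2) / 2)"
      using Ii by (intro Bochner_Integration.integrable_add integrable_divide integrable_mult_right integrable_mult_left) (auto simp: integrable_indicator_iff emeasure_lborel_Ioo s)
    have "\<bar>tail_integral r s\<bar> \<le> (LINT t|lborel. \<bar>indicator {s<..<1} t * r t\<bar>)"
      unfolding tail_integral_def by (simp add: integral_abs_bound)
    also have "\<dots> \<le> (LINT t|lborel. indicator {s<..<1} t * l / 2 + l * (weight t * (r t)\<^sup>2) / 2)"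
    proof (rule integral_mono[OF integrable_abs[OF i1] i2])
      fix t
      show "\<bar>indicator {s<..<1} t * r t\<bar> \<le> indicator {s<..<1} t * l / 2 + l * (weight t * (r t)\<^sup>2) / 2"
      proof (cases "t \<in> {s<..<1}")
        case True
        then have "weight s \<le> weight t" using weight_mono[of s t] s by auto
        then have "1 / weight s * (weight s * (r t)\<^sup>2) \<le> l\<^sup>2 * (weight t * (r t)\<^sup>2)"
          unfolding l(2) using ws by (intro mult_left_mono mult_right_mono) auto
        then have le: "(r t)\<^sup>2 \<le> l\<^sup>2 * (weight t * (r t)\<^sup>2)" using ws by simp
        have "2 * \<bar>r t\<bar> * l \<le> (r t)\<^sup>2 + l\<^sup>2"
          using sum_squares_bound[of "\<bar>r t\<bar>" l] by simp
        also have "\<dots> \<le> l * (l * (weight t * (r t)\<^sup>2) + l)"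
          using le by (simp add: power2_eq_square algebra_simps)
        finally have "l * (2 * \<bar>r t\<bar>) \<le> l * (l * (weight t * (r t)\<^sup>2) + l)" by (simp add: mult_ac)
        then have "2 * \<bar>r t\<bar> \<le> l * (weight t * (r t)\<^sup>2) + l" using l(1) by (rule mult_left_le_imp_le)
        then show ?thesis using True by simp
      next
        case False
        then show ?thesis using l(1) weight_nonneg[of t] by simp
      qed
    qed
    also have "\<dots> = (1 - s) * l / 2 + l * I / 2"
      unfolding I_def using Ii s by (subst Bochner_Integration.integral_add) (auto simp: emeasure_lborel_Ioo integrable_indicator_iff)
    also have "\<dots> \<le> l * ((1 + I) / 2)"
      using l(1) s by (simp add: field_simps)
    finally have "(tail_integral r s)\<^sup>2 \<le> (l * ((1 + I) / 2))\<^sup>2"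
      using l(1) I0 by (intro abs_le_square_iff[THEN iffD1]) (simp add: abs_mult)
    then have "(tail_integral r s)\<^sup>2 \<le> l\<^sup>2 * ((1 + I) / 2)\<^sup>2"
      by (simp only: power_mult_distrib)
    then have "weight s * (tail_integral r s)\<^sup>2 \<le> weight s * (l\<^sup>2 * ((1 + I) / 2)\<^sup>2)"
      using ws by (intro mult_left_mono) auto
    then show ?thesis using ws by (simp add: l(2))
  qed
  then show ?thesis by (rule that)
qed

lemma tail_integral_square_integrable:
  fixes r :: "real \<Rightarrow> real"
  assumes [measurable]: "r \<in> borel_measurable borel" and r: "integrable \<nu> (\<lambda>t. (r t)\<^sup>2)"
  shows "integrable \<nu> (\<lambda>s. (tail_integral r s)\<^sup>2)"
proof -
  obtain C where C: "\<And>s. 0 < s \<Longrightarrow> s \<le> 1 \<Longrightarrow> weight s * (tail_integral r s)\<^sup>2 \<le> C"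
    using tail_integral_square_bound[OF assms] by blast
  have "integrable lborel (\<lambda>s. weight s * (tail_integral r s)\<^sup>2)"
  proof (rule Bochner_Integration.integrable_bound)
    show "integrable lborel (\<lambda>s. C * indicator {0..1::real} s)" by (intro integrable_mult_right integrable_real_indicator) auto
    have "AE s in lborel. s \<noteq> (0::real)" by (rule AE_lborel_singleton)
    then show "AE s in lborel. norm (weight s * (tail_integral r s)\<^sup>2) \<le> norm (C * indicator {0..1::real} s)"
    proof eventually_elim
      case (elim s)
      show ?case
      proof (cases "s \<in> {0..1}")
        case True
        then have "weight s * (tail_integral r s)\<^sup>2 \<le> C" using elim by (intro C) auto
        then show ?thesis using True weight_nonneg[of s] by (simp add: abs_mult)
      qed (simp add: weight_zero)
    qed
  qed measurable
  then show ?thesis by (simp add: integral_nu_weight)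
qed

text \<open>Writing the antiderivative as an integral over \<open>\<xi> x < t < 1\<close> and
  exchanging the order moves \<open>r\<close> outside and leaves the mass \<open>m t\<close> of
  \<open>p\<close> on the set \<open>\<xi> < t\<close>. The bound of \<open>m\<close> by the weight
  compensates a singularity of \<open>r\<close> at 0, because \<open>weight t * r t\<close> is
  integrable.\<close>

lemma tail_integral_fubini:
  fixes r :: "real \<Rightarrow> real" and p :: "'a \<Rightarrow> real"
  assumes [measurable]: "r \<in> borel_measurable borel" and r: "integrable \<nu> r"
    and p[measurable]: "p \<in> borel_measurable borel" and pB: "\<And>x. \<bar>p x\<bar> \<le> B" and p0: "\<And>x. x \<notin> S \<Longrightarrow> p x = 0"
  defines "m \<equiv> \<lambda>t. LINT x|lborel. (if \<xi> x < t then p x else 0)"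
  shows "(LINT x|lborel. tail_integral r (\<xi> x) * p x) = - (LINT t|lborel. indicator {0<..<1} t * r t * m t)"
    and "m \<in> borel_measurable borel" and "\<And>t. t \<le> 1 \<Longrightarrow> \<bar>m t\<bar> \<le> B * weight t"
proof -
  have [measurable]: "Measurable.pred (borel \<Otimes>\<^sub>M borel) (\<lambda>q::real \<times> 'a. \<xi> (snd q) < fst q)" by measurable
  show m[measurable]: "m \<in> borel_measurable borel" unfolding m_def by measurable
  have B0: "0 \<le> B" using pB[of 0] by linarith
  have int_p: "integrable lborel (\<lambda>x. if \<xi> x < t then \<bar>p x\<bar> else 0)" 
    and bound: "t \<le> 1 \<Longrightarrow> (LINT x|lborel. (if \<xi> x < t then \<bar>p x\<bar> else 0)) \<le> B * weight t" for t
  proof -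
    have i: "integrable \<nu> (\<lambda>s. B * indicator {..<t} s)"
      using finite_measure_nu by (intro integrable_mult_right finite_measure.integrable_const_bound[where B=1]) auto
    then have i': "integrable lborel (\<lambda>x. indicator S x *\<^sub>R (B * indicator {..<t} (\<xi> x)))"
      by (subst integral_lebesgue_on_S(2)[symmetric]) (simp_all add: integrable_nu_iff)
    have le: "(if \<xi> x < t then \<bar>p x\<bar> else 0) \<le> indicator S x *\<^sub>R (B * indicator {..<t} (\<xi> x))" for x
      using pB[of x] p0[of x] B0 by (auto simp: indicator_def)
    show i1: "integrable lborel (\<lambda>x. if \<xi> x < t then \<bar>p x\<bar> else 0)"
    proof (rule Bochner_Integration.integrable_bound[OF i'])
      show "AE x in lborel. norm (if \<xi> x < t then \<bar>p x\<bar> else 0) \<le> norm (indicator S x *\<^sub>R (B * indicator {..<t} (\<xi> x)))"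
        using pB p0 B0 by (intro AE_I2) (auto simp: indicator_def)
    qed measurable
    assume t1: "t \<le> 1"
    have "(LINT x|lborel. (if \<xi> x < t then \<bar>p x\<bar> else 0)) \<le> (LINT x|lborel. indicator S x *\<^sub>R (B * indicator {..<t} (\<xi> x)))"
      by (rule integral_mono[OF i1 i' le])
    also have "\<dots> = (LINT s|\<nu>. B * indicator {..<t} s)"
      by (rule trans[OF integral_lebesgue_on_S(1)[symmetric] integrable_nu_iff(2)[symmetric]]) measurable
    also have "\<dots> = (LINT s|lborel. weight s * (B * indicator {..<t} s))"
      by (rule integral_nu_weight) measurable
    \<comment> \<open>A crude estimate: below \<open>t\<close> the weight is at most
      \<open>weight t\<close>, and the interval has length at most 1.\<close>
    also have "\<dots> \<le> (LINT s|lborel. B * weight t * indicator {0..1::real} s)"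
    proof (rule integral_mono)
      show "integrable lborel (\<lambda>s. weight s * (B * indicator {..<t} s))"
        by (rule integral_nu_weight(2)[THEN iffD1, OF _ i]) measurable
      show "integrable lborel (\<lambda>s. B * weight t * indicator {0..1::real} s)"
        by (intro integrable_mult_right integrable_real_indicator) auto
      show "weight s * (B * indicator {..<t} s) \<le> B * weight t * indicator {0..1::real} s" for s
      proof (cases "s \<in> {0..1} \<and> s < t")
        case True
        then have "B * weight s \<le> B * weight t" using B0 t1 by (intro mult_left_mono weight_mono) auto
        then show ?thesis using True by (simp add: mult.commute)
      next
        case False
        then show ?thesis using weight_zero[of s] B0 weight_nonneg[of t] by (auto simp: indicator_def)
      qed
    qed
    also have "\<dots> = B * weight t" by simp
    finally show "(LINT x|lborel. (if \<xi> x < t then \<bar>p x\<bar> else 0)) \<le> B * weight t" .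
  qed
  show mb: "\<bar>m t\<bar> \<le> B * weight t" if "t \<le> 1" for t
  proof -
    have "\<bar>m t\<bar> \<le> (LINT x|lborel. \<bar>if \<xi> x < t then p x else 0\<bar>)"
      unfolding m_def by (rule integral_abs_bound)
    also have "\<dots> = (LINT x|lborel. (if \<xi> x < t then \<bar>p x\<bar> else 0))"
      by (intro Bochner_Integration.integral_cong) auto
    finally show ?thesis using bound[OF that] by linarith
  qed
  let ?H = "\<lambda>t x. indicator {0<..<1} t * r t * (if \<xi> x < t then p x else 0)"
  have "integrable (lborel \<Otimes>\<^sub>M lborel) (\<lambda>(t, x). ?H t x)"
  proof (rule lborel_pair.Fubini_integrable)
    have normH: "(LINT x|lborel. norm (?H t x)) = indicator {0<..<1} t * \<bar>r t\<bar> * (LINT x|lborel. (if \<xi> x < t then \<bar>p x\<bar> else 0))" for t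
    proof -
      have "(LINT x|lborel. norm (?H t x)) = (LINT x|lborel. (indicator {0<..<1} t * \<bar>r t\<bar>) * (if \<xi> x < t then \<bar>p x\<bar> else 0))"
        by (intro Bochner_Integration.integral_cong) (auto simp: abs_mult)
      then show ?thesis by simp
    qed
    show "integrable lborel (\<lambda>t. LINT x|lborel. norm (case (t, x) of (t, x) \<Rightarrow> ?H t x))"
      unfolding prod.case normH
    proof (rule Bochner_Integration.integrable_bound)
      show "integrable lborel (\<lambda>t. B * (weight t * r t))"
        using r by (simp add: integral_nu_weight)
      show "AE t in lborel. norm (indicator {0<..<1} t * \<bar>r t\<bar> * (LINT x|lborel. (if \<xi> x < t then \<bar>p x\<bar> else 0))) \<le> norm (B * (weight t * r t))"
      proof (rule AE_I2)
        fix t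
        have nn: "0 \<le> (LINT x|lborel. (if \<xi> x < t then \<bar>p x\<bar> else 0))"
          by (intro Bochner_Integration.integral_nonneg) auto
        show "norm (indicator {0<..<1} t * \<bar>r t\<bar> * (LINT x|lborel. (if \<xi> x < t then \<bar>p x\<bar> else 0))) \<le> norm (B * (weight t * r t))"
        proof (cases "t \<in> {0<..<1}")
          case True
          then have "\<bar>r t\<bar> * (LINT x|lborel. (if \<xi> x < t then \<bar>p x\<bar> else 0)) \<le> \<bar>r t\<bar> * (B * weight t)"
            by (intro mult_left_mono bound) auto
          then show ?thesis using True nn B0 weight_nonneg[of t] by (simp add: abs_mult mult_ac)
        qed simp
      qed
    qed measurable
    show "AE t in lborel. integrable lborel (\<lambda>x. case (t, x) of (t, x) \<Rightarrow> ?H t x)"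
    proof (rule AE_I2)
      fix t
      have "integrable lborel (\<lambda>x. if \<xi> x < t then p x else 0)"
        by (rule Bochner_Integration.integrable_bound[OF int_p[of t]]) auto
      then show "integrable lborel (\<lambda>x. case (t, x) of (t, x) \<Rightarrow> ?H t x)"
        by simp
    qed
  qed measurable
  from lborel_pair.Fubini_integral[OF this]
  have "(LINT x|lborel. LINT t|lborel. ?H t x) = (LINT t|lborel. LINT x|lborel. ?H t x)" by simp
  also have "\<dots> = (LINT t|lborel. indicator {0<..<1} t * r t * m t)"
    unfolding m_def by simp
  finally have fub: "(LINT x|lborel. LINT t|lborel. ?H t x) = (LINT t|lborel. indicator {0<..<1} t * r t * m t)" .
  have "(LINT t|lborel. ?H t x) = - (tail_integral r (\<xi> x) * p x)" for x
  proof (cases "x \<in> S")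
    case True
    then have "(\<lambda>t. ?H t x) = (\<lambda>t. (indicator {\<xi> x<..<1} t * r t) * p x)"
      using xi_range(1)[OF True] by (auto simp: fun_eq_iff indicator_def)
    then show ?thesis by (simp add: tail_integral_def)
  next
    case False
    then have "(\<lambda>t. ?H t x) = (\<lambda>t. 0)" using p0 by auto
    then show ?thesis using False p0 by simp
  qed
  then show "(LINT x|lborel. tail_integral r (\<xi> x) * p x) = - (LINT t|lborel. indicator {0<..<1} t * r t * m t)"
    using fub by simp
qed

end

lemma exists_bound_compact_support:
  fixes w :: "'a::euclidean_space \<Rightarrow> real"
  assumes "continuous_on UNIV w" "compact K" "\<And>x. x \<notin> K \<Longrightarrow> w x = 0"
  shows "\<exists>B. \<forall>x. \<bar>w x\<bar> \<le> B"
  using C1_compact_support_bounded[OF assms] by (metis real_norm_def)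

lemma integrable_lborel_imp_lebesgue:
  fixes f :: "'a::euclidean_space \<Rightarrow> real"
  shows "integrable lborel f \<Longrightarrow> integrable lebesgue f"
  using integrable_completion[OF borel_measurable_integrable] by blast

context scaled_element
begin

lemma integral_lebesgue_on_S_zero_off:
  fixes f :: "'a \<Rightarrow> real"
  assumes [measurable]: "f \<in> borel_measurable borel" and "\<And>x. x \<notin> S \<Longrightarrow> f x = 0"
  shows "(LINT x|lebesgue_on S. f x) = (LINT x|lborel. f x)"
proof -
  have "(\<lambda>x. indicator S x *\<^sub>R f x) = f" using assms(2) by (auto simp: fun_eq_iff indicator_def)
  then show ?thesis using integral_lebesgue_on_S(1)[OF assms(1)] by simp
qed

lemma tail_integral_antiderivative:
  assumes F: "C1_with_gradient F f" and s: "s \<le> (1::real)"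
  shows "tail_integral f s = F s - F 1"
proof -
  have "(LINT t|lborel. indicator {s<..<1} t * f t) = (LINT t|lborel. f t * indicator {s..1} t)"
  proof (rule integral_cong_AE)
    have [measurable]: "f \<in> borel_measurable borel"
      using C1_with_gradientD(2)[OF F] by (rule borel_measurable_continuous_onI)
    show "(\<lambda>t. indicator {s<..<1} t * f t) \<in> borel_measurable lborel"
      "(\<lambda>t. f t * indicator {s..1} t) \<in> borel_measurable lborel" by measurable
    have "AE t in lborel. t \<noteq> s" "AE t in lborel. t \<noteq> (1::real)" by (rule AE_lborel_singleton)+
    then show "AE t in lborel. indicator {s<..<1} t * f t = f t * indicator {s..1} t"
      by eventually_elim (auto simp: indicator_def)
  qed
  also have "\<dots> = F 1 - F s"
  proof (rule integral_FTC_Icc_real[OF s])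
    show "DERIV F t :> f t" for t using C1_with_gradientD(1)[OF F] by simp
    show "isCont f t" for t
      using C1_with_gradientD(2)[OF F] by (simp add: continuous_on_eq_continuous_at)
  qed
  finally show ?thesis by (simp add: tail_integral_def)
qed

text \<open>By Fubini the left side involves \<open>m t\<close>, the integral of the partial
  derivative of \<open>w\<close> over \<open>\<xi> < t\<close>; the right side involves the
  push-forward density \<open>h\<close> of \<open>w\<close> times the partial derivative of
  \<open>\<xi>\<close>. The claim follows from \<open>m = weight * h\<close> almost everywhere. This
  relation is independent of \<open>r\<close>, so it can be verified by smoother profiles, for which
  the Lipschitz case is available.\<close>

proposition radial_weak_gradient:
  fixes r :: "real \<Rightarrow> real"
  assumes r[measurable]: "r \<in> borel_measurable borel" and r2: "integrable \<nu> (\<lambda>t. (r t)\<^sup>2)"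
  shows "has_weak_gradient S (\<lambda>x. tail_integral r (\<xi> x)) (\<lambda>x. r (\<xi> x) *\<^sub>R G x)"
  unfolding has_weak_gradient_iff_components[OF S_sets(3)]
proof (intro conjI allI impI ballI)
  have r1: "integrable \<nu> r" by (rule square_integrable_imp_integrable_nu[OF r r2])
  show "square_integrable S (\<lambda>x. tail_integral r (\<xi> x))"
    unfolding square_integrable_scalar
    using tail_integral_square_integrable[OF r r2] integrable_nu_iff(1)[of "\<lambda>t. (tail_integral r t)\<^sup>2"]
    by (auto intro!: measurable_lebesgue_on_S)
  show "square_integrable S (\<lambda>x. r (\<xi> x) *\<^sub>R G x)"
    unfolding square_integrable_def
  proof
    show "(\<lambda>x. r (\<xi> x) *\<^sub>R G x) \<in> borel_measurable (lebesgue_on S)"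
      by (rule measurable_lebesgue_on_S) measurable
    show "integrable (lebesgue_on S) (\<lambda>x. (norm (r (\<xi> x) *\<^sub>R G x))\<^sup>2)"
    proof (rule Bochner_Integration.integrable_bound)
      show "integrable (lebesgue_on S) (\<lambda>x. nrm_bound\<^sup>2 * (r (\<xi> x))\<^sup>2)"
        using r2 integrable_nu_iff(1)[of "\<lambda>t. (r t)\<^sup>2"] by simp
      show "(\<lambda>x. (norm (r (\<xi> x) *\<^sub>R G x))\<^sup>2) \<in> borel_measurable (lebesgue_on S)"
        by (rule measurable_lebesgue_on_S) measurable
      show "AE x in lebesgue_on S. norm ((norm (r (\<xi> x) *\<^sub>R G x))\<^sup>2) \<le> norm (nrm_bound\<^sup>2 * (r (\<xi> x))\<^sup>2)"
      proof (rule AE_I2)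
        fix x
        have "(norm (G x))\<^sup>2 \<le> nrm_bound\<^sup>2" by (intro power_mono norm_G_bound) simp
        then have "(r (\<xi> x))\<^sup>2 * (norm (G x))\<^sup>2 \<le> (r (\<xi> x))\<^sup>2 * nrm_bound\<^sup>2" by (intro mult_left_mono) auto
        then show "norm ((norm (r (\<xi> x) *\<^sub>R G x))\<^sup>2) \<le> norm (nrm_bound\<^sup>2 * (r (\<xi> x))\<^sup>2)"
          by (simp add: power_mult_distrib mult.commute)
      qed
    qed
  qed
  fix w D and i :: 'a assume w: "test_function S w D" and i: "i \<in> Basis"
  obtain K where c1: "C1_with_gradient w D" and K: "compact K" "K \<subseteq> interior S"
    "\<And>x. x \<notin> K \<Longrightarrow> w x = 0" "\<And>x. x \<notin> K \<Longrightarrow> D x = 0"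
    using test_functionD[OF w] by blast
  have KS: "x \<notin> S \<Longrightarrow> x \<notin> K" for x using K(2) interior_subset by blast
  have cD: "continuous_on UNIV (\<lambda>x. i \<bullet> D x)" and cw: "continuous_on UNIV w"
    using C1_with_gradientD[OF c1] by (auto intro!: continuous_intros)
  note [measurable] = borel_measurable_continuous_onI[OF cD] borel_measurable_continuous_onI[OF cw]
  obtain B where B: "\<And>x. \<bar>i \<bullet> D x\<bar> \<le> B"
    using exists_bound_compact_support[OF cD K(1)] K(4) by auto
  obtain Bw where Bw: "\<And>x. \<bar>w x\<bar> \<le> Bw"
    using exists_bound_compact_support[OF cw K(1,3)] by auto
  define m where "m t = (LINT x|lborel. (if \<xi> x < t then i \<bullet> D x else 0))" for t
  have D0: "i \<bullet> D x = 0" if "x \<notin> S" for x using K(4)[OF KS[OF that]] by simp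
  have fub: "(LINT x|lborel. tail_integral f (\<xi> x) * (i \<bullet> D x)) = - (LINT t|lborel. indicator {0<..<1} t * f t * m t)"
    if "f \<in> borel_measurable borel" "integrable \<nu> f" for f
    unfolding m_def by (rule tail_integral_fubini(1)[OF that _ B D0]) measurable
  have m[measurable]: "m \<in> borel_measurable borel"
    unfolding m_def by (rule tail_integral_fubini(2)[OF r r1 _ B D0]) measurable
  have mB: "\<bar>m t\<bar> \<le> B * weight t" if "t \<le> 1" for t
    unfolding m_def by (rule tail_integral_fubini(3)[OF r r1 _ B D0 that]) measurable
  define u where "u x = w x * (i \<bullet> G x)" for x
  have [measurable]: "u \<in> borel_measurable borel" unfolding u_def by measurable
  have uS: "u \<in> borel_measurable (lebesgue_on S)" by (rule measurable_lebesgue_on_S) measurable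
  have uB: "\<bar>u x\<bar> \<le> Bw * nrm_bound" for x
  proof -
    have "\<bar>i \<bullet> G x\<bar> \<le> norm i * norm (G x)" by (rule Cauchy_Schwarz_ineq2)
    then have "\<bar>i \<bullet> G x\<bar> \<le> nrm_bound" using norm_G_bound[of x] i by simp
    then show ?thesis unfolding u_def abs_mult
      using Bw[of x] by (intro mult_mono) (auto intro: order_trans[OF abs_ge_zero])
  qed
  have u2: "integrable (lebesgue_on S) (\<lambda>x. (u x)\<^sup>2)"
  proof (rule finite_measure.integrable_const_bound[OF finite_measure_S])
    show "AE x in lebesgue_on S. norm ((u x)\<^sup>2) \<le> (Bw * nrm_bound)\<^sup>2"
      using uB by (intro AE_I2) (simp add: abs_le_square_iff[symmetric] order_trans[OF _ abs_ge_self])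
    show "(\<lambda>x. (u x)\<^sup>2) \<in> borel_measurable (lebesgue_on S)" using uS by measurable
  qed
  obtain h where hm[measurable]: "h \<in> borel_measurable borel" and h2: "integrable \<nu> (\<lambda>t. (h t)\<^sup>2)"
    and h: "\<And>f::real \<Rightarrow> real. f \<in> borel_measurable borel \<Longrightarrow> integrable \<nu> (\<lambda>t. (f t)\<^sup>2) \<Longrightarrow>
       (LINT x|lebesgue_on S. u x * f (\<xi> x)) = (LINT t|\<nu>. h t * f t)"
    using finite_measure.pushforward_density[OF finite_measure_S xi_measurable_S uS u2]
    unfolding \<nu>_def[symmetric] by blast
  have hw: "integrable lborel (\<lambda>t. weight t * h t)"
    using square_integrable_imp_integrable_nu[OF hm h2] by (simp add: integral_nu_weight)
  have wint: "integrable lborel weight"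
    using integral_nu_weight(2)[of "\<lambda>_. 1"] finite_measure_nu by (simp add: finite_measure.integrable_const)
  have mw: "integrable lborel (\<lambda>t. indicator {0<..<1} t * (m t - weight t * h t))"
  proof -
    have "integrable lborel (\<lambda>t. indicator {0<..<1} t * m t)"
    proof (rule Bochner_Integration.integrable_bound)
      show "integrable lborel (\<lambda>t. B * weight t)" using wint by simp
      show "AE t in lborel. norm (indicator {0<..<1} t * m t) \<le> norm (B * weight t)"
        using mB by (intro AE_I2) (auto simp: indicator_def intro: order_trans[OF _ abs_ge_self])
    qed measurable
    moreover have "integrable lborel (\<lambda>t. indicator {0<..<1} t *\<^sub>R (weight t * h t))"
      by (rule integrable_mult_indicator[OF _ hw]) simp
    ultimately have "integrable lborel (\<lambda>t. indicator {0<..<1} t * m t - indicator {0<..<1} t *\<^sub>R (weight t * h t))"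
      by (rule Bochner_Integration.integrable_diff)
    then show ?thesis by (simp add: right_diff_distrib)
  qed
  \<comment> \<open>The divergence theorem on the sets \<open>\<xi> < t\<close>, in an
    almost-everywhere form that does not mention surface integrals.\<close>
  have mh: "AE t in lebesgue. t \<in> {0<..<1} \<longrightarrow> m t - weight t * h t = 0"
  proof (rule AE_zero_if_test_integrals_zero)
    fix a b :: real assume ab: "cbox a b \<subseteq> {0<..<1}"
    have "integrable lborel (\<lambda>t. indicator (cbox a b) t *\<^sub>R (indicator {0<..<1} t * (m t - weight t * h t)))"
      by (rule integrable_mult_indicator[OF _ mw]) simp
    moreover have "(\<lambda>t. indicator (cbox a b) t *\<^sub>R (indicator {0<..<1} t * (m t - weight t * h t))) =
        (\<lambda>t. indicator (cbox a b) t *\<^sub>R (m t - weight t * h t))"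
      using ab by (intro ext) (auto simp: indicator_def)
    ultimately show "set_integrable lebesgue (cbox a b) (\<lambda>t. m t - weight t * h t)"
      unfolding set_integrable_def by (intro integrable_lborel_imp_lebesgue) simp
  next
    fix f D' assume "test_function {0<..<1::real} f D'"
    then obtain K' where cf: "C1_with_gradient f D'" and K': "compact K'" "K' \<subseteq> {0<..<1}" "\<And>t. t \<notin> K' \<Longrightarrow> f t = 0"
      using test_functionD[of "{0<..<1::real}" f D'] by (auto simp: interior_open)
    obtain a b where ab: "0 < a" "b < 1" "K' \<subseteq> {a..b}"
      using compact_subset_unit_interval[OF K'(1,2)] by blast
    have f0: "f t = 0" if "t \<notin> {a..b}" for t using K'(3) ab(3) that by blast
    have f01: "f t = 0" if "t \<notin> {0<..<1}" for t using K'(2,3) that by blast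
    have cont: "continuous_on UNIV f" by (rule C1_with_gradientD[OF cf])
    have [measurable]: "f \<in> borel_measurable borel" by (rule borel_measurable_continuous_onI[OF cont])
    \<comment> \<open>The mass of \<open>f\<close> is arbitrary here, so \<open>F\<close> in general
      is a non-zero constant to the right of the support of \<open>f\<close>; the value
      \<open>F 1\<close> is corrected below.\<close>
    obtain F where "\<And>t. (F has_real_derivative f t) (at t)"
      using has_antiderivative_compact_support[OF cont ab(1,2) f0] by metis
    then have F: "C1_with_gradient F f" using cont by (simp add: C1_with_gradient_def)
    have cF: "continuous_on UNIV (\<lambda>x. F (\<xi> x))"
      by (rule continuous_on_compose2[OF C1_with_gradientD(3)[OF F] continuous_xi]) simp
    obtain Bf where Bf: "\<And>t. \<bar>f t\<bar> \<le> Bf"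
      using exists_bound_compact_support[OF cont K'(1,3)] by auto
    have f2: "integrable \<nu> (\<lambda>t. (f t)\<^sup>2)"
    proof (rule finite_measure.integrable_const_bound[OF finite_measure_nu])
      show "AE t in \<nu>. norm ((f t)\<^sup>2) \<le> Bf\<^sup>2"
        using Bf by (intro AE_I2) (simp add: abs_le_square_iff[symmetric] order_trans[OF _ abs_ge_self])
    qed measurable
    have f1: "integrable \<nu> f" by (rule square_integrable_imp_integrable_nu[OF _ f2]) measurable
    have "(LINT t|lborel. f t * m t) = (LINT t|lborel. indicator {0<..<1} t * f t * m t)"
    proof (rule Bochner_Integration.integral_cong)
      show "f t * m t = indicator {0<..<1} t * f t * m t" for t
        using f01[of t] by (cases "t \<in> {0<..<1}") auto
    qed simp
    also have "\<dots> = - (LINT x|lborel. tail_integral f (\<xi> x) * (i \<bullet> D x))"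
      using fub[OF _ f1] by simp
    also have "(LINT x|lborel. tail_integral f (\<xi> x) * (i \<bullet> D x)) =
        (LINT x|lborel. F (\<xi> x) * (i \<bullet> D x) - F 1 * (i \<bullet> D x))"
    proof (rule Bochner_Integration.integral_cong)
      fix x
      show "tail_integral f (\<xi> x) * (i \<bullet> D x) = F (\<xi> x) * (i \<bullet> D x) - F 1 * (i \<bullet> D x)"
        using tail_integral_antiderivative[OF F xi_range(2)[of x]] D0[of x]
        by (cases "x \<in> S") (auto simp: left_diff_distrib)
    qed simp
    also have "\<dots> = (LINT x|lborel. F (\<xi> x) * (i \<bullet> D x)) - F 1 * (LINT x|lborel. i \<bullet> D x)"
    proof -
      have "integrable lborel (\<lambda>x. F (\<xi> x) * (i \<bullet> D x))" "integrable lborel (\<lambda>x. i \<bullet> D x)"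
        using K(4) cF cD by (auto intro!: test_function_integrable[OF _ K(1)] continuous_on_mult)
      then show ?thesis by simp
    qed
    \<comment> \<open>The constant \<open>F 1\<close> contributes nothing because a partial
      derivative of a test function has integral zero.\<close>
    also have "\<dots> = - (LINT x|lborel. w x * (i \<bullet> (f (\<xi> x) *\<^sub>R G x)))"
      using radial_lipschitz_weak_derivative[OF F K'(1,3) w, of i] test_gradient_integral_zero[OF w, of i] by simp
    also have "(LINT x|lborel. w x * (i \<bullet> (f (\<xi> x) *\<^sub>R G x))) = (LINT x|lborel. u x * f (\<xi> x))"
      by (simp add: u_def mult_ac)
    also have "\<dots> = (LINT x|lebesgue_on S. u x * f (\<xi> x))"
      by (rule integral_lebesgue_on_S_zero_off[symmetric]) (measurable, simp add: u_def K(3) KS)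
    also have "\<dots> = (LINT t|\<nu>. h t * f t)" by (rule h[OF _ f2]) measurable
    also have "\<dots> = (LINT t|lborel. f t * (weight t * h t))"
      by (subst integral_nu_weight(1)) (simp_all add: mult_ac)
    finally have eq: "(LINT t|lborel. f t * m t) = (LINT t|lborel. f t * (weight t * h t))" by simp
    have i1: "integrable lborel (\<lambda>t. f t * (weight t * h t))"
      by (subst mult.commute, rule integrable_mult_bounded[OF hw _ Bf]) measurable
    have "integrable lborel (\<lambda>t. (indicator {0<..<1} t * (m t - weight t * h t)) * f t)"
      by (rule integrable_mult_bounded[OF mw _ Bf]) measurable
    moreover have "(\<lambda>t. (indicator {0<..<1} t * (m t - weight t * h t)) * f t) = (\<lambda>t. f t * (m t - weight t * h t))"
    proof
      fix t
      show "(indicator {0<..<1} t * (m t - weight t * h t)) * f t = f t * (m t - weight t * h t)"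
        using f01[of t] by (cases "t \<in> {0<..<1}") auto
    qed
    ultimately have i2: "integrable lborel (\<lambda>t. f t * (m t - weight t * h t))" by simp
    have "(LINT t|lborel. f t * m t) = (LINT t|lborel. f t * (m t - weight t * h t) + f t * (weight t * h t))"
      by (simp add: right_diff_distrib)
    also have "\<dots> = (LINT t|lborel. f t * (m t - weight t * h t)) + (LINT t|lborel. f t * (weight t * h t))"
      by (rule Bochner_Integration.integral_add[OF i2 i1])
    finally have "(LINT t|lborel. f t * (m t - weight t * h t)) = 0" using eq by simp
    then show "(LINT t|lebesgue. f t * (m t - weight t * h t)) = 0"
      using borel_measurable_integrable[OF i2] by (simp add: integral_completion)
  qed simp
  have "(LINT x|lebesgue_on S. tail_integral r (\<xi> x) * (D x \<bullet> i)) = (LINT x|lborel. tail_integral r (\<xi> x) * (i \<bullet> D x))"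
    using D0 by (subst integral_lebesgue_on_S_zero_off) (auto simp: inner_commute)
  also have "\<dots> = - (LINT t|lborel. indicator {0<..<1} t * r t * m t)" by (rule fub[OF r r1])
  also have "(LINT t|lborel. indicator {0<..<1} t * r t * m t) = (LINT t|lborel. weight t * (h t * r t))"
  proof (rule integral_cong_AE)
    have "AE t in lborel. t \<noteq> 0" "AE t in lborel. t \<noteq> (1::real)" by (rule AE_lborel_singleton)+
    moreover have "AE t in lborel. t \<in> {0<..<1} \<longrightarrow> m t - weight t * h t = 0"
      using mh by (simp add: AE_completion_iff)
    ultimately show "AE t in lborel. indicator {0<..<1} t * r t * m t = weight t * (h t * r t)"
    proof eventually_elim
      case (elim t)
      then show ?case
        by (cases "t \<in> {0<..<1}") (auto simp: weight_def indicator_def)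
    qed
  qed measurable
  also have "\<dots> = (LINT t|\<nu>. h t * r t)" by (rule integral_nu_weight(1)[symmetric]) measurable
  also have "\<dots> = (LINT x|lebesgue_on S. u x * r (\<xi> x))" by (rule h[OF r r2, symmetric])
  also have "\<dots> = (LINT x|lebesgue_on S. (r (\<xi> x) *\<^sub>R G x \<bullet> i) * w x)"
    by (simp add: u_def inner_commute mult_ac)
  finally show "(LINT x|lebesgue_on S. tail_integral r (\<xi> x) * (D x \<bullet> i)) =
      - (LINT x|lebesgue_on S. (r (\<xi> x) *\<^sub>R G x \<bullet> i) * w x)" .
qed

end

subsection \<open>Gradients of radial Sobolev functions\<close>

context scaled_element
begin

text \<open>The profile \<open>\<rho>\<close> carries no measurability. A Borel version of
  \<open>\<phi>\<close> agrees with \<open>\<rho> (\<xi> x)\<close> off a null set, and by Fubini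
  almost every ray from \<open>z\<close> meets this null set in a null set of parameters.
  Restricting the Borel version to one such ray gives \<open>h\<close>.\<close>

lemma radial_representative:
  fixes \<phi> :: "'a \<Rightarrow> real"
  assumes \<phi>: "\<phi> \<in> borel_measurable (lebesgue_on S)" and rho: "AE x in lebesgue_on S. \<phi> x = \<rho> (\<xi> x)"
  obtains h where "h \<in> borel_measurable borel" "AE x in lebesgue_on S. \<phi> x = h (\<xi> x)"
proof -
  have "(\<lambda>x. indicator S x *\<^sub>R \<phi> x) \<in> borel_measurable lebesgue"
    using \<phi> by (subst (asm) borel_measurable_restrict_space_iff) auto
  then obtain \<phi>' where \<phi>'[measurable]: "\<phi>' \<in> borel_measurable borel" and ae: "AE x in lborel. indicator S x *\<^sub>R \<phi> x = \<phi>' x"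
    using completion_ex_borel_measurable_real[of "\<lambda>x. indicator S x *\<^sub>R \<phi> x" lborel] by auto
  have "AE x in lborel. x \<in> S \<longrightarrow> \<phi> x = \<rho> (\<xi> x)"
    using rho by (simp add: AE_lebesgue_on_S AE_completion_iff)
  with ae have "AE x in lborel. x \<in> S \<longrightarrow> \<phi>' x = \<rho> (\<xi> x)"
  proof eventually_elim
    case (elim x)
    show ?case
    proof
      assume "x \<in> S"
      with elim(2) have "\<phi> x = \<rho> (\<xi> x)" by blast
      with elim(1) \<open>x \<in> S\<close> show "\<phi>' x = \<rho> (\<xi> x)" by simp
    qed
  qed
  then obtain Z where Z: "Z \<in> null_sets lborel" "{x. \<not> (x \<in> S \<longrightarrow> \<phi>' x = \<rho> (\<xi> x))} \<subseteq> Z"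
    by (auto simp: eventually_ae_filter)
  then have [measurable]: "Z \<in> sets borel" by auto
  let ?ray = "\<lambda>x t. z + t *\<^sub>R (x - z)"
  have meas[measurable]: "Measurable.pred (lborel \<Otimes>\<^sub>M lborel) (\<lambda>p::'a \<times> real. 0 < snd p \<longrightarrow> ?ray (fst p) (snd p) \<notin> Z)"
    by measurable
  \<comment> \<open>For a fixed \<open>t > 0\<close> the dilation by \<open>t\<close> preserves null
    sets. This holds for every \<open>t\<close>, and exchanging the quantifiers by Fubini yields the
    statement about almost every ray.\<close>
  have "AE x in lborel. 0 < t \<longrightarrow> ?ray x t \<notin> Z" for t :: real
  proof (cases "0 < t")
    case True
    have "AE x in lborel. x \<notin> Z" by (rule AE_not_in[OF Z(1)])
    then have "AE x in density (distr lborel borel (\<lambda>x. (z - t *\<^sub>R z) + t *\<^sub>R x)) (\<lambda>_. \<bar>t\<bar> ^ DIM('a)). x \<notin> Z"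
      using True by (subst (asm) lborel_affine[of t "z - t *\<^sub>R z"]) auto
    then have "AE x in distr lborel borel (\<lambda>x. (z - t *\<^sub>R z) + t *\<^sub>R x). x \<notin> Z"
      using True by (subst (asm) AE_density) auto
    then have "AE x in lborel. (z - t *\<^sub>R z) + t *\<^sub>R x \<notin> Z"
      by (subst (asm) AE_distr_iff) auto
    then show ?thesis by (simp add: algebra_simps)
  qed simp
  then have "AE t in lborel. AE x in lborel. 0 < t \<longrightarrow> ?ray x t \<notin> Z" by simp
  then have rays: "AE x in lborel. AE t in lborel. 0 < t \<longrightarrow> ?ray x t \<notin> Z"
    using lborel_pair.AE_commute[of "\<lambda>x t. 0 < t \<longrightarrow> ?ray x t \<notin> Z"] meas by (simp add: pred_def)
  \<comment> \<open>A good ray exists because \<open>S\<close> has positive volume;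
    \<open>x0 \<noteq> z\<close> makes the ray non-degenerate.\<close>
  obtain x0 where x0: "x0 \<in> S" "x0 \<noteq> z" "AE t in lborel. 0 < t \<longrightarrow> ?ray x0 t \<notin> Z"
  proof (rule ccontr)
    assume "\<not> thesis"
    then have no: "\<And>x. x \<in> S \<Longrightarrow> x \<noteq> z \<Longrightarrow> \<not> (AE t in lborel. 0 < t \<longrightarrow> ?ray x t \<notin> Z)" using that by blast
    have "AE x in lborel. x \<noteq> z" by (rule AE_lborel_singleton)
    with rays have "AE x in lborel. x \<notin> S"
      by eventually_elim (use no in auto)
    then have "S \<in> null_sets lborel" by (subst (asm) AE_iff_null_sets[symmetric]) auto
    then show False using vol_pos by (simp add: vol_def null_sets_def measure_def)
  qed
  define s where "s = \<xi> x0"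
  have s: "0 < s" using xi_range(1)[OF x0(1)] xi_eq_0[OF x0(1)] x0(2) unfolding s_def by force
  \<comment> \<open>Dividing by \<open>s = \<xi> x0\<close> parametrizes the ray by the radial
    coordinate.\<close>
  define h where "h t = \<phi>' (?ray x0 (t / s))" for t
  have hm: "h \<in> borel_measurable borel" unfolding h_def by measurable
  have "AE t in lborel. 0 < 0 + (1 / s) * t \<longrightarrow> ?ray x0 (0 + (1 / s) * t) \<notin> Z"
    using s by (intro AE_borel_affine x0(3)) auto
  then have "AE t in lborel. t \<in> {0<..<1} \<longrightarrow> h t = \<rho> t"
  proof eventually_elim
    case (elim t)
    show ?case
    proof
      assume t: "t \<in> {0<..<1}"
      obtain s' y where y: "0 \<le> s'" "s' \<le> 1" "y \<in> scaled_boundary E" "x0 = z + s' *\<^sub>R (y - z)"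
        by (rule S_point[OF x0(1)])
      then have "s' = s" unfolding s_def using xi_point by simp
      then have ray: "?ray x0 (t / s) = z + t *\<^sub>R (y - z)" using y s by simp
      obtain L where L: "L \<in> E" "y \<in> facet_set L" using y(3) by (auto simp: scaled_boundary_def)
      have "z + t *\<^sub>R (y - z) \<in> sector z L" unfolding sector_iff using L t by (intro exI[of _ t] exI[of _ y]) auto
      then have inS: "?ray x0 (t / s) \<in> S" using ray sector_subset[OF L(1)] by auto
      have "\<xi> (?ray x0 (t / s)) = t" unfolding ray using xi_point[OF _ _ y(3)] t by auto
      moreover have "?ray x0 (t / s) \<notin> Z" using elim t s by simp
      ultimately show "h t = \<rho> t" using Z(2) inS unfolding h_def by auto
    qed
  qed
  then have "AE t in lebesgue. t \<in> {0<..<1} \<longrightarrow> h t = \<rho> t" by (simp add: AE_completion_iff)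
  then have "AE x in lebesgue_on S. h (\<xi> x) = \<rho> (\<xi> x)" by (rule AE_xi)
  with rho have "AE x in lebesgue_on S. \<phi> x = h (\<xi> x)" by eventually_elim simp
  then show ?thesis by (rule that[OF hm])
qed

end

section \<open>Test fields supported in a wedge of one sector\<close>

lemma C1_with_gradient_divide_power:
  fixes \<kappa> :: "real \<Rightarrow> real"
  assumes k: "C1_with_gradient \<kappa> \<kappa>'" and a: "0 < a" "\<And>t. t < a \<Longrightarrow> \<kappa> t = 0" "\<And>t. t < a \<Longrightarrow> \<kappa>' t = 0"
  shows "C1_with_gradient (\<lambda>t. \<kappa> t / t ^ n) (\<lambda>t. \<kappa>' t / t ^ n - real n * \<kappa> t / t ^ Suc n)"
  unfolding C1_with_gradient_def gderiv_deriv
proof (intro conjI allI)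
  let ?D = "\<lambda>t. \<kappa>' t / t ^ n - real n * \<kappa> t / t ^ Suc n"
  have ck: "continuous_on UNIV \<kappa>" "continuous_on UNIV \<kappa>'" using C1_with_gradientD[OF k] by auto
  \<comment> \<open>Left of \<open>a\<close> everything vanishes, including the value at 0, where
    division by zero returns 0. The two open sets cover the line since \<open>a > 0\<close>.\<close>
  have "continuous_on ({..<a} \<union> {0<..}) ?D"
  proof (rule continuous_on_open_Un)
    show "continuous_on {..<a} ?D"
      by (rule continuous_on_eq[of _ "\<lambda>t. 0"]) (use a in auto)
    show "continuous_on {0<..} ?D"
      by (intro continuous_intros continuous_on_subset[OF ck(1)] continuous_on_subset[OF ck(2)]) auto
  qed auto
  moreover have "{..<a} \<union> {0<..} = (UNIV :: real set)" using a(1) by force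
  ultimately show "continuous_on UNIV ?D" by simp
  fix t :: real
  show "((\<lambda>t. \<kappa> t / t ^ n) has_real_derivative ?D t) (at t)"
  proof (cases "t < a")
    case True
    have "((\<lambda>t. 0) has_real_derivative ?D t) (at t)" using a(2,3)[OF True] by simp
    then show ?thesis
      by (rule has_field_derivative_transform_within_open[where S="{..<a}"]) (use True a in auto)
  next
    case False
    then have t: "t \<noteq> 0" using a(1) by auto
    have "(\<kappa> has_real_derivative \<kappa>' t) (at t)" using C1_with_gradientD(1)[OF k] by simp
    moreover have "((\<lambda>t. t ^ n) has_real_derivative real n * t ^ (n - 1)) (at t)"
      by (auto intro!: derivative_eq_intros)
    ultimately have "((\<lambda>t. \<kappa> t / t ^ n) has_real_derivative (\<kappa>' t * t ^ n - \<kappa> t * (real n * t ^ (n - 1))) / (t ^ n * t ^ n)) (at t)"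
      using t by (intro DERIV_divide) auto
    moreover have "(\<kappa>' t * t ^ n - \<kappa> t * (real n * t ^ (n - 1))) / (t ^ n * t ^ n) = ?D t"
    proof (cases n)
      case 0
      then show ?thesis by simp
    next
      case (Suc k)
      then show ?thesis using t by (simp add: diff_divide_distrib) 
    qed
    ultimately show ?thesis by simp
  qed
qed

text \<open>A wedge inside the sector of a facet \<open>L\<close> with normal \<open>N\<close>: the cone over the disc of radius
  \<open>\<epsilon>\<close> around \<open>z + v\<close> in the plane of \<open>L\<close>. The bump is a squared positive part of a quadratic form,
  so that it is continuously differentiable and homogeneous of degree 4 without any division.\<close>

definition wedge_form :: "'a::euclidean_space \<Rightarrow> 'a \<Rightarrow> 'a \<Rightarrow> real \<Rightarrow> 'a \<Rightarrow> real" where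
  "wedge_form z N v \<epsilon> x = (\<epsilon> * ((x - z) \<bullet> N))\<^sup>2 - (norm (x - z - ((x - z) \<bullet> N) *\<^sub>R v))\<^sup>2"

definition wedge_bump :: "'a::euclidean_space \<Rightarrow> 'a \<Rightarrow> 'a \<Rightarrow> real \<Rightarrow> 'a \<Rightarrow> real" where
  "wedge_bump z N v \<epsilon> x = (max 0 (wedge_form z N v \<epsilon> x))\<^sup>2"

lemma wedge_form_scale: "wedge_form z N v \<epsilon> (z + t *\<^sub>R (x - z)) = t\<^sup>2 * wedge_form z N v \<epsilon> x"
proof -
  have eq: "z + t *\<^sub>R (x - z) - z = t *\<^sub>R (x - z)" by simp
  have "t *\<^sub>R d - (t *\<^sub>R d \<bullet> N) *\<^sub>R v = t *\<^sub>R (d - (d \<bullet> N) *\<^sub>R v)" for d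
    by (simp add: scaleR_diff_right)
  then show ?thesis
    unfolding wedge_form_def eq
    by (simp only: inner_scaleR_left norm_scaleR power_mult_distrib power2_abs right_diff_distrib) (simp add: mult_ac)
qed

lemma wedge_bump_scale:
  assumes "0 < t" shows "wedge_bump z N v \<epsilon> (z + t *\<^sub>R (x - z)) = t ^ 4 * wedge_bump z N v \<epsilon> x"
proof -
  have "max 0 (t\<^sup>2 * wedge_form z N v \<epsilon> x) = t\<^sup>2 * max 0 (wedge_form z N v \<epsilon> x)"
    using assms by (auto simp: max_def zero_le_mult_iff)
  then show ?thesis unfolding wedge_bump_def wedge_form_scale by (simp add: power_mult_distrib)
qed

lemma wedge_form_C1:
  obtains D where "C1_with_gradient (wedge_form z N v \<epsilon>) D" "\<And>x. D x \<bullet> (x - z) = 2 * wedge_form z N v \<epsilon> x"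
proof -
  let ?l = "\<lambda>x. (x - z) \<bullet> N" and ?u = "\<lambda>x. x - z - ((x - z) \<bullet> N) *\<^sub>R v"
  define D where "D x = (2 * \<epsilon>\<^sup>2 * ?l x) *\<^sub>R N - (2 *\<^sub>R ?u x - (2 * (?u x \<bullet> v)) *\<^sub>R N)" for x
  have eq: "wedge_form z N v \<epsilon> = (\<lambda>x. \<epsilon>\<^sup>2 * (?l x)\<^sup>2 - ?u x \<bullet> ?u x)"
    by (simp add: wedge_form_def power_mult_distrib power2_norm_eq_inner fun_eq_iff)
  show ?thesis
  proof (rule that[of D])
    have "((\<lambda>x. \<epsilon>\<^sup>2 * (?l x)\<^sup>2 - ?u x \<bullet> ?u x) has_derivative (\<lambda>h. h \<bullet> D x)) (at x)" for x
      unfolding D_def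
      by (auto intro!: derivative_eq_intros simp: fun_eq_iff inner_diff_left inner_diff_right inner_commute power2_eq_square algebra_simps)
    moreover have "continuous_on UNIV D" unfolding D_def by (intro continuous_intros)
    ultimately show "C1_with_gradient (wedge_form z N v \<epsilon>) D"
      unfolding C1_with_gradient_def gderiv_def eq by blast
    show "D x \<bullet> (x - z) = 2 * wedge_form z N v \<epsilon> x" for x
      unfolding D_def eq
      by (simp add: inner_diff_left inner_diff_right inner_commute power2_eq_square algebra_simps)
  qed
qed

text \<open>The second property is Euler's identity in degree 4; it is what turns the divergence of
  a radial field into a scalar expression in \<open>\<xi>\<close>.\<close>

lemma wedge_bump_C1:
  obtains D where "C1_with_gradient (wedge_bump z N v \<epsilon>) D" "\<And>x. D x \<bullet> (x - z) = 4 * wedge_bump z N v \<epsilon> x"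
proof -
  obtain D where D: "C1_with_gradient (wedge_form z N v \<epsilon>) D" "\<And>x. D x \<bullet> (x - z) = 2 * wedge_form z N v \<epsilon> x"
    using wedge_form_C1 by blast
  show ?thesis
  proof (rule that)
    show "C1_with_gradient (wedge_bump z N v \<epsilon>) (\<lambda>x. (2 * max 0 (wedge_form z N v \<epsilon> x)) *\<^sub>R D x)"
      using C1_with_gradient_square_max[OF D(1)] by (simp add: wedge_bump_def[abs_def])
    show "(2 * max 0 (wedge_form z N v \<epsilon> x)) *\<^sub>R D x \<bullet> (x - z) = 4 * wedge_bump z N v \<epsilon> x" for x
      by (simp add: D(2) wedge_bump_def power2_eq_square max_def)
  qed
qed

context scaled_element
begin

text \<open>The facet contains the disc of radius \<open>2 \<epsilon>\<close> while the bump lives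
  over the disc of radius \<open>\<epsilon>\<close>. The margin keeps the support of the cut-off
  bump inside the interior of the sector.\<close>

definition "admissible_wedge L v \<epsilon> \<longleftrightarrow> L \<in> E \<and> 0 < \<epsilon> \<and> nrm L \<bullet> v = 1 \<and>
  (\<forall>y. nrm L \<bullet> (y - z) = 1 \<longrightarrow> dist y (z + v) < 2 * \<epsilon> \<longrightarrow> y \<in> facet_set L)"

lemma admissible_wedge_exists: obtains L v \<epsilon> where "admissible_wedge L v \<epsilon>"
proof -
  obtain L where L: "L \<in> E" using E_nonempty by blast
  obtain y0 \<delta> where "0 < \<delta>" "nrm L \<bullet> (y0 - z) = 1"
    "\<And>y. nrm L \<bullet> (y - z) = 1 \<Longrightarrow> dist y y0 < \<delta> \<Longrightarrow> y \<in> facet_set L"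
    using facet_contains_disc[OF L] by metis
  then have "admissible_wedge L (y0 - z) (\<delta> / 2)" using L by (auto simp: admissible_wedge_def)
  then show ?thesis by (rule that)
qed

lemma wedge_in_sector:
  assumes A: "admissible_wedge L v \<epsilon>" and l: "0 < (x - z) \<bullet> nrm L" "(x - z) \<bullet> nrm L \<le> 1"
    and x: "norm (x - z - ((x - z) \<bullet> nrm L) *\<^sub>R v) < 2 * \<epsilon> * ((x - z) \<bullet> nrm L)"
  shows "x \<in> sector z L"
proof -
  let ?l = "(x - z) \<bullet> nrm L"
  let ?y = "z + (1 / ?l) *\<^sub>R (x - z)"
  have "nrm L \<bullet> (?y - z) = 1" using l by (simp add: inner_commute)
  moreover have "dist ?y (z + v) < 2 * \<epsilon>"
  proof -
    have "?y - (z + v) = (1 / ?l) *\<^sub>R (x - z - ?l *\<^sub>R v)" using l by (simp add: scaleR_diff_right)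
    then have "dist ?y (z + v) = norm (x - z - ?l *\<^sub>R v) / ?l" using l by (simp add: dist_norm)
    also have "\<dots> < 2 * \<epsilon>" using x l by (simp add: field_simps)
    finally show ?thesis .
  qed
  ultimately have "?y \<in> facet_set L" using A by (auto simp: admissible_wedge_def)
  moreover have "x = z + ?l *\<^sub>R (?y - z)" using l by simp
  ultimately show ?thesis unfolding sector_iff using l by (intro exI[of _ ?l] exI[of _ ?y]) auto
qed

lemma wedge_bump_nonzero:
  assumes "wedge_bump z N v \<epsilon> x \<noteq> 0" "0 < (x - z) \<bullet> N" "0 < \<epsilon>"
  shows "norm (x - z - ((x - z) \<bullet> N) *\<^sub>R v) < \<epsilon> * ((x - z) \<bullet> N)"
proof -
  have "(norm (x - z - ((x - z) \<bullet> N) *\<^sub>R v))\<^sup>2 < (\<epsilon> * ((x - z) \<bullet> N))\<^sup>2"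
    using assms(1) by (auto simp: wedge_bump_def wedge_form_def max_def split: if_splits)
  then show ?thesis by (rule power_less_imp_less_base) (use assms in auto)
qed

lemma wedge_bump_le: "wedge_bump z N v \<epsilon> x \<le> \<epsilon> ^ 4 * ((x - z) \<bullet> N) ^ 4"
proof -
  have "max 0 (wedge_form z N v \<epsilon> x) \<le> (\<epsilon> * ((x - z) \<bullet> N))\<^sup>2" by (simp add: wedge_form_def)
  then have "wedge_bump z N v \<epsilon> x \<le> ((\<epsilon> * ((x - z) \<bullet> N))\<^sup>2)\<^sup>2"
    unfolding wedge_bump_def by (intro power_mono) auto
  then show ?thesis by (simp add: power_mult_distrib flip: power_mult)
qed

text \<open>\<open>\<theta>\<close> cuts the cone off from the apex and from the facet, and the bump
  cuts it off sideways. The resulting closed set \<open>?K\<close> sits in the open set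
  \<open>?U\<close> defined by strict inequalities and the doubled radius, and \<open>?U\<close>
  lies in the sector.\<close>

lemma wedge_test_function:
  assumes A: "admissible_wedge L v \<epsilon>" and chi: "C1_with_gradient \<theta> \<theta>'" and ab: "0 < a" "b < 1" "\<And>t. t \<notin> {a..b} \<Longrightarrow> \<theta> t = 0"
    and beta: "C1_with_gradient (wedge_bump z (nrm L) v \<epsilon>) D"
  shows "test_function S (\<lambda>x. (\<theta> ((x - z) \<bullet> nrm L) * wedge_bump z (nrm L) v \<epsilon> x) * ((x - z) \<bullet> i))
    (\<lambda>x. (\<theta> ((x - z) \<bullet> nrm L) * wedge_bump z (nrm L) v \<epsilon> x) *\<^sub>R i + ((x - z) \<bullet> i) *\<^sub>R
       (\<theta> ((x - z) \<bullet> nrm L) *\<^sub>R D x + wedge_bump z (nrm L) v \<epsilon> x *\<^sub>R (\<theta>' ((x - z) \<bullet> nrm L) *\<^sub>R nrm L)))"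
proof (rule test_functionI)
  let ?l = "\<lambda>x. (x - z) \<bullet> nrm L" and ?u = "\<lambda>x. norm (x - z - ((x - z) \<bullet> nrm L) *\<^sub>R v)"
  have L: "L \<in> E" and eps: "0 < \<epsilon>" using A by (auto simp: admissible_wedge_def)
  show "C1_with_gradient (\<lambda>x. (\<theta> (?l x) * wedge_bump z (nrm L) v \<epsilon> x) * ((x - z) \<bullet> i))
    (\<lambda>x. (\<theta> (?l x) * wedge_bump z (nrm L) v \<epsilon> x) *\<^sub>R i + ((x - z) \<bullet> i) *\<^sub>R
       (\<theta> (?l x) *\<^sub>R D x + wedge_bump z (nrm L) v \<epsilon> x *\<^sub>R (\<theta>' (?l x) *\<^sub>R nrm L)))"
    using C1_with_gradientD(1,2)[OF chi]
    by (intro C1_with_gradient_mult C1_with_gradient_inner beta C1_with_gradient_compose) auto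
  let ?K = "{x. a \<le> ?l x \<and> ?l x \<le> b \<and> ?u x \<le> \<epsilon> * ?l x}"
  let ?U = "{x. 0 < ?l x \<and> ?l x < 1 \<and> ?u x < 2 * \<epsilon> * ?l x}"
  have KU: "?K \<subseteq> ?U"
  proof
    fix x assume "x \<in> ?K"
    then have "0 < ?l x" "?l x < 1" "?u x \<le> \<epsilon> * ?l x" using ab by auto
    moreover from this have "\<epsilon> * ?l x < 2 * \<epsilon> * ?l x" using eps by simp
    ultimately show "x \<in> ?U" by simp
  qed
  have "?U \<subseteq> S" using wedge_in_sector[OF A] sector_subset[OF L] by force
  moreover have "open ?U"
    by (intro open_Collect_conj open_Collect_less continuous_intros)
  ultimately have US: "?U \<subseteq> interior S" by (rule interior_maximal)
  then show "?K \<subseteq> interior S" using KU by blast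
  have "closed ?K" by (intro closed_Collect_conj closed_Collect_le continuous_intros)
  moreover have "bounded ?K"
    using KU US interior_subset[of S] by (intro bounded_subset[OF bounded_S]) blast
  ultimately show "compact ?K" by (simp add: compact_eq_bounded_closed)
  fix x assume x: "x \<notin> ?K"
  have "\<theta> (?l x) = 0 \<or> wedge_bump z (nrm L) v \<epsilon> x = 0"
  proof (rule ccontr)
    assume *: "\<not> (\<theta> (?l x) = 0 \<or> wedge_bump z (nrm L) v \<epsilon> x = 0)"
    then have "?l x \<in> {a..b}" using ab(3) by blast
    moreover from this have "?u x < \<epsilon> * ?l x"
      using * ab(1) eps by (intro wedge_bump_nonzero) auto
    ultimately show False using x by auto
  qed
  then show "(\<theta> (?l x) * wedge_bump z (nrm L) v \<epsilon> x) * ((x - z) \<bullet> i) = 0" by auto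
qed

end

lemma unit_test_functionE:
  fixes \<kappa> :: "real \<Rightarrow> real"
  assumes "test_function {0<..<1} \<kappa> \<kappa>'"
  obtains a b where "C1_with_gradient \<kappa> \<kappa>'" "0 < a" "b < 1" "\<And>t. t \<notin> {a..b} \<Longrightarrow> \<kappa> t = 0" "\<And>t. t \<notin> {a..b} \<Longrightarrow> \<kappa>' t = 0"
    "\<exists>B. \<forall>t. \<bar>\<kappa>' t\<bar> \<le> B"
proof -
  obtain K where c: "C1_with_gradient \<kappa> \<kappa>'" and K: "compact K" "K \<subseteq> {0<..<1}" "\<And>t. t \<notin> K \<Longrightarrow> \<kappa> t = 0" "\<And>t. t \<notin> K \<Longrightarrow> \<kappa>' t = 0"
    using test_functionD[OF assms] by (auto simp: interior_open)
  obtain a b where ab: "0 < a" "b < 1" "K \<subseteq> {a..b}"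
    using compact_subset_unit_interval[OF K(1,2)] by blast
  have "\<kappa> t = 0" "\<kappa>' t = 0" if "t \<notin> {a..b}" for t using K(3,4)[of t] ab(3) that by blast+
  then show ?thesis
    using exists_bound_compact_support[OF C1_with_gradientD(2)[OF c] K(1) K(4)] ab(1,2)
    by (intro that[OF c])
qed

context scaled_element
begin

lemma weight_eq: "t \<in> {0..1} \<Longrightarrow> weight t = vol * real DIM('a) * t ^ (DIM('a) - 1)"
  by (simp add: weight_def)

lemma test_integrable_nu:
  fixes h f :: "real \<Rightarrow> real"
  assumes [measurable]: "h \<in> borel_measurable borel" and h: "integrable \<nu> h" and f[measurable]: "f \<in> borel_measurable borel"
    and "0 < a" "b < 1" "\<And>t. t \<notin> {a..b} \<Longrightarrow> f t = 0" "\<exists>B. \<forall>t. \<bar>f t\<bar> \<le> B"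
  shows "integrable lborel (\<lambda>t. h t * f t)"
proof -
  obtain B where B: "\<And>t. \<bar>f t\<bar> \<le> B" using assms(7) by blast
  \<comment> \<open>Any left end strictly between 0 and \<open>a\<close> would do: the open interval
    has to contain \<open>{a..b}\<close>.\<close>
  have "integrable lborel (\<lambda>t. (indicator {a/2<..<1} t * h t) * f t)"
    by (rule integrable_mult_bounded[OF set_integrable_tail[OF assms(1) h] _ B]) (use assms in auto)
  moreover have "(\<lambda>t. (indicator {a/2<..<1} t * h t) * f t) = (\<lambda>t. h t * f t)"
  proof
    fix t
    show "(indicator {a/2<..<1} t * h t) * f t = h t * f t"
      using assms(4-6) by (cases "t \<in> {a..b}") auto
  qed
  ultimately show ?thesis by simp
qed

text \<open>The bump is positive on a non-empty open part of the sector. Positivity of the mass is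
  what allows division by \<open>Q\<close> in \<open>radial_gradient\<close>.\<close>

lemma wedge_mass:
  assumes A: "admissible_wedge L v \<epsilon>"
  shows "integrable lborel (\<lambda>x. indicator (sector z L) x * wedge_bump z (nrm L) v \<epsilon> x)" (is "integrable _ ?f")
    and "0 < (LINT x|lborel. indicator (sector z L) x * wedge_bump z (nrm L) v \<epsilon> x)"
proof -
  have L: "L \<in> E" and eps: "0 < \<epsilon>" "nrm L \<bullet> v = 1" using A by (auto simp: admissible_wedge_def)
  obtain D where D: "C1_with_gradient (wedge_bump z (nrm L) v \<epsilon>) D" using wedge_bump_C1 by blast
  have [measurable]: "wedge_bump z (nrm L) v \<epsilon> \<in> borel_measurable borel"
    using C1_with_gradientD(3)[OF D] by (rule borel_measurable_continuous_onI)
  have [measurable]: "sector z L \<in> sets borel" using compact_sector by (simp add: borel_compact)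
  show int: "integrable lborel ?f"
    using borel_integrable_compact[OF compact_sector C1_with_gradientD(4)[OF D]] by (simp add: mult.commute)
  have f0: "0 \<le> ?f x" for x by (simp add: wedge_bump_def)
  show "0 < (LINT x|lborel. ?f x)"
  proof (rule ccontr)
    assume "\<not> 0 < (LINT x|lborel. ?f x)"
    moreover have "0 \<le> (LINT x|lborel. ?f x)" using f0 by (intro Bochner_Integration.integral_nonneg)
    ultimately have "(LINT x|lborel. ?f x) = 0" by linarith
    then have ae: "AE x in lborel. ?f x = 0"
      using integral_nonneg_eq_0_iff_AE[OF int] f0 by simp
    let ?l = "\<lambda>x. (x - z) \<bullet> nrm L"
    let ?U = "{x. 0 < ?l x \<and> ?l x < 1 \<and> norm (x - z - ?l x *\<^sub>R v) < \<epsilon> * ?l x}"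
    have "open ?U" by (intro open_Collect_conj open_Collect_less continuous_intros)
    moreover have "z + (1/2) *\<^sub>R v \<in> ?U" using eps by (simp add: inner_commute)
    ultimately have nn: "\<not> negligible ?U" by (metis (no_types, lifting) empty_iff open_not_negligible)
    have "?f x \<noteq> 0" if "x \<in> ?U" for x
    proof -
      have x: "0 < ?l x" "?l x < 1" "norm (x - z - ?l x *\<^sub>R v) < \<epsilon> * ?l x" using that by auto
      moreover have "\<epsilon> * ?l x < 2 * \<epsilon> * ?l x" using x eps by simp
      ultimately have "x \<in> sector z L" by (intro wedge_in_sector[OF A]) auto
      moreover have "(norm (x - z - ?l x *\<^sub>R v))\<^sup>2 < (\<epsilon> * ?l x)\<^sup>2"
        using x by (intro power_strict_mono) auto
      then have "wedge_bump z (nrm L) v \<epsilon> x \<noteq> 0" by (simp add: wedge_bump_def wedge_form_def)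
      ultimately show ?thesis by simp
    qed
    then have "AE x in lborel. x \<notin> ?U" using ae by (auto elim!: eventually_mono)
    then have "AE x in lebesgue. x \<notin> ?U" by (rule AE_completion)
    moreover have "?U \<in> sets lebesgue" using \<open>open ?U\<close> by (simp add: borel_open)
    ultimately have "?U \<in> null_sets lebesgue" by (simp only: AE_iff_null_sets)
    then have "negligible ?U" by (simp only: negligible_iff_null_sets)
    with nn show False by blast
  qed
qed

text \<open>The exponent \<open>d + 3\<close> is the sum of the degree 4 of the bump and the
  exponent \<open>d - 1\<close> of the weight. Both cancel, and a plain Lebesgue integral of
  \<open>F\<close> remains.\<close>

lemma wedge_integral:
  fixes F :: "real \<Rightarrow> real"
  assumes A: "admissible_wedge L v \<epsilon>" and [measurable]: "F \<in> borel_measurable borel" and F0: "\<And>t. t \<notin> {0<..<1} \<Longrightarrow> F t = 0"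
  shows "(LINT x|lborel. indicator (sector z L) x * wedge_bump z (nrm L) v \<epsilon> x * (F (\<xi> x) / \<xi> x ^ (DIM('a) + 3))) =
    (LINT x|lborel. indicator (sector z L) x * wedge_bump z (nrm L) v \<epsilon> x) * (DIM('a) + 4) * (LINT t|lborel. F t)"
proof -
  have L: "L \<in> E" using A by (auto simp: admissible_wedge_def)
  obtain D where D: "C1_with_gradient (wedge_bump z (nrm L) v \<epsilon>) D" using wedge_bump_C1 by blast
  have "(LINT x|lborel. indicator (sector z L) x * wedge_bump z (nrm L) v \<epsilon> x * (F (\<xi> x) / \<xi> x ^ (DIM('a) + 3))) =
      (LINT x|lborel. indicator (sector z L) x * wedge_bump z (nrm L) v \<epsilon> x) * (DIM('a) + 4) / (vol * DIM('a)) *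
      (LINT t|\<nu>. t ^ 4 * (F t / t ^ (DIM('a) + 3)))"
    by (rule sector_integral[OF L borel_measurable_continuous_onI[OF C1_with_gradientD(3)[OF D]] _ wedge_bump_scale wedge_mass(1)[OF A]])
      (auto simp: wedge_bump_def)
  also have "(LINT t|\<nu>. t ^ 4 * (F t / t ^ (DIM('a) + 3))) = (LINT t|lborel. weight t * (t ^ 4 * (F t / t ^ (DIM('a) + 3))))"
    by (rule integral_nu_weight(1)) measurable
  also have "\<dots> = (LINT t|lborel. vol * DIM('a) * F t)"
  proof (rule Bochner_Integration.integral_cong)
    fix t :: real
    show "weight t * (t ^ 4 * (F t / t ^ (DIM('a) + 3))) = vol * DIM('a) * F t"
    proof (cases "t \<in> {0<..<1}")
      case True
      have "DIM('a) + 3 = (DIM('a) - 1) + 4" using dim_ge_2 by simp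
      then have "t ^ (DIM('a) + 3) = t ^ (DIM('a) - 1) * t ^ 4" by (simp only: power_add)
      then show ?thesis using True by (simp add: weight_eq)
    qed (simp add: F0)
  qed simp
  also have "\<dots> = vol * DIM('a) * (LINT t|lborel. F t)" by (rule integral_mult_right_zero)
  finally show ?thesis using vol_pos by simp
qed

text \<open>The weak gradient is tested with the radial field \<open>W(x) (x - z)\<close>, where
  \<open>W\<close> is the wedge bump times \<open>\<kappa>(\<xi>) / \<xi>^(d+4)\<close>. The
  \<open>d\<close> from the divergence of \<open>x - z\<close> and the 4 from Euler's identity are
  cancelled by the derivative of the power, so only \<open>\<kappa>'\<close> remains in the
  divergence. What results is integration by parts for \<open>h\<close> along the rays.\<close>

lemma ray_identity:
  assumes A: "admissible_wedge L v \<epsilon>" and g: "has_weak_gradient S \<phi> g"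
    and h[measurable]: "h \<in> borel_measurable borel" and ae: "AE x in lebesgue_on S. \<phi> x = h (\<xi> x)"
    and k: "test_function {0<..<1} \<kappa> \<kappa>'"
  shows "(LINT x|lborel. indicator (sector z L) x * wedge_bump z (nrm L) v \<epsilon> x) * (DIM('a) + 4) * (LINT t|lborel. h t * \<kappa>' t) =
    - (LINT x|lebesgue_on S. indicator (sector z L) x * wedge_bump z (nrm L) v \<epsilon> x * (g x \<bullet> (x - z)) * (\<kappa> (\<xi> x) / \<xi> x ^ (DIM('a) + 4)))"
proof -
  let ?n = "DIM('a) + 4" and ?\<beta> = "wedge_bump z (nrm L) v \<epsilon>" and ?l = "\<lambda>x. (x - z) \<bullet> nrm L" and ?K = "sector z L"
  have L: "L \<in> E" and eps: "0 < \<epsilon>" using A by (auto simp: admissible_wedge_def)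
  obtain a b where c: "C1_with_gradient \<kappa> \<kappa>'" and ab: "0 < a" "b < 1" "\<And>t. t \<notin> {a..b} \<Longrightarrow> \<kappa> t = 0" "\<And>t. t \<notin> {a..b} \<Longrightarrow> \<kappa>' t = 0"
    using unit_test_functionE[OF k] by metis
  obtain D where D: "C1_with_gradient ?\<beta> D" "\<And>x. D x \<bullet> (x - z) = 4 * ?\<beta> x"
    using wedge_bump_C1 by blast
  have [measurable]: "?\<beta> \<in> borel_measurable borel"
    using C1_with_gradientD(3)[OF D(1)] by (rule borel_measurable_continuous_onI)
  have [measurable]: "?K \<in> sets borel" using compact_sector by (simp add: borel_compact)
  have [measurable]: "\<kappa>' \<in> borel_measurable borel" "\<kappa> \<in> borel_measurable borel"
    using C1_with_gradientD(2,3)[OF c] by (auto intro: borel_measurable_continuous_onI)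
  let ?\<theta> = "\<lambda>t. \<kappa> t / t ^ ?n" and ?\<theta>' = "\<lambda>t. \<kappa>' t / t ^ ?n - real ?n * \<kappa> t / t ^ Suc ?n"
  have th: "C1_with_gradient ?\<theta> ?\<theta>'"
    by (rule C1_with_gradient_divide_power[OF c ab(1)]) (use ab in auto)
  define W where "W x = ?\<theta> (?l x) * ?\<beta> x" for x
  define DW where "DW x = ?\<theta> (?l x) *\<^sub>R D x + ?\<beta> x *\<^sub>R (?\<theta>' (?l x) *\<^sub>R nrm L)" for x
  \<comment> \<open>The components of the field are the scalar test functions; summing the
    \<open>i\<close>-th equation over \<open>i\<close> produces the divergence.\<close>
  have test: "test_function S (\<lambda>x. W x * ((x - z) \<bullet> i)) (\<lambda>x. W x *\<^sub>R i + ((x - z) \<bullet> i) *\<^sub>R DW x)" for i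
    unfolding W_def DW_def by (rule wedge_test_function[OF A th ab(1,2) _ D(1)]) (use ab(3) in auto)
  note comp = g[unfolded has_weak_gradient_iff_components[OF S_sets(3)]]
  have sq: "square_integrable S \<phi>" "square_integrable S g" using comp by auto
  note phi_int = square_integrable_integrable[OF S_sets(3) sq(1)]
  note g_int = integrable_inner_left[OF square_integrable_integrable[OF S_sets(3) sq(2)]]
  have div: "(\<Sum>i\<in>Basis. (W x *\<^sub>R i + ((x - z) \<bullet> i) *\<^sub>R DW x) \<bullet> i) = ?\<beta> x * (\<kappa>' (?l x) / ?l x ^ (DIM('a) + 3))" for x
  proof -
    have "(\<Sum>i\<in>Basis. (W x *\<^sub>R i + ((x - z) \<bullet> i) *\<^sub>R DW x) \<bullet> i) = (\<Sum>i\<in>(Basis :: 'a set). W x) + (\<Sum>i\<in>Basis. ((x - z) \<bullet> i) * (DW x \<bullet> i))"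
      by (subst sum.distrib[symmetric]) (auto simp: inner_add_left intro!: sum.cong)
    also have "\<dots> = DIM('a) * W x + (x - z) \<bullet> DW x"
      by (simp add: euclidean_inner[of "x - z" "DW x"])
    also have "(x - z) \<bullet> DW x = 4 * W x + ?\<beta> x * (?\<theta>' (?l x) * ?l x)"
      using D(2)[of x] by (simp add: DW_def W_def inner_add_right inner_commute)
    also have "DIM('a) * W x + \<dots> = ?\<beta> x * (real ?n * ?\<theta> (?l x) + ?\<theta>' (?l x) * ?l x)"
    proof -
      have "real DIM('a) * (q * b) + (4 * (q * b) + b * (p * s)) = b * (real ?n * q + p * s)" for q b p s :: real
        by (simp add: algebra_simps)
      then show ?thesis unfolding W_def .
    qed
    also have "real ?n * ?\<theta> (?l x) + ?\<theta>' (?l x) * ?l x = \<kappa>' (?l x) / ?l x ^ (DIM('a) + 3)"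
    proof (cases "?l x = 0")
      case True
      then have "\<kappa> (?l x) = 0" "\<kappa>' (?l x) = 0" using ab(1) ab(3,4)[of "?l x"] by auto
      then show ?thesis by simp
    next
      case False
      then show ?thesis by (simp add: left_diff_distrib numeral_eq_Suc)
    qed
    finally show ?thesis .
  qed
  \<comment> \<open>The bump is even about \<open>z\<close> and hence also non-zero on the opposite
    cone. There \<open>?l x\<close> is negative and the factor \<open>f\<close> vanishes.\<close>
  have outside: "?\<beta> x * f (?l x) = 0" if "x \<notin> ?K" "\<And>t. t \<notin> {a..b} \<Longrightarrow> f t = 0" for x and f :: "real \<Rightarrow> real"
  proof (rule ccontr)
    assume *: "?\<beta> x * f (?l x) \<noteq> 0"
    then have l: "?l x \<in> {a..b}" using that(2) by auto
    then have "norm (x - z - ?l x *\<^sub>R v) < \<epsilon> * ?l x" using * ab(1) eps by (intro wedge_bump_nonzero) auto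
    moreover have "\<epsilon> * ?l x < 2 * \<epsilon> * ?l x" using l ab(1) eps by simp
    ultimately have "x \<in> ?K" using l ab by (intro wedge_in_sector[OF A]) auto
    then show False using that(1) by blast
  qed
  have on_K: "?l x = \<xi> x" if "x \<in> ?K" for x using xi_sector[OF L that] by (simp add: inner_commute)
  have "(\<Sum>i\<in>Basis. (LINT x|lebesgue_on S. \<phi> x * ((W x *\<^sub>R i + ((x - z) \<bullet> i) *\<^sub>R DW x) \<bullet> i))) =
      (\<Sum>i\<in>Basis. - (LINT x|lebesgue_on S. (g x \<bullet> i) * (W x * ((x - z) \<bullet> i))))"
    using comp test by (intro sum.cong refl) blast
  moreover have "(\<Sum>i\<in>Basis. (LINT x|lebesgue_on S. \<phi> x * ((W x *\<^sub>R i + ((x - z) \<bullet> i) *\<^sub>R DW x) \<bullet> i))) =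
      (LINT x|lebesgue_on S. \<phi> x * (?\<beta> x * (\<kappa>' (?l x) / ?l x ^ (DIM('a) + 3))))"
    unfolding div[symmetric] sum_distrib_left
    by (rule Bochner_Integration.integral_sum[symmetric]) (rule test_function_products_integrable(1)[OF phi_int test])
  moreover have "(LINT x|lebesgue_on S. \<phi> x * (?\<beta> x * (\<kappa>' (?l x) / ?l x ^ (DIM('a) + 3)))) =
      (LINT x|lebesgue_on S. indicator ?K x * ?\<beta> x * ((h (\<xi> x) * \<kappa>' (\<xi> x)) / \<xi> x ^ (DIM('a) + 3)))"
  proof (rule integral_cong_AE)
    have [measurable]: "\<phi> \<in> borel_measurable (lebesgue_on S)" using sq by (simp add: square_integrable_scalar)
    have "(\<lambda>x. ?\<beta> x * (\<kappa>' (?l x) / ?l x ^ (DIM('a) + 3))) \<in> borel_measurable (lebesgue_on S)"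
      by (rule measurable_lebesgue_on_S) measurable
    then show "(\<lambda>x. \<phi> x * (?\<beta> x * (\<kappa>' (?l x) / ?l x ^ (DIM('a) + 3)))) \<in> borel_measurable (lebesgue_on S)"
      by measurable
    show "(\<lambda>x. indicator ?K x * ?\<beta> x * ((h (\<xi> x) * \<kappa>' (\<xi> x)) / \<xi> x ^ (DIM('a) + 3))) \<in> borel_measurable (lebesgue_on S)"
      by (rule measurable_lebesgue_on_S) measurable
    show "AE x in lebesgue_on S. \<phi> x * (?\<beta> x * (\<kappa>' (?l x) / ?l x ^ (DIM('a) + 3))) =
        indicator ?K x * ?\<beta> x * ((h (\<xi> x) * \<kappa>' (\<xi> x)) / \<xi> x ^ (DIM('a) + 3))"
      using ae
    proof eventually_elim
      case (elim x)
      show ?case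
      proof (cases "x \<in> ?K")
        case True
        then show ?thesis using elim on_K[OF True] by simp
      next
        case False
        then have "?\<beta> x * (\<kappa>' (?l x) / ?l x ^ (DIM('a) + 3)) = 0"
          using outside[of x "\<lambda>t. \<kappa>' t / t ^ (DIM('a) + 3)"] ab(4) by simp
        moreover have "indicator ?K x = (0::real)" using False by simp
        ultimately show ?thesis by (simp only: mult_zero_right mult_zero_left)
      qed
    qed
  qed
  moreover have "\<dots> = (LINT x|lborel. indicator ?K x * ?\<beta> x * ((h (\<xi> x) * \<kappa>' (\<xi> x)) / \<xi> x ^ (DIM('a) + 3)))"
    using sector_subset[OF L] by (intro integral_lebesgue_on_S_zero_off) (measurable, auto simp: indicator_def)
  moreover have "\<dots> = (LINT x|lborel. indicator ?K x * ?\<beta> x) * (DIM('a) + 4) * (LINT t|lborel. h t * \<kappa>' t)"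
    using ab by (intro wedge_integral[OF A]) (measurable, auto)
  moreover have "(\<Sum>i\<in>Basis. - (LINT x|lebesgue_on S. (g x \<bullet> i) * (W x * ((x - z) \<bullet> i)))) =
      - (LINT x|lebesgue_on S. (\<Sum>i\<in>Basis. (g x \<bullet> i) * (W x * ((x - z) \<bullet> i))))"
    unfolding sum_negf
    by (subst Bochner_Integration.integral_sum) (rule test_function_products_integrable(2)[OF g_int test], simp)
  moreover have "(LINT x|lebesgue_on S. (\<Sum>i\<in>Basis. (g x \<bullet> i) * (W x * ((x - z) \<bullet> i)))) =
      (LINT x|lebesgue_on S. indicator ?K x * ?\<beta> x * (g x \<bullet> (x - z)) * (\<kappa> (\<xi> x) / \<xi> x ^ ?n))"
  proof (rule Bochner_Integration.integral_cong)
    fix x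
    have "(\<Sum>i\<in>Basis. (g x \<bullet> i) * (W x * ((x - z) \<bullet> i))) = W x * (g x \<bullet> (x - z))"
      by (simp add: euclidean_inner[of "g x" "x - z"] sum_distrib_left mult_ac)
    also have "\<dots> = indicator ?K x * ?\<beta> x * (g x \<bullet> (x - z)) * (\<kappa> (\<xi> x) / \<xi> x ^ ?n)"
    proof (cases "x \<in> ?K")
      case True
      then show ?thesis using on_K[OF True] by (simp add: W_def)
    next
      case False
      then have "W x = 0"
        using outside[of x ?\<theta>] ab(3) unfolding W_def by (simp add: mult.commute)
      then show ?thesis using False by simp
    qed
    finally show "(\<Sum>i\<in>Basis. (g x \<bullet> i) * (W x * ((x - z) \<bullet> i))) =
        indicator ?K x * ?\<beta> x * (g x \<bullet> (x - z)) * (\<kappa> (\<xi> x) / \<xi> x ^ ?n)" .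
  qed simp
  ultimately show ?thesis by linarith
qed

end

subsection \<open>The orthogonal decomposition\<close>

lemma inverse_not_integrable_near_0:
  fixes f :: "real \<Rightarrow> real"
  assumes f: "integrable lborel f" "\<And>t. 0 \<le> f t" and ge: "AE t in lborel. t \<in> {0<..<1} \<longrightarrow> c / t \<le> f t"
  shows "c \<le> 0"
proof (rule ccontr)
  assume "\<not> c \<le> 0"
  then have c: "0 < c" by simp
  define I where "I = (LINT t|lborel. f t)"
  have I0: "0 \<le> I" unfolding I_def using f(2) by (intro Bochner_Integration.integral_nonneg)
  \<comment> \<open>Chosen so that the integral of \<open>c / t\<close> over \<open>[e, 1]\<close>
    is \<open>I + c\<close>, which exceeds the total integral \<open>I\<close> of
    \<open>f\<close>.\<close>
  define e where "e = exp (- (I / c + 1))"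
  have "0 \<le> I / c" using I0 c by simp
  then have e: "0 < e" "e \<le> 1" by (auto simp: e_def)
  have FTC: "(LINT t|lborel. (c / t) * indicator {e..1} t) = c * ln 1 - c * ln e"
  proof (rule integral_FTC_Icc_real[OF e(2)])
    show "DERIV (\<lambda>t. c * ln t) t :> c / t" if "e \<le> t" for t
      using that e(1) by (auto intro!: derivative_eq_intros)
    show "isCont (\<lambda>t. c / t) t" if "e \<le> t" for t
      using that e(1) by (auto intro!: continuous_intros)
  qed
  have int: "integrable lborel (\<lambda>t. (c / t) * indicator {e..1} t)"
  proof -
    have "set_integrable lborel {e..1} (\<lambda>t. c / t)"
      using e(1) by (intro borel_integrable_atLeastAtMost' continuous_intros) auto
    then show ?thesis by (simp add: set_integrable_def mult.commute)
  qed
  have "(LINT t|lborel. (c / t) * indicator {e..1} t) \<le> I"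
    unfolding I_def
  proof (rule integral_mono_AE[OF int f(1)])
    have "AE t in lborel. t \<noteq> (1::real)" by (rule AE_lborel_singleton)
    with ge show "AE t in lborel. c / t * indicator {e..1} t \<le> f t"
      by eventually_elim (use e f(2) in \<open>auto simp: indicator_def\<close>)
  qed
  moreover have "c * ln 1 - c * ln e = I + c"
    using c by (simp add: e_def field_simps)
  ultimately show False using FTC c by simp
qed

section \<open>Linear structure of the Duffy spaces\<close>

lemma constant_trace_in_trace_space:
  assumes "\<And>y. y \<in> scaled_boundary E \<Longrightarrow> \<alpha> y = C"
  shows "\<alpha> \<in> trace_space E k"
proof -
  have "\<alpha> \<in> facet_space k L" if L: "L \<in> E" for L
  proof -
    have eq: "\<alpha> y = C" if "y \<in> facet_set L" for y
      using assms L that by (auto simp: scaled_boundary_def)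
    \<comment> \<open>The free inner bound \<open>m i\<close> covers both two-variable spaces:
      \<open>k - i\<close> for total degree and \<open>k\<close> for degree in each
      variable.\<close>
    have two: "(\<Sum>i\<le>k. \<Sum>j\<le>m i. (if i = 0 \<and> j = 0 then C else 0) * s ^ i * t ^ j) = C" for m s t
    proof -
      have "(\<Sum>i\<le>k. \<Sum>j\<le>m i. (if i = 0 \<and> j = 0 then C else 0) * s ^ i * t ^ j) = (\<Sum>i\<le>k. if i = 0 then C else 0)"
      proof (rule sum.cong)
        fix i
        have "(\<Sum>j\<le>m i. (if i = 0 \<and> j = 0 then C else 0) * s ^ i * t ^ j) = (\<Sum>j\<le>m i. if j = 0 then (if i = 0 then C else 0) else 0)"
          by (intro sum.cong) auto
        also have "\<dots> = (if i = 0 then C else 0)" by (subst sum.delta) auto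
        finally show "(\<Sum>j\<le>m i. (if i = 0 \<and> j = 0 then C else 0) * s ^ i * t ^ j) = (if i = 0 then C else 0)" .
      qed simp
      also have "\<dots> = C" by (subst sum.delta) auto
      finally show ?thesis .
    qed
    have one: "(\<lambda>_. C) \<in> poly_interval k"
      unfolding poly_interval_def by (intro CollectI exI[of _ "[:C:]"]) (auto simp: fun_eq_iff)
    have "(\<lambda>(s, t). \<Sum>i\<le>k. \<Sum>j\<le>k - i. (if i = 0 \<and> j = 0 then C else 0) * s ^ i * t ^ j) \<in> poly_total_degree k"
      unfolding poly_total_degree_def
      by (intro CollectI exI[of _ "\<lambda>i j. if i = 0 \<and> j = 0 then C else 0"] conjI refl TrueI)
    then have total: "(\<lambda>(s, t). C) \<in> poly_total_degree k" by (simp only: two)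
    have "(\<lambda>(s, t). \<Sum>i\<le>k. \<Sum>j\<le>k. (if i = 0 \<and> j = 0 then C else 0) * s ^ i * t ^ j) \<in> poly_each_degree k"
      unfolding poly_each_degree_def
      by (intro CollectI exI[of _ "\<lambda>i j. if i = 0 \<and> j = 0 then C else 0"] conjI refl TrueI)
    then have each: "(\<lambda>(s, t). C) \<in> poly_each_degree k" by (simp only: two)
    show ?thesis
    proof (cases L)
      case (Segment a b)
      show ?thesis unfolding Segment facet_space.simps
        using eq Segment by (intro CollectI bexI[OF _ one]) auto
    next
      case (Triangle a b c)
      show ?thesis unfolding Triangle facet_space.simps
        using eq Triangle by (intro CollectI bexI[OF _ total]) (auto simp: split_beta)
    next
      case (Quadrilateral a b c d)
      show ?thesis unfolding Quadrilateral facet_space.simps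
        using eq Quadrilateral by (intro CollectI bexI[OF _ each]) (auto simp: split_beta)
    qed
  qed
  moreover have "continuous_on (scaled_boundary E) \<alpha>"
    by (rule continuous_on_eq[OF continuous_on_const[of _ C]]) (simp add: assms)
  moreover have "\<exists>C. \<forall>y\<in>scaled_boundary E. \<alpha> y = C" using assms by blast
  ultimately show ?thesis unfolding trace_space_def by (cases "k = 0") simp_all
qed

lemma duffy_space_add_function:
  assumes "\<phi> \<in> duffy_space S z E k" "f \<in> duffy_functions S z E k"
  shows "(\<lambda>x. \<phi> x + f x) \<in> duffy_space S z E k"
proof -
  obtain n :: nat and F where "\<phi> = (\<lambda>x. \<Sum>i<n. F i x)" "\<forall>i<n. F i \<in> duffy_functions S z E k"
    using assms(1) unfolding duffy_space_def by blast
  then show ?thesis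
    unfolding duffy_space_def using assms(2)
    by (intro CollectI exI[of _ "Suc n"] exI[of _ "F(n := f)"]) (auto simp: less_Suc_eq)
qed

lemma duffy_space_add:
  assumes "\<phi> \<in> duffy_space S z E k" "\<psi> \<in> duffy_space S z E k"
  shows "(\<lambda>x. \<phi> x + \<psi> x) \<in> duffy_space S z E k"
proof -
  obtain n :: nat and F where psi: "\<psi> = (\<lambda>x. \<Sum>i<n. F i x)" and F: "\<forall>i<n. F i \<in> duffy_functions S z E k"
    using assms(2) unfolding duffy_space_def by blast
  have "(\<lambda>x. \<phi> x + (\<Sum>i<m. F i x)) \<in> duffy_space S z E k" if "m \<le> n" for m
    using that
  proof (induction m)
    case 0
    then show ?case using assms(1) by simp
  next
    case (Suc m)
    then have "(\<lambda>x. (\<phi> x + (\<Sum>i<m. F i x)) + F m x) \<in> duffy_space S z E k"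
      using F by (intro duffy_space_add_function[of "\<lambda>x. \<phi> x + (\<Sum>i<m. F i x)"]) auto
    then show ?case by (simp add: add.assoc)
  qed
  then show ?thesis unfolding psi by blast
qed

lemma duffy_functions_subset_space: "duffy_functions S z E k \<subseteq> duffy_space S z E k"
proof
  fix f assume "f \<in> duffy_functions S z E k"
  then show "f \<in> duffy_space S z E k"
    unfolding duffy_space_def by (intro CollectI exI[of _ 1] exI[of _ "\<lambda>_. f"]) auto
qed

lemma duffy_space_0_subset: "duffy_space S z E 0 \<subseteq> duffy_space S z E k"
proof -
  have "trace_space E 0 \<subseteq> trace_space E k"
    using constant_trace_in_trace_space[of E _ _ k] by (force simp: trace_space_def)
  then have "duffy_functions S z E 0 \<subseteq> duffy_functions S z E k"
    unfolding duffy_functions_def by blast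
  then show ?thesis unfolding duffy_space_def by blast
qed

context scaled_element
begin

lemma negligible_frontier_S: "negligible (frontier S)"
  by (rule negligible_convex_frontier[OF convex_S])

lemmas grad_inner_S = grad_inner_eq[OF S_sets(3) negligible_frontier_S]

lemma has_weak_gradient_const: "has_weak_gradient S (\<lambda>x. c) (\<lambda>x. 0)"
  unfolding has_weak_gradient_iff_components[OF S_sets(3)]
proof (intro conjI allI impI ballI)
  show "square_integrable S (\<lambda>x. c)" "square_integrable S (\<lambda>x. 0 :: 'a)"
    by (auto simp: square_integrable_def intro!: finite_measure.integrable_const finite_measure_S)
  fix w D and i :: 'a assume w: "test_function S w D" and i: "i \<in> Basis"
  obtain K where c: "C1_with_gradient w D" and K: "K \<subseteq> interior S" "\<And>x. x \<notin> K \<Longrightarrow> D x = 0"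
    using test_functionD[OF w] by blast
  have [measurable]: "(\<lambda>x. D x \<bullet> i) \<in> borel_measurable borel"
    by (intro borel_measurable_continuous_onI continuous_intros C1_with_gradientD[OF c])
  have "(LINT x|lebesgue_on S. c * (D x \<bullet> i)) = (LINT x|lborel. c * (D x \<bullet> i))"
    using K interior_subset[of S] by (intro integral_lebesgue_on_S_zero_off) (measurable, force)
  then show "(LINT x|lebesgue_on S. c * (D x \<bullet> i)) = - (LINT x|lebesgue_on S. (0 \<bullet> i) * w x)"
    using test_gradient_integral_zero[OF w, of i] by (simp add: inner_commute)
qed

text \<open>Near the center the bump is of order \<open>\<xi>^4\<close> and \<open>x - z\<close> of
  order \<open>\<xi>\<close>. Division by the fifth power therefore leaves a field bounded by a
  multiple of the norm of \<open>g\<close>.\<close>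

lemma square_integrable_wedge_field:
  assumes A: "admissible_wedge L v \<epsilon>" and g: "square_integrable S g"
  defines "u \<equiv> \<lambda>x. indicator (sector z L) x * wedge_bump z (nrm L) v \<epsilon> x * (g x \<bullet> (x - z)) / \<xi> x ^ 5"
  shows "u \<in> borel_measurable (lebesgue_on S)" "integrable (lebesgue_on S) (\<lambda>x. (u x)\<^sup>2)"
proof -
  have L: "L \<in> E" and eps: "0 < \<epsilon>" using A by (auto simp: admissible_wedge_def)
  obtain D where D: "C1_with_gradient (wedge_bump z (nrm L) v \<epsilon>) D" using wedge_bump_C1 by blast
  have [measurable]: "wedge_bump z (nrm L) v \<epsilon> \<in> borel_measurable borel"
    using C1_with_gradientD(3)[OF D] by (rule borel_measurable_continuous_onI)
  have [measurable]: "sector z L \<in> sets borel" using compact_sector by (simp add: borel_compact)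
  have gm[measurable]: "g \<in> borel_measurable (lebesgue_on S)" and gi: "integrable (lebesgue_on S) (\<lambda>x. (norm (g x))\<^sup>2)"
    using g by (auto simp: square_integrable_def)
  have m1: "(\<lambda>x. indicator (sector z L) x * wedge_bump z (nrm L) v \<epsilon> x) \<in> borel_measurable (lebesgue_on S)"
    "(\<lambda>x. x - z) \<in> borel_measurable (lebesgue_on S)" "(\<lambda>x. \<xi> x ^ 5) \<in> borel_measurable (lebesgue_on S)"
    by (rule measurable_lebesgue_on_S; measurable)+
  show u: "u \<in> borel_measurable (lebesgue_on S)"
    unfolding u_def by (intro borel_measurable_divide borel_measurable_times borel_measurable_inner m1 gm)
  obtain R where R: "\<And>y. y \<in> S \<Longrightarrow> norm (y - z) \<le> R" "0 \<le> R"
  proof -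
    obtain R where "\<forall>y\<in>S. dist z y \<le> R" using bounded_S bounded_any_center[of S] by blast
    then show ?thesis using that[of R] z_in_S by (auto simp: dist_norm norm_minus_commute intro: order_trans[OF norm_ge_zero])
  qed
  have bound: "\<bar>u x\<bar> \<le> \<epsilon> ^ 4 * R * norm (g x)" for x
  proof (cases "x \<in> sector z L \<and> \<xi> x \<noteq> 0")
    case False
    then have "u x = 0" by (auto simp: u_def)
    then show ?thesis using R(2) eps by simp
  next
    case True
    then have xK: "x \<in> sector z L" and xS: "x \<in> S" using sector_subset[OF L] by auto
    then have xi0: "0 < \<xi> x" using True xi_range(1)[of x] by auto
    obtain t y where ty: "0 \<le> t" "t \<le> 1" "y \<in> scaled_boundary E" "x = z + t *\<^sub>R (y - z)" by (rule S_point[OF xS])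
    have yS: "y \<in> S" using ty(3) facet_frontier closed_S by (fastforce simp: scaled_boundary_def frontier_def)
    have "norm (x - z) = \<xi> x * norm (y - z)" using ty xi_point[OF ty(1-3)] by simp
    also have "\<dots> \<le> \<xi> x * R" using R(1)[OF yS] xi0 by (intro mult_left_mono) auto
    finally have nx: "norm (x - z) \<le> \<xi> x * R" .
    have "\<bar>g x \<bullet> (x - z)\<bar> \<le> norm (g x) * norm (x - z)" by (rule Cauchy_Schwarz_ineq2)
    also have "\<dots> \<le> norm (g x) * (\<xi> x * R)" using nx by (intro mult_left_mono) auto
    finally have gx: "\<bar>g x \<bullet> (x - z)\<bar> \<le> norm (g x) * (\<xi> x * R)" .
    have b: "wedge_bump z (nrm L) v \<epsilon> x \<le> \<epsilon> ^ 4 * \<xi> x ^ 4"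
      using wedge_bump_le[of "nrm L" v \<epsilon> x] xi_sector[OF L xK] by (simp add: inner_commute)
    have b0: "0 \<le> wedge_bump z (nrm L) v \<epsilon> x" by (simp add: wedge_bump_def)
    have "wedge_bump z (nrm L) v \<epsilon> x * \<bar>g x \<bullet> (x - z)\<bar> \<le> (\<epsilon> ^ 4 * \<xi> x ^ 4) * (norm (g x) * (\<xi> x * R))"
      using b b0 gx by (intro mult_mono) auto
    also have "\<dots> = (\<epsilon> ^ 4 * R * norm (g x)) * \<xi> x ^ 5"
      by (simp add: numeral_eq_Suc mult_ac)
    finally have "wedge_bump z (nrm L) v \<epsilon> x * \<bar>g x \<bullet> (x - z)\<bar> / \<xi> x ^ 5 \<le> \<epsilon> ^ 4 * R * norm (g x)"
      using xi0 by (simp add: pos_divide_le_eq)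
    then show ?thesis using xK xi0 b0 by (simp add: u_def abs_mult)
  qed
  show "integrable (lebesgue_on S) (\<lambda>x. (u x)\<^sup>2)"
  proof (rule Bochner_Integration.integrable_bound)
    show "integrable (lebesgue_on S) (\<lambda>x. (\<epsilon> ^ 4 * R)\<^sup>2 * (norm (g x))\<^sup>2)" using gi by simp
    show "(\<lambda>x. (u x)\<^sup>2) \<in> borel_measurable (lebesgue_on S)" using u by measurable
    show "AE x in lebesgue_on S. norm ((u x)\<^sup>2) \<le> norm ((\<epsilon> ^ 4 * R)\<^sup>2 * (norm (g x))\<^sup>2)"
    proof (rule AE_I2)
      fix x
      have "\<bar>u x\<bar> \<le> \<bar>\<epsilon> ^ 4 * R * norm (g x)\<bar>" using bound[of x] by linarith
      then have "(u x)\<^sup>2 \<le> (\<epsilon> ^ 4 * R * norm (g x))\<^sup>2" by (rule abs_le_square_iff[THEN iffD1])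
      then show "norm ((u x)\<^sup>2) \<le> norm ((\<epsilon> ^ 4 * R)\<^sup>2 * (norm (g x))\<^sup>2)" by (simp add: power_mult_distrib)
    qed
  qed
qed

text \<open>A candidate \<open>r\<close> is read off from the radial part of \<open>g\<close> in one
  wedge. Its antiderivative composed with \<open>\<xi>\<close> has a known gradient, and
  \<open>ray_identity\<close> shows that it has the same weak derivative along rays as
  \<open>\<phi>\<close>. The profiles then differ by a constant, and uniqueness of weak gradients
  identifies \<open>g\<close> in all sectors.\<close>

proposition radial_gradient:
  assumes g: "has_weak_gradient S \<phi> g" and rho: "AE x in lebesgue_on S. \<phi> x = \<rho> (\<xi> x)"
  obtains r where "r \<in> borel_measurable borel" "integrable \<nu> (\<lambda>t. (r t)\<^sup>2)" "AE x in lebesgue_on S. g x = r (\<xi> x) *\<^sub>R G x"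
proof -
  obtain L v \<epsilon> where A: "admissible_wedge L v \<epsilon>" by (rule admissible_wedge_exists)
  have L: "L \<in> E" using A by (simp add: admissible_wedge_def)
  let ?K = "sector z L" and ?\<beta> = "wedge_bump z (nrm L) v \<epsilon>"
  define Q where "Q = (LINT x|lborel. indicator ?K x * ?\<beta> x) * (DIM('a) + 4)"
  have Q: "0 < Q" unfolding Q_def using wedge_mass(2)[OF A] by simp
  have cancel: "X = - Y" if "Q * X = - (Q * Y)" for X Y
  proof -
    have "Q * (X + Y) = 0" using that by (simp add: distrib_left)
    then show ?thesis using Q by simp
  qed
  have sq: "square_integrable S \<phi>" "square_integrable S g" using g by (auto simp: has_weak_gradient_def)
  obtain h where h[measurable]: "h \<in> borel_measurable borel" and \<phi>h: "AE x in lebesgue_on S. \<phi> x = h (\<xi> x)"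
    by (rule radial_representative[OF sq(1)[unfolded square_integrable_scalar, THEN conjunct1] rho])
  have "integrable (lebesgue_on S) (\<lambda>x. (h (\<xi> x))\<^sup>2)"
  proof -
    have "(\<lambda>x. (h (\<xi> x))\<^sup>2) \<in> borel_measurable (lebesgue_on S)" by (rule measurable_lebesgue_on_S) measurable
    moreover have "AE x in lebesgue_on S. (\<phi> x)\<^sup>2 = (h (\<xi> x))\<^sup>2" using \<phi>h by eventually_elim simp
    ultimately show ?thesis
      using sq(1) integrable_cong_AE[of "\<lambda>x. (\<phi> x)\<^sup>2" "lebesgue_on S" "\<lambda>x. (h (\<xi> x))\<^sup>2"]
      by (auto simp: square_integrable_scalar)
  qed
  then have "integrable \<nu> (\<lambda>t. (h t)\<^sup>2)" by (subst integrable_nu_iff) auto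
  then have h1: "integrable \<nu> h" by (rule square_integrable_imp_integrable_nu[OF h])
  let ?u = "\<lambda>x. indicator ?K x * ?\<beta> x * (g x \<bullet> (x - z)) / \<xi> x ^ 5"
  obtain H where H[measurable]: "H \<in> borel_measurable borel" and H2: "integrable \<nu> (\<lambda>t. (H t)\<^sup>2)"
    and HH: "\<And>f::real \<Rightarrow> real. f \<in> borel_measurable borel \<Longrightarrow> integrable \<nu> (\<lambda>t. (f t)\<^sup>2) \<Longrightarrow>
       (LINT x|lebesgue_on S. ?u x * f (\<xi> x)) = (LINT t|\<nu>. H t * f t)"
    using finite_measure.pushforward_density[OF finite_measure_S xi_measurable_S square_integrable_wedge_field[OF A sq(2)]]
    unfolding \<nu>_def[symmetric] by blast
  \<comment> \<open>The factor makes \<open>weight t * H t * f t\<close> equal to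
    \<open>Q * (r t * \<kappa> t)\<close> for the \<open>f\<close> used below: of the weight only
    \<open>vol * d\<close> is left after the powers of \<open>t\<close> cancel, and \<open>Q\<close>
    is the constant in \<open>ray_identity\<close>.\<close>
  define r where "r t = vol * DIM('a) / Q * H t" for t
  have r[measurable]: "r \<in> borel_measurable borel" unfolding r_def by measurable
  have r2: "integrable \<nu> (\<lambda>t. (r t)\<^sup>2)" unfolding r_def power_mult_distrib using H2 by simp
  let ?R = "tail_integral r"
  note wgR = radial_weak_gradient[OF r r2]
  have R1: "integrable \<nu> ?R"
    by (rule square_integrable_imp_integrable_nu[OF _ tail_integral_square_integrable[OF r r2]]) measurable
  have zero: "(LINT t|lebesgue. \<kappa>' t * (h t - ?R t)) = 0" if k: "test_function {0<..<1} \<kappa> \<kappa>'" for \<kappa> \<kappa>'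
  proof -
    obtain a b where c: "C1_with_gradient \<kappa> \<kappa>'" and ab: "0 < a" "b < 1" "\<And>t. t \<notin> {a..b} \<Longrightarrow> \<kappa> t = 0" "\<And>t. t \<notin> {a..b} \<Longrightarrow> \<kappa>' t = 0"
      and bd: "\<exists>B. \<forall>t. \<bar>\<kappa>' t\<bar> \<le> B"
      using unit_test_functionE[OF k] by metis
    have [measurable]: "\<kappa>' \<in> borel_measurable borel" "\<kappa> \<in> borel_measurable borel"
      using C1_with_gradientD(2,3)[OF c] by (auto intro: borel_measurable_continuous_onI)
    have i1: "integrable lborel (\<lambda>t. h t * \<kappa>' t)"
      by (rule test_integrable_nu[OF h h1 _ ab(1,2,4) bd]) measurable
    have i2: "integrable lborel (\<lambda>t. ?R t * \<kappa>' t)"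
      by (rule test_integrable_nu[OF _ R1 _ ab(1,2,4) bd]) measurable
    let ?n = "DIM('a) + 4"
    \<comment> \<open>The power \<open>t^5\<close> undoes the division by \<open>\<xi>^5\<close> in
      the square-integrable field, restoring the integrand of \<open>ray_identity\<close>.\<close>
    define f where "f t = t ^ 5 * (\<kappa> t / t ^ ?n)" for t
    have [measurable]: "f \<in> borel_measurable borel" unfolding f_def by measurable
    have "continuous_on UNIV f"
      unfolding f_def
      by (intro continuous_on_mult continuous_intros C1_with_gradientD(3)[OF C1_with_gradient_divide_power[OF c ab(1)]]) (use ab in auto)
    then obtain B where B: "\<And>t. \<bar>f t\<bar> \<le> B"
      using exists_bound_compact_support[of f "{a..b}"] ab(3) by (auto simp: f_def)
    have f2: "integrable \<nu> (\<lambda>t. (f t)\<^sup>2)"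
    proof (rule finite_measure.integrable_const_bound[OF finite_measure_nu])
      show "AE t in \<nu>. norm ((f t)\<^sup>2) \<le> B\<^sup>2"
        using B by (intro AE_I2) (simp add: abs_le_square_iff[symmetric] order_trans[OF _ abs_ge_self])
    qed measurable
    have "Q * (LINT t|lborel. h t * \<kappa>' t) =
        - (LINT x|lebesgue_on S. indicator ?K x * ?\<beta> x * (g x \<bullet> (x - z)) * (\<kappa> (\<xi> x) / \<xi> x ^ ?n))"
      unfolding Q_def by (rule ray_identity[OF A g h \<phi>h k])
    also have "(\<lambda>x. indicator ?K x * ?\<beta> x * (g x \<bullet> (x - z)) * (\<kappa> (\<xi> x) / \<xi> x ^ ?n)) = (\<lambda>x. ?u x * f (\<xi> x))"
    proof
      fix x
      show "indicator ?K x * ?\<beta> x * (g x \<bullet> (x - z)) * (\<kappa> (\<xi> x) / \<xi> x ^ ?n) = ?u x * f (\<xi> x)"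
        by (cases "\<xi> x = 0") (use ab(1) ab(3)[of 0] in \<open>auto simp: f_def\<close>)
    qed
    also have "(LINT x|lebesgue_on S. ?u x * f (\<xi> x)) = (LINT t|\<nu>. H t * f t)" by (rule HH[OF _ f2]) measurable
    also have "\<dots> = (LINT t|lborel. weight t * (H t * f t))" by (rule integral_nu_weight(1)) measurable
    also have "\<dots> = (LINT t|lborel. Q * (r t * \<kappa> t))"
    proof (rule Bochner_Integration.integral_cong)
      fix t
      show "weight t * (H t * f t) = Q * (r t * \<kappa> t)"
      proof (cases "t \<in> {a..b}")
        case True
        then have t: "t \<in> {0..1}" "t \<noteq> 0" using ab by auto
        have "DIM('a) + 4 = (DIM('a) - 1) + 5" using dim_ge_2 by simp
        then have "t ^ ?n = t ^ (DIM('a) - 1) * t ^ 5" by (simp only: power_add)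
        then show ?thesis using t Q by (simp add: f_def r_def weight_eq)
      next
        case False
        then show ?thesis using ab(3)[OF False] by (simp add: f_def)
      qed
    qed simp
    also have "\<dots> = Q * (LINT t|lborel. r t * \<kappa> t)" by (rule integral_mult_right_zero)
    finally have e1: "(LINT t|lborel. h t * \<kappa>' t) = - (LINT t|lborel. r t * \<kappa> t)" by (rule cancel)
    \<comment> \<open>The same identity for the candidate. Its gradient is explicit, so Euler's
      identity for \<open>\<xi>\<close> reduces the right side to \<open>r\<close>.\<close>
    have "Q * (LINT t|lborel. ?R t * \<kappa>' t) =
        - (LINT x|lebesgue_on S. indicator ?K x * ?\<beta> x * (r (\<xi> x) *\<^sub>R G x \<bullet> (x - z)) * (\<kappa> (\<xi> x) / \<xi> x ^ ?n))"
      unfolding Q_def by (rule ray_identity[OF A wgR _ _ k]) auto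
    also have "(LINT x|lebesgue_on S. indicator ?K x * ?\<beta> x * (r (\<xi> x) *\<^sub>R G x \<bullet> (x - z)) * (\<kappa> (\<xi> x) / \<xi> x ^ ?n)) =
        (LINT x|lebesgue_on S. indicator ?K x * ?\<beta> x * ((r (\<xi> x) * \<kappa> (\<xi> x)) / \<xi> x ^ (DIM('a) + 3)))"
    proof (rule integral_cong_AE)
      obtain D where D: "C1_with_gradient ?\<beta> D" using wedge_bump_C1 by blast
      have [measurable]: "?\<beta> \<in> borel_measurable borel"
        using C1_with_gradientD(3)[OF D] by (rule borel_measurable_continuous_onI)
      have [measurable]: "?K \<in> sets borel" using compact_sector by (simp add: borel_compact)
      show "(\<lambda>x. indicator ?K x * ?\<beta> x * (r (\<xi> x) *\<^sub>R G x \<bullet> (x - z)) * (\<kappa> (\<xi> x) / \<xi> x ^ ?n)) \<in> borel_measurable (lebesgue_on S)"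
        "(\<lambda>x. indicator ?K x * ?\<beta> x * ((r (\<xi> x) * \<kappa> (\<xi> x)) / \<xi> x ^ (DIM('a) + 3))) \<in> borel_measurable (lebesgue_on S)"
        by (rule measurable_lebesgue_on_S; measurable)+
      have "AE x in lebesgue_on S. \<exists>L\<in>E. x \<in> interior (sector z L)"
        using AE_interior_sector by (simp add: AE_lebesgue_on_S)
      then show "AE x in lebesgue_on S. indicator ?K x * ?\<beta> x * (r (\<xi> x) *\<^sub>R G x \<bullet> (x - z)) * (\<kappa> (\<xi> x) / \<xi> x ^ ?n) =
          indicator ?K x * ?\<beta> x * ((r (\<xi> x) * \<kappa> (\<xi> x)) / \<xi> x ^ (DIM('a) + 3))"
      proof eventually_elim
        case (elim x)
        then have "G x \<bullet> (x - z) = \<xi> x" using G_radial by blast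
        moreover have "\<xi> x ^ ?n = \<xi> x * \<xi> x ^ (DIM('a) + 3)"
          by (simp add: numeral_eq_Suc)
        ultimately show ?case
          by (cases "\<xi> x = 0") (use ab(1) ab(3)[of 0] in auto)
      qed
    qed
    also have "\<dots> = (LINT x|lborel. indicator ?K x * ?\<beta> x * ((r (\<xi> x) * \<kappa> (\<xi> x)) / \<xi> x ^ (DIM('a) + 3)))"
    proof (rule integral_lebesgue_on_S_zero_off)
      obtain D where D: "C1_with_gradient ?\<beta> D" using wedge_bump_C1 by blast
      have [measurable]: "?\<beta> \<in> borel_measurable borel"
        using C1_with_gradientD(3)[OF D] by (rule borel_measurable_continuous_onI)
      have [measurable]: "?K \<in> sets borel" using compact_sector by (simp add: borel_compact)
      show "(\<lambda>x. indicator ?K x * ?\<beta> x * ((r (\<xi> x) * \<kappa> (\<xi> x)) / \<xi> x ^ (DIM('a) + 3))) \<in> borel_measurable borel"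
        by measurable
      show "indicator ?K x * ?\<beta> x * ((r (\<xi> x) * \<kappa> (\<xi> x)) / \<xi> x ^ (DIM('a) + 3)) = 0" if "x \<notin> S" for x
        using that sector_subset[OF L] by (auto simp: indicator_def)
    qed
    also have "\<dots> = Q * (LINT t|lborel. r t * \<kappa> t)"
      unfolding Q_def using ab by (intro wedge_integral[OF A]) (measurable, auto)
    finally have e2: "(LINT t|lborel. ?R t * \<kappa>' t) = - (LINT t|lborel. r t * \<kappa> t)" by (rule cancel)
    have "(LINT t|lborel. h t * \<kappa>' t - ?R t * \<kappa>' t) = 0"
      using e1 e2 by (subst Bochner_Integration.integral_diff[OF i1 i2]) simp
    moreover have "(\<lambda>t. h t * \<kappa>' t - ?R t * \<kappa>' t) = (\<lambda>t. \<kappa>' t * (h t - ?R t))"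
      by (simp add: fun_eq_iff algebra_simps)
    ultimately have "(LINT t|lborel. \<kappa>' t * (h t - ?R t)) = 0" by simp
    then show ?thesis by (subst integral_completion) auto
  qed
  obtain c where c: "AE t in lebesgue. t \<in> {0<..<1} \<longrightarrow> h t - ?R t = c"
  proof (rule AE_const_if_derivative_tests_zero[OF _ zero])
    fix a b :: real assume ab: "0 < a" "b < 1"
    have d1: "integrable \<nu> (\<lambda>t. h t - ?R t)" using h1 R1 by simp
    have "integrable lborel (\<lambda>t. indicator {a..b} t *\<^sub>R (indicator {a/2<..<1} t * (h t - ?R t)))"
      using ab by (intro integrable_mult_indicator set_integrable_tail d1) auto
    moreover have "(\<lambda>t. indicator {a..b} t *\<^sub>R (indicator {a/2<..<1} t * (h t - ?R t))) = (\<lambda>t. indicator {a..b} t *\<^sub>R (h t - ?R t))"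
      using ab by (intro ext) (auto simp: indicator_def)
    ultimately show "set_integrable lebesgue {a..b} (\<lambda>t. h t - ?R t)"
      unfolding set_integrable_def by (intro integrable_lborel_imp_lebesgue) simp
  qed
  have "AE x in lebesgue_on S. h (\<xi> x) - ?R (\<xi> x) = c" by (rule AE_xi[OF c])
  with \<phi>h have ae: "AE x in lebesgue_on S. \<phi> x = ?R (\<xi> x) + c" by eventually_elim simp
  have "has_weak_gradient S (\<lambda>x. ?R (\<xi> x) + c) (\<lambda>x. r (\<xi> x) *\<^sub>R G x + 0)"
    by (rule has_weak_gradient_add[OF S_sets(3) wgR has_weak_gradient_const])
  then have "has_weak_gradient S \<phi> (\<lambda>x. r (\<xi> x) *\<^sub>R G x)"
    using has_weak_gradient_cong[OF S_sets(3) _ sq(1) ae] by simp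
  from has_weak_gradient_unique[OF S_sets(3) negligible_frontier_S g this]
  show ?thesis by (rule that[OF r r2])
qed


section \<open>Passage from Duffy functions to profiles in the radial coordinate\<close>

lemma boundary_nonempty: "scaled_boundary E \<noteq> {}"
  using E_nonempty facet_set_convex_compact(3) by (auto simp: scaled_boundary_def)

lemma xi_apex: "\<xi> z = 0"
proof -
  obtain y where "y \<in> scaled_boundary E" using boundary_nonempty by blast
  from xi_point[of 0, OF _ _ this] show ?thesis by simp
qed

text \<open>The constant value of the trace is absorbed into the profile. The new profile inherits
  no regularity, which is why \<open>radial_gradient\<close> accepts an arbitrary one.\<close>

lemma radial_extension_constant_trace:
  assumes \<alpha>: "\<alpha> \<in> trace_space E 0" and ext: "radial_extension S z E \<rho> \<alpha> \<phi>"
  obtains \<rho>' where "AE x in lebesgue_on S. \<phi> x = \<rho>' (\<xi> x)"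
proof -
  obtain C where C: "\<forall>y\<in>scaled_boundary E. \<alpha> y = C" using \<alpha> by (auto simp: trace_space_def)
  have "AE x in lebesgue_on S. x \<in> S" by (intro AE_I2) simp
  with ext[unfolded radial_extension_def] have "AE x in lebesgue_on S. \<phi> x = \<rho> (\<xi> x) * C"
  proof eventually_elim
    case (elim x)
    obtain t y where ty: "0 \<le> t" "t \<le> 1" "y \<in> scaled_boundary E" "x = z + t *\<^sub>R (y - z)"
      by (rule S_point[OF elim(2)])
    then have "\<xi> x = t" using xi_point by simp
    moreover have "\<phi> x = \<rho> t * \<alpha> y" using elim(1) ty by auto
    ultimately show ?case using C ty(3) by simp
  qed
  then show ?thesis by (rule that)
qed

lemma radial_extension_radial:
  assumes "\<And>x. x \<in> S \<Longrightarrow> \<phi> x = \<rho> (\<xi> x)"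
  shows "radial_extension S z E \<rho> (\<lambda>_. 1) \<phi>"
  unfolding radial_extension_def
proof (rule AE_I2)
  fix x assume "x \<in> space (lebesgue_on S)"
  then have "\<phi> x = \<rho> (\<xi> x)" using assms by simp
  then show "\<forall>t\<in>{0..1}. \<forall>y\<in>scaled_boundary E. x = z + t *\<^sub>R (y - z) \<longrightarrow> \<phi> x = \<rho> t * 1"
    using xi_point by auto
qed

lemma duffy_space_weak_gradient:
  assumes "\<phi> \<in> duffy_space S z E k" obtains g where "has_weak_gradient S \<phi> g"
proof -
  obtain n :: nat and F where phi: "\<phi> = (\<lambda>x. \<Sum>i<n. F i x)" and F: "\<forall>i<n. F i \<in> duffy_functions S z E k"
    using assms unfolding duffy_space_def by blast
  have "\<exists>g. has_weak_gradient S (\<lambda>x. \<Sum>i<m. F i x) g" if "m \<le> n" for m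
    using that
  proof (induction m)
    case 0
    then show ?case using has_weak_gradient_const[of 0] by auto
  next
    case (Suc m)
    then obtain g where g: "has_weak_gradient S (\<lambda>x. \<Sum>i<m. F i x) g" by auto
    have "F m \<in> H1 S" using F Suc.prems by (auto simp: duffy_functions_def)
    then obtain g' where "has_weak_gradient S (F m) g'" by (auto simp: H1_def)
    from has_weak_gradient_add[OF S_sets(3) g this] show ?case by auto
  qed
  then show ?thesis using that phi by blast
qed

lemma duffy_space_0_radial:
  assumes "\<psi> \<in> duffy_space S z E 0" obtains \<rho> where "AE x in lebesgue_on S. \<psi> x = \<rho> (\<xi> x)"
proof -
  obtain n :: nat and F where psi: "\<psi> = (\<lambda>x. \<Sum>i<n. F i x)" and F: "\<forall>i<n. F i \<in> duffy_functions S z E 0"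
    using assms unfolding duffy_space_def by blast
  define R where "R i = (SOME \<rho>. AE x in lebesgue_on S. F i x = \<rho> (\<xi> x))" for i
  have R: "AE x in lebesgue_on S. F i x = R i (\<xi> x)" if i: "i < n" for i
  proof -
    have "F i \<in> duffy_functions S z E 0" using F i by blast
    then obtain \<rho> \<alpha> where "\<alpha> \<in> trace_space E 0" "radial_extension S z E \<rho> \<alpha> (F i)"
      unfolding duffy_functions_def by blast
    then obtain \<rho>' where "AE x in lebesgue_on S. F i x = \<rho>' (\<xi> x)"
      by (rule radial_extension_constant_trace)
    then have "\<exists>\<rho>. AE x in lebesgue_on S. F i x = \<rho> (\<xi> x)" by blast
    from someI_ex[OF this] show ?thesis unfolding R_def .
  qed
  have "AE x in lebesgue_on S. \<forall>i\<in>{..<n}. F i x = R i (\<xi> x)"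
    using R by (intro AE_finite_allI) auto
  then have "AE x in lebesgue_on S. \<psi> x = (\<Sum>i<n. R i (\<xi> x))"
    unfolding psi by eventually_elim (intro sum.cong, auto)
  then show ?thesis by (rule that)
qed

lemma tail_integral_duffy:
  assumes r[measurable]: "r \<in> borel_measurable borel" and r2: "integrable \<nu> (\<lambda>t. (r t)\<^sup>2)"
  shows "(\<lambda>x. tail_integral r (\<xi> x)) \<in> duffy_functions S z E k"
proof -
  have "(\<lambda>x. tail_integral r (\<xi> x)) \<in> H1 S"
    unfolding H1_def using radial_weak_gradient[OF assms] by blast
  moreover have "(\<lambda>_. 1) \<in> trace_space E k" by (rule constant_trace_in_trace_space) simp
  moreover have "radial_extension S z E (tail_integral r) (\<lambda>_. 1) (\<lambda>x. tail_integral r (\<xi> x))"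
    by (rule radial_extension_radial) simp
  ultimately show ?thesis unfolding duffy_functions_def by blast
qed

section \<open>Flux densities, orthogonality and decomposition\<close>

lemma normal_flux_square_integrable:
  assumes "square_integrable S g"
  shows "(\<lambda>x. g x \<bullet> G x) \<in> borel_measurable (lebesgue_on S)" "integrable (lebesgue_on S) (\<lambda>x. (g x \<bullet> G x)\<^sup>2)"
proof -
  have gm: "g \<in> borel_measurable (lebesgue_on S)" and gi: "integrable (lebesgue_on S) (\<lambda>x. (norm (g x))\<^sup>2)"
    using assms by (auto simp: square_integrable_def)
  show m: "(\<lambda>x. g x \<bullet> G x) \<in> borel_measurable (lebesgue_on S)"
    by (intro borel_measurable_inner gm measurable_lebesgue_on_S) simp
  show "integrable (lebesgue_on S) (\<lambda>x. (g x \<bullet> G x)\<^sup>2)"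
  proof (rule Bochner_Integration.integrable_bound)
    show "integrable (lebesgue_on S) (\<lambda>x. nrm_bound\<^sup>2 * (norm (g x))\<^sup>2)" using gi by simp
    show "(\<lambda>x. (g x \<bullet> G x)\<^sup>2) \<in> borel_measurable (lebesgue_on S)" using m by measurable
    show "AE x in lebesgue_on S. norm ((g x \<bullet> G x)\<^sup>2) \<le> norm (nrm_bound\<^sup>2 * (norm (g x))\<^sup>2)"
    proof (rule AE_I2)
      fix x
      have "\<bar>g x \<bullet> G x\<bar> \<le> norm (g x) * norm (G x)" by (rule Cauchy_Schwarz_ineq2)
      also have "\<dots> \<le> norm (g x) * nrm_bound" by (intro mult_left_mono norm_G_bound) simp
      also have "\<dots> \<le> \<bar>nrm_bound * norm (g x)\<bar>" by (simp add: mult.commute)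
      finally have "(g x \<bullet> G x)\<^sup>2 \<le> (nrm_bound * norm (g x))\<^sup>2" by (rule abs_le_square_iff[THEN iffD1])
      then show "norm ((g x \<bullet> G x)\<^sup>2) \<le> norm (nrm_bound\<^sup>2 * (norm (g x))\<^sup>2)" by (simp add: power_mult_distrib)
    qed
  qed
qed

text \<open>The function \<open>h\<close> is the normal flux of \<open>g\<close> through the scaled copies of the boundary,
  normalized by the push-forward of the volume.\<close>

lemma flux_density:
  assumes "square_integrable S g"
  shows "\<exists>h. h \<in> borel_measurable borel \<and> integrable \<nu> (\<lambda>t. (h t)\<^sup>2) \<and>
    (\<forall>f. f \<in> borel_measurable borel \<longrightarrow> integrable \<nu> (\<lambda>t. (f t)\<^sup>2) \<longrightarrow>
       (LINT x|lebesgue_on S. g x \<bullet> (f (\<xi> x) *\<^sub>R G x)) = (LINT t|\<nu>. h t * f t))"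
proof -
  obtain h where h: "h \<in> borel_measurable borel" "integrable \<nu> (\<lambda>t. (h t)\<^sup>2)"
    "\<And>f::real \<Rightarrow> real. f \<in> borel_measurable borel \<Longrightarrow> integrable \<nu> (\<lambda>t. (f t)\<^sup>2) \<Longrightarrow>
       (LINT x|lebesgue_on S. (g x \<bullet> G x) * f (\<xi> x)) = (LINT t|\<nu>. h t * f t)"
    using finite_measure.pushforward_density[OF finite_measure_S xi_measurable_S normal_flux_square_integrable[OF assms]]
    unfolding \<nu>_def[symmetric] by blast
  have "(LINT x|lebesgue_on S. g x \<bullet> (f (\<xi> x) *\<^sub>R G x)) = (LINT t|\<nu>. h t * f t)"
    if "f \<in> borel_measurable borel" "integrable \<nu> (\<lambda>t. (f t)\<^sup>2)" for f
    using h(3)[OF that] by (simp add: mult.commute)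
  with h(1,2) show ?thesis by blast
qed

text \<open>Testing with profiles that vanish at both ends determines \<open>weight * h\<close> only
  up to a constant. This constant is all that the two end conditions in the definition of the SBFEM
  space leave open; once it is zero, arbitrary profiles may be inserted.\<close>

lemma sbfem_flux_zero:
  assumes phi: "\<phi> \<in> sbfem_space S z E k" and g: "has_weak_gradient S \<phi> g"
    and f: "f \<in> borel_measurable borel" "integrable \<nu> (\<lambda>t. (f t)\<^sup>2)"
  shows "(LINT x|lebesgue_on S. g x \<bullet> (f (\<xi> x) *\<^sub>R G x)) = 0"
proof -
  have sq: "square_integrable S g" using g by (simp add: has_weak_gradient_def)
  obtain h where h[measurable]: "h \<in> borel_measurable borel" and h2: "integrable \<nu> (\<lambda>t. (h t)\<^sup>2)"
    and hh: "\<And>f. f \<in> borel_measurable borel \<Longrightarrow> integrable \<nu> (\<lambda>t. (f t)\<^sup>2) \<Longrightarrow>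
       (LINT x|lebesgue_on S. g x \<bullet> (f (\<xi> x) *\<^sub>R G x)) = (LINT t|\<nu>. h t * f t)"
    using flux_density[OF sq] by blast
  have h1: "integrable \<nu> h" by (rule square_integrable_imp_integrable_nu[OF h h2])
  have wh: "integrable lborel (\<lambda>t. weight t * h t)" using h1 by (simp add: integral_nu_weight)
  obtain c where c: "AE t in lebesgue. t \<in> {0<..<1} \<longrightarrow> weight t * h t = c"
  proof (rule AE_const_if_derivative_tests_zero)
    fix a b :: real
    show "set_integrable lebesgue {a..b} (\<lambda>t. weight t * h t)"
      unfolding set_integrable_def
      by (intro integrable_lborel_imp_lebesgue integrable_mult_indicator wh) simp
  next
    fix \<kappa> \<kappa>' :: "real \<Rightarrow> real" assume k: "test_function {0<..<1} \<kappa> \<kappa>'"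
    obtain a b where k1: "C1_with_gradient \<kappa> \<kappa>'" and ab: "0 < a" "b < 1" "\<And>t. t \<notin> {a..b} \<Longrightarrow> \<kappa> t = 0" "\<And>t. t \<notin> {a..b} \<Longrightarrow> \<kappa>' t = 0"
      and bd: "\<exists>B. \<forall>t. \<bar>\<kappa>' t\<bar> \<le> B"
      using unit_test_functionE[OF k] by metis
    obtain B where B: "\<And>t. \<bar>\<kappa>' t\<bar> \<le> B" using bd by blast
    have km[measurable]: "\<kappa>' \<in> borel_measurable borel"
      using C1_with_gradientD(2)[OF k1] by (rule borel_measurable_continuous_onI)
    have k2: "integrable \<nu> (\<lambda>t. (\<kappa>' t)\<^sup>2)"
    proof (rule finite_measure.integrable_const_bound[OF finite_measure_nu])
      show "AE t in \<nu>. norm ((\<kappa>' t)\<^sup>2) \<le> B\<^sup>2"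
        using B by (intro AE_I2) (simp add: abs_le_square_iff[symmetric] order_trans[OF _ abs_ge_self])
    qed measurable
    \<comment> \<open>\<open>\<kappa>\<close> vanishes at 1 and near 0, so
      \<open>\<kappa> \<circ> \<xi>\<close> satisfies both end conditions, and it serves as the
      continuous representative at \<open>z\<close>.\<close>
    have tail: "tail_integral \<kappa>' t = \<kappa> t" if "t \<le> 1" for t
      using tail_integral_antiderivative[OF k1 that] ab(2) ab(3)[of 1] by simp
    let ?\<psi> = "\<lambda>x. tail_integral \<kappa>' (\<xi> x)"
    have wg: "has_weak_gradient S ?\<psi> (\<lambda>x. \<kappa>' (\<xi> x) *\<^sub>R G x)" by (rule radial_weak_gradient[OF km k2])
    have "?\<psi> \<in> duffy_space_00 S z E"
    proof -
      have "?\<psi> \<in> H1 S" using wg by (auto simp: H1_def)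
      moreover have "(\<lambda>_. 1) \<in> trace_space E 0" by (rule constant_trace_in_trace_space) simp
      moreover have "radial_extension S z E (tail_integral \<kappa>') (\<lambda>_. 1) ?\<psi>"
        by (rule radial_extension_radial) simp
      moreover have "continuous_on {0<..1} (tail_integral \<kappa>')"
        by (rule continuous_on_eq[OF C1_with_gradientD(4)[OF k1]]) (simp add: tail)
      moreover have "tail_integral \<kappa>' 1 = 0" using tail[of 1] ab(2) ab(3)[of 1] by simp
      ultimately show ?thesis unfolding duffy_space_00_def by blast
    qed
    moreover have "vanishes_at S z ?\<psi>"
      unfolding vanishes_at_def
    proof (intro exI conjI)
      show "AE x in lebesgue_on S. \<kappa> (\<xi> x) = ?\<psi> x"
        using tail xi_range(2) by (intro AE_I2) simp
      have "continuous_on UNIV (\<lambda>x. \<kappa> (\<xi> x))"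
        by (rule continuous_on_compose2[OF C1_with_gradientD(3)[OF k1] continuous_xi]) simp
      then show "continuous (at z within S) (\<lambda>x. \<kappa> (\<xi> x))"
        by (simp add: continuous_on_eq_continuous_at continuous_at_imp_continuous_within)
      show "\<kappa> (\<xi> z) = 0" using xi_apex ab(1) ab(3)[of 0] by simp
    qed
    ultimately have "grad_inner S \<phi> ?\<psi> = 0" using phi by (simp add: sbfem_space_def)
    then have "(LINT x|lebesgue_on S. g x \<bullet> (\<kappa>' (\<xi> x) *\<^sub>R G x)) = 0"
      using grad_inner_S[OF g wg] by simp
    then have "(LINT t|\<nu>. h t * \<kappa>' t) = 0" using hh[OF km k2] by simp
    moreover have "(LINT t|\<nu>. h t * \<kappa>' t) = (LINT t|lborel. weight t * (h t * \<kappa>' t))"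
      by (rule integral_nu_weight(1)) measurable
    ultimately have "(LINT t|lborel. \<kappa>' t * (weight t * h t)) = 0" by (simp add: mult_ac)
    then show "(LINT t|lebesgue. \<kappa>' t * (weight t * h t)) = 0"
      by (subst integral_completion) auto
  qed
  have "c = 0"
  proof -
    text \<open>A constant flux \<open>c\<close> has energy at least \<open>c\<^sup>2\<close> times the integral of \<open>t\<^sup>1\<^sup>-\<^sup>d\<close>, which
      is infinite for \<open>d \<ge> 2\<close>.\<close>
    have i: "integrable lborel (\<lambda>t. weight t * (h t)\<^sup>2)" using h2 by (simp add: integral_nu_weight)
    have "c\<^sup>2 / (vol * DIM('a)) \<le> 0"
    proof (rule inverse_not_integrable_near_0[OF i])
      show "0 \<le> weight t * (h t)\<^sup>2" for t using weight_nonneg by simp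
      have "AE t in lborel. t \<in> {0<..<1} \<longrightarrow> weight t * h t = c" using c by (simp add: AE_completion_iff)
      then show "AE t in lborel. t \<in> {0<..<1} \<longrightarrow> c\<^sup>2 / (vol * DIM('a)) / t \<le> weight t * (h t)\<^sup>2"
      proof eventually_elim
        case (elim t)
        show ?case
        proof
          assume t: "t \<in> {0<..<1}"
          then have w: "0 < weight t" "weight t * h t = c" using weight_pos[of t] elim by auto
          \<comment> \<open>Here \<open>d \<ge> 2\<close> decides: the energy density
            \<open>c^2 / weight t\<close> is at least a multiple of \<open>1 / t\<close>. For
            exponent 0 a constant flux would have finite energy.\<close>
          have "t ^ (DIM('a) - 1) \<le> t ^ 1" using t dim_ge_2 by (intro power_decreasing) auto
          then have "weight t \<le> vol * DIM('a) * t" using t vol_pos by (simp add: weight_eq)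
          then have "c\<^sup>2 / (vol * DIM('a) * t) \<le> c\<^sup>2 / weight t"
            using w(1) by (intro divide_left_mono) (auto intro!: mult_pos_pos vol_pos simp: t[simplified])
          also have "\<dots> = weight t * (h t)\<^sup>2" using w by (simp add: power2_eq_square flip: w(2))
          finally show "c\<^sup>2 / (vol * DIM('a)) / t \<le> weight t * (h t)\<^sup>2" by simp
        qed
      qed
    qed
    moreover have "0 < vol * real DIM('a)" using vol_pos by simp
    ultimately have "c\<^sup>2 \<le> 0" by (simp only: divide_le_0_iff) linarith
    then show ?thesis by simp
  qed
  have "(LINT x|lebesgue_on S. g x \<bullet> (f (\<xi> x) *\<^sub>R G x)) = (LINT t|\<nu>. h t * f t)" by (rule hh[OF f])
  also have "\<dots> = (LINT t|lborel. weight t * (h t * f t))" by (rule integral_nu_weight(1)) (use f in measurable)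
  also have "\<dots> = 0"
  proof (rule integral_eq_zero_AE)
    have "AE t in lborel. t \<in> {0<..<1} \<longrightarrow> weight t * h t = c" using c by (simp add: AE_completion_iff)
    moreover have "AE t in lborel. t \<noteq> 0" "AE t in lborel. t \<noteq> (1::real)" by (rule AE_lborel_singleton)+
    ultimately show "AE t in lborel. weight t * (h t * f t) = 0"
    proof eventually_elim
      case (elim t)
      then show ?case using \<open>c = 0\<close> weight_zero[of t] by (cases "t \<in> {0..1}") auto
    qed
  qed
  finally show ?thesis .
qed

lemma sbfem_orthogonal:
  assumes phi: "\<phi> \<in> sbfem_space S z E k" and psi: "\<psi> \<in> duffy_space S z E 0"
  shows "grad_inner S \<phi> \<psi> = 0"
proof -
  have "\<phi> \<in> duffy_space S z E k" using phi by (simp add: sbfem_space_def)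
  then obtain g where g: "has_weak_gradient S \<phi> g" by (rule duffy_space_weak_gradient)
  obtain g' where g': "has_weak_gradient S \<psi> g'" by (rule duffy_space_weak_gradient[OF psi])
  obtain \<rho> where rho: "AE x in lebesgue_on S. \<psi> x = \<rho> (\<xi> x)" by (rule duffy_space_0_radial[OF psi])
  obtain r where r[measurable]: "r \<in> borel_measurable borel" and r2: "integrable \<nu> (\<lambda>t. (r t)\<^sup>2)"
    and ae: "AE x in lebesgue_on S. g' x = r (\<xi> x) *\<^sub>R G x"
    by (rule radial_gradient[OF g' rho])
  have "grad_inner S \<phi> \<psi> = (LINT x|lebesgue_on S. g x \<bullet> g' x)" by (rule grad_inner_S[OF g g'])
  also have "\<dots> = (LINT x|lebesgue_on S. g x \<bullet> (r (\<xi> x) *\<^sub>R G x))"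
  proof (rule integral_cong_AE)
    have m: "g \<in> borel_measurable (lebesgue_on S)" "g' \<in> borel_measurable (lebesgue_on S)"
      using g g' by (auto simp: has_weak_gradient_def square_integrable_def)
    have "(\<lambda>x. r (\<xi> x) *\<^sub>R G x) \<in> borel_measurable (lebesgue_on S)" by (rule measurable_lebesgue_on_S) measurable
    then show "(\<lambda>x. g x \<bullet> (r (\<xi> x) *\<^sub>R G x)) \<in> borel_measurable (lebesgue_on S)"
      by (rule borel_measurable_inner[OF m(1)])
    show "(\<lambda>x. g x \<bullet> g' x) \<in> borel_measurable (lebesgue_on S)"
      by (rule borel_measurable_inner[OF m])
    show "AE x in lebesgue_on S. g x \<bullet> g' x = g x \<bullet> (r (\<xi> x) *\<^sub>R G x)"
      using ae by eventually_elim simp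
  qed
  also have "\<dots> = 0" by (rule sbfem_flux_zero[OF phi g r r2])
  finally show ?thesis .
qed

text \<open>Adding a radial function with derivative \<open>r\<close> to \<open>\<phi>\<close>
  changes the flux density from \<open>h\<close> to \<open>h + A r\<close>, by the constant ratio in
  \<open>G_norm_integral\<close>. Every radial Sobolev function has a gradient along
  \<open>G\<close>, so zero flux density gives orthogonality to all of them.\<close>

lemma duffy_space_decompose:
  assumes phi: "\<phi> \<in> duffy_space S z E k"
  obtains \<chi>1 \<psi> where "\<chi>1 \<in> sbfem_space S z E k" "\<psi> \<in> duffy_space S z E 0" "\<phi> = (\<lambda>x. \<chi>1 x + \<psi> x)"
proof -
  obtain g where g: "has_weak_gradient S \<phi> g" by (rule duffy_space_weak_gradient[OF phi])
  have sq: "square_integrable S g" using g by (simp add: has_weak_gradient_def)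
  obtain h where h[measurable]: "h \<in> borel_measurable borel" and h2: "integrable \<nu> (\<lambda>t. (h t)\<^sup>2)"
    and hh: "\<And>f. f \<in> borel_measurable borel \<Longrightarrow> integrable \<nu> (\<lambda>t. (f t)\<^sup>2) \<Longrightarrow>
       (LINT x|lebesgue_on S. g x \<bullet> (f (\<xi> x) *\<^sub>R G x)) = (LINT t|\<nu>. h t * f t)"
    using flux_density[OF sq] by blast
  obtain A where A: "0 < A" "\<And>F::real \<Rightarrow> real. F \<in> borel_measurable borel \<Longrightarrow> integrable \<nu> F \<Longrightarrow>
    (LINT x|lebesgue_on S. (G x \<bullet> G x) * F (\<xi> x)) = A * (LINT t|\<nu>. F t)"
    using G_norm_integral by blast
  \<comment> \<open>The solution of \<open>h + A r = 0\<close>; it inherits square integrability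
    from \<open>h\<close>, so it is the derivative of an admissible profile.\<close>
  define r where "r t = - h t / A" for t
  have r[measurable]: "r \<in> borel_measurable borel" unfolding r_def by measurable
  have r2: "integrable \<nu> (\<lambda>t. (r t)\<^sup>2)" unfolding r_def power_divide using h2 by simp
  let ?T = "\<lambda>x. tail_integral r (\<xi> x)"
  have wgT: "has_weak_gradient S ?T (\<lambda>x. r (\<xi> x) *\<^sub>R G x)" by (rule radial_weak_gradient[OF r r2])
  let ?\<phi> = "\<lambda>x. \<phi> x + ?T x"
  have wg: "has_weak_gradient S ?\<phi> (\<lambda>x. g x + r (\<xi> x) *\<^sub>R G x)"
    by (rule has_weak_gradient_add[OF S_sets(3) g wgT])
  have "grad_inner S ?\<phi> \<psi> = 0" if psi: "\<psi> \<in> duffy_space_00 S z E" for \<psi>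
  proof -
    obtain g' where g': "has_weak_gradient S \<psi> g'" using psi by (auto simp: duffy_space_00_def H1_def)
    obtain \<rho> \<alpha> where "\<alpha> \<in> trace_space E 0" "radial_extension S z E \<rho> \<alpha> \<psi>"
      using psi by (auto simp: duffy_space_00_def)
    then obtain \<rho>' where "AE x in lebesgue_on S. \<psi> x = \<rho>' (\<xi> x)"
      by (rule radial_extension_constant_trace)
    then obtain f where f[measurable]: "f \<in> borel_measurable borel" and f2: "integrable \<nu> (\<lambda>t. (f t)\<^sup>2)"
      and ae: "AE x in lebesgue_on S. g' x = f (\<xi> x) *\<^sub>R G x"
      by (rule radial_gradient[OF g'])
    have rf: "integrable \<nu> (\<lambda>t. r t * f t)" by (rule integrable_mult_of_squares[OF _ _ r2 f2]) measurable
    have m: "g \<in> borel_measurable (lebesgue_on S)" "g' \<in> borel_measurable (lebesgue_on S)"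
      using g g' by (auto simp: has_weak_gradient_def square_integrable_def)
    have mG: "(\<lambda>x. f (\<xi> x) *\<^sub>R G x) \<in> borel_measurable (lebesgue_on S)" "(\<lambda>x. r (\<xi> x) *\<^sub>R G x) \<in> borel_measurable (lebesgue_on S)"
      by (rule measurable_lebesgue_on_S; measurable)+
    have i1: "integrable (lebesgue_on S) (\<lambda>x. g x \<bullet> (f (\<xi> x) *\<^sub>R G x))"
    proof -
      have "integrable (lebesgue_on S) (\<lambda>x. (g x \<bullet> G x) * f (\<xi> x))"
        using f2 by (intro integrable_mult_of_squares normal_flux_square_integrable[OF sq] measurable_lebesgue_on_S)
          (auto simp: integrable_nu_iff)
      then show ?thesis by (simp add: mult.commute)
    qed
    have i2: "integrable (lebesgue_on S) (\<lambda>x. (G x \<bullet> G x) * (r (\<xi> x) * f (\<xi> x)))"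
    proof -
      have i: "integrable (lebesgue_on S) (\<lambda>x. r (\<xi> x) * f (\<xi> x))"
        using rf integrable_nu_iff(1)[of "\<lambda>t. r t * f t"] by simp
      have bound: "\<bar>G x \<bullet> G x\<bar> \<le> nrm_bound\<^sup>2" for x
        using power_mono[OF norm_G_bound norm_ge_zero, of x 2] by (simp add: power2_norm_eq_inner)
      have "integrable (lebesgue_on S) (\<lambda>x. (r (\<xi> x) * f (\<xi> x)) * (G x \<bullet> G x))"
        by (rule integrable_mult_bounded[OF i _ bound]) (rule measurable_lebesgue_on_S, measurable)
      then show ?thesis by (subst mult.commute)
    qed
    have "grad_inner S ?\<phi> \<psi> = (LINT x|lebesgue_on S. (g x + r (\<xi> x) *\<^sub>R G x) \<bullet> g' x)"
      by (rule grad_inner_S[OF wg g'])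
    also have "\<dots> = (LINT x|lebesgue_on S. g x \<bullet> (f (\<xi> x) *\<^sub>R G x) + (G x \<bullet> G x) * (r (\<xi> x) * f (\<xi> x)))"
    proof (rule integral_cong_AE)
      show "(\<lambda>x. (g x + r (\<xi> x) *\<^sub>R G x) \<bullet> g' x) \<in> borel_measurable (lebesgue_on S)"
        by (intro borel_measurable_inner borel_measurable_add m mG)
      show "(\<lambda>x. g x \<bullet> (f (\<xi> x) *\<^sub>R G x) + (G x \<bullet> G x) * (r (\<xi> x) * f (\<xi> x))) \<in> borel_measurable (lebesgue_on S)"
        using i1 i2 by (intro borel_measurable_add borel_measurable_integrable)
      show "AE x in lebesgue_on S. (g x + r (\<xi> x) *\<^sub>R G x) \<bullet> g' x = g x \<bullet> (f (\<xi> x) *\<^sub>R G x) + (G x \<bullet> G x) * (r (\<xi> x) * f (\<xi> x))"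
        using ae by eventually_elim (simp add: inner_add_left distrib_left mult_ac)
    qed
    also have "\<dots> = (LINT x|lebesgue_on S. g x \<bullet> (f (\<xi> x) *\<^sub>R G x)) + (LINT x|lebesgue_on S. (G x \<bullet> G x) * (r (\<xi> x) * f (\<xi> x)))"
      by (rule Bochner_Integration.integral_add[OF i1 i2])
    also have "\<dots> = (LINT t|\<nu>. h t * f t) + A * (LINT t|\<nu>. r t * f t)"
      using hh[OF f f2] A(2)[OF _ rf] by simp
    also have "(LINT t|\<nu>. r t * f t) = - (LINT t|\<nu>. h t * f t) / A"
    proof -
      have "(\<lambda>t. r t * f t) = (\<lambda>t. (- 1 / A) * (h t * f t))" by (simp add: r_def fun_eq_iff)
      then show ?thesis by (simp only: integral_mult_right_zero) simp
    qed
    finally show ?thesis using A(1) by simp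
  qed
  moreover have "?\<phi> \<in> duffy_space S z E k"
    by (rule duffy_space_add_function[OF phi tail_integral_duffy[OF r r2]])
  ultimately have "?\<phi> \<in> sbfem_space S z E k" by (simp add: sbfem_space_def)
  \<comment> \<open>The correction is undone by the antiderivative of \<open>- r\<close>, since
    \<open>tail_integral\<close> is odd in its integrand. The radial summand is thus a single Duffy
    function with trace 1.\<close>
  moreover have "(\<lambda>x. tail_integral (\<lambda>t. - r t) (\<xi> x)) \<in> duffy_space S z E 0"
    by (rule subsetD[OF duffy_functions_subset_space tail_integral_duffy]) (use r2 in auto)
  moreover have "\<phi> = (\<lambda>x. ?\<phi> x + tail_integral (\<lambda>t. - r t) (\<xi> x))"
    by (simp add: tail_integral_def fun_eq_iff)
  ultimately show ?thesis by (rule that)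
qed

end

theorem proposition3p1:
  fixes S :: "(real ^ 'n) set" and z :: "real ^ 'n" and E :: "(real ^ 'n) facet set" and k :: nat
  assumes "CARD('n) = 2 \<or> CARD('n) = 3"
    and "S_element S z E"
  shows "(\<forall>\<phi>\<in>sbfem_space S z E k. \<forall>\<psi>\<in>duffy_space S z E 0. grad_inner S \<phi> \<psi> = 0) \<and>
    grad_orthogonal_sum S (duffy_space S z E k) (sbfem_space S z E k) (duffy_space S z E 0)"
proof -
  interpret scaled_element S z E by unfold_locales (rule assms(2))
  have orth: "\<forall>\<phi>\<in>sbfem_space S z E k. \<forall>\<psi>\<in>duffy_space S z E 0. grad_inner S \<phi> \<psi> = 0"
    using sbfem_orthogonal by blast
  have "duffy_space S z E k = {(\<lambda>x. \<phi> x + \<psi> x) | \<phi> \<psi>. \<phi> \<in> sbfem_space S z E k \<and> \<psi> \<in> duffy_space S z E 0}"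
  proof (intro equalityI subsetI)
    fix \<phi> assume "\<phi> \<in> duffy_space S z E k"
    then show "\<phi> \<in> {(\<lambda>x. \<phi> x + \<psi> x) | \<phi> \<psi>. \<phi> \<in> sbfem_space S z E k \<and> \<psi> \<in> duffy_space S z E 0}"
      using duffy_space_decompose by blast
  next
    fix f assume "f \<in> {(\<lambda>x. \<phi> x + \<psi> x) | \<phi> \<psi>. \<phi> \<in> sbfem_space S z E k \<and> \<psi> \<in> duffy_space S z E 0}"
    then obtain \<phi> \<psi> where f: "f = (\<lambda>x. \<phi> x + \<psi> x)" "\<phi> \<in> sbfem_space S z E k" "\<psi> \<in> duffy_space S z E 0"
      by blast
    then have "\<phi> \<in> duffy_space S z E k" "\<psi> \<in> duffy_space S z E k"
      using duffy_space_0_subset[of S z E k] by (auto simp: sbfem_space_def)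
    then show "f \<in> duffy_space S z E k" unfolding f(1) by (rule duffy_space_add)
  qed
  then show ?thesis using orth by (simp add: grad_orthogonal_sum_def)
qed

end
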